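(* Let $p$ be an odd prime. There is a unique pseudo-measure $\zeta_p$ on $\mathbf{Z}_p^\times$ such that, for all integers $k>0$, $$\int_{\mathbf{Z}_p^\times} x^k\cdot \zeta_p = (1-p^{k-1})\,\zeta(1-k),$$ where $\zeta$ is the Riemann zeta function.
   Context: Fix a finite extension $L/\mathbf{Q}_p$ with ring of integers $\mathcal{O}_L$ (for instance $L=\mathbf{Q}_p$). For a profinite abelian group $G$, the Iwasawa algebra is $\Lambda(G)=\varprojlim_H \mathcal{O}_L[G/H]$ ($H$ running over open subgroups). It is identified with the algebra of $\mathcal{O}_L$-valued measures on $G$, i.e. continuous $\mathcal{O}_L$-linear functionals $\phi\mapsto\int_G\phi\cdot\mu$ on the continuous functions $G\to\mathcal{O}_L$, with product given by convolution; the group element $[g]$ corresponds to the Dirac measure $\phi\mapsto\phi(g)$. Measures also integrate continuous $\mathbf{C}_p$-valued functions. Let $Q(G)$ be the total ring of fractions of $\Lambda(G)$. A pseudo-measure on $G$ is an element $\lambda\in Q(G)$ with $([g]-[1])\lambda\in\Lambda(G)$ for all $g\in G$. For a pseudo-measure $\lambda$ and a non-trivial continuous character $\chi:G\to\mathbf{C}_p^\times$, define $\int_G\chi\cdot\lambda := (\chi(g)-1)^{-1}\int_G\chi\cdot([g]-[1])\lambda$ for any $g\in G$ with $\chi(g)\ne 1$ (this is independent of $g$). The values $\zeta(1-k)$, $k\geq 1$, are rational numbers, viewed in $\mathbf{Q}_p$. *)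

theory Defs
  imports "HOL-Complex_Analysis.Complex_Analysis" "HOL-Algebra.Ring"
begin

section \<open>Finite extensions of the field of p-adic numbers\<close>

text \<open>
  A finite extension L of the p-adic numbers is given as a field type \<^typ>\<open>'a\<close> carrying the metric
  \<open>dist x y = |x - y|\<close> of its absolute value, normalised so that \<open>|p| = 1/p\<close>; the absolute value is
  recovered as the distance to 0 (the class constraint on \<^const>\<open>norm\<close> excludes non-archimedean
  fields). These conditions force its restriction to the rationals to be the p-adic absolute
  value, so the closure of the rationals, once complete, is their p-adic completion.
\<close>

definition absval :: "'a::{field_char_0,metric_space} \<Rightarrow> real" where
  "absval x = dist x 0"

definition Qp :: "'a::{field_char_0,metric_space} set" where
  "Qp = closure (range of_rat)"

definition finite_extension_Qp :: "nat \<Rightarrow> 'a::{field_char_0,metric_space} itself \<Rightarrow> bool"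
  where "finite_extension_Qp p L \<longleftrightarrow>
    (\<forall>x y :: 'a. dist x y = absval (x - y)) \<and>
    (\<forall>x y :: 'a. absval (x * y) = absval x * absval y) \<and>
    (\<forall>x y :: 'a. absval (x + y) \<le> max (absval x) (absval y)) \<and>
    absval (of_nat p :: 'a) = 1 / real p \<and>
    complete (Qp :: 'a set) \<and>
    (\<exists>B :: 'a set. finite B \<and>
      (\<forall>x. \<exists>c :: 'a \<Rightarrow> 'a. (\<forall>b\<in>B. c b \<in> Qp) \<and> x = (\<Sum>b\<in>B. c b * b)))"

definition ring_of_integers :: "'a::{field_char_0,metric_space} set" where
  "ring_of_integers = {x. absval x \<le> 1}"

definition Zp :: "'a::{field_char_0,metric_space} set" where
  "Zp = Qp \<inter> ring_of_integers"

definition Zp_units :: "'a::{field_char_0,metric_space} monoid" where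
  "Zp_units = \<lparr>carrier = {x \<in> Zp. \<exists>y\<in>Zp. x * y = 1}, mult = (*), one = 1\<rparr>"


section \<open>The Iwasawa algebra as the algebra of measures\<close>

text \<open>
  A topological group G carries the topology induced on its carrier by the type of its elements.
  Functions on G, and functionals on them, are extensional (\<^const>\<open>undefined\<close> off their domain),
  so that equality of measures is equality of terms.
\<close>

definition continuous_functions ::
    "'g::topological_space monoid \<Rightarrow> ('g \<Rightarrow> 'a::{field_char_0,metric_space}) set" where
  "continuous_functions G =
    {\<phi> \<in> carrier G \<rightarrow>\<^sub>E ring_of_integers. continuous_on (carrier G) \<phi>}"

text \<open>The last condition is continuity for the topology of uniform convergence.\<close>

definition measures_on :: "'g::topological_space monoid
    \<Rightarrow> (('g \<Rightarrow> 'a::{field_char_0,metric_space}) \<Rightarrow> 'a) set" where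
  "measures_on G =
    {\<mu> \<in> continuous_functions G \<rightarrow>\<^sub>E ring_of_integers.
      (\<forall>\<phi>\<in>continuous_functions G. \<forall>\<psi>\<in>continuous_functions G.
        \<mu> (\<lambda>x\<in>carrier G. \<phi> x + \<psi> x) = \<mu> \<phi> + \<mu> \<psi>) \<and>
      (\<forall>c\<in>ring_of_integers. \<forall>\<phi>\<in>continuous_functions G.
        \<mu> (\<lambda>x\<in>carrier G. c * \<phi> x) = c * \<mu> \<phi>) \<and>
      (\<forall>\<phi>\<in>continuous_functions G. \<forall>\<epsilon>>0. \<exists>\<delta>>0. \<forall>\<psi>\<in>continuous_functions G.
        (\<forall>x\<in>carrier G. dist (\<psi> x) (\<phi> x) < \<delta>) \<longrightarrow> dist (\<mu> \<psi>) (\<mu> \<phi>) < \<epsilon>)}"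

definition measure_integral :: "'g::topological_space monoid
    \<Rightarrow> (('g \<Rightarrow> 'a::{field_char_0,metric_space}) \<Rightarrow> 'a) \<Rightarrow> ('g \<Rightarrow> 'a) \<Rightarrow> 'a" where
  "measure_integral G \<mu> \<phi> = \<mu> (restrict \<phi> (carrier G))"

definition dirac :: "'g::topological_space monoid \<Rightarrow> 'g
    \<Rightarrow> ('g \<Rightarrow> 'a::{field_char_0,metric_space}) \<Rightarrow> 'a" where
  "dirac G g = (\<lambda>\<phi>\<in>continuous_functions G. \<phi> g)"

definition convolution :: "'g::topological_space monoid
    \<Rightarrow> (('g \<Rightarrow> 'a::{field_char_0,metric_space}) \<Rightarrow> 'a) \<Rightarrow> (('g \<Rightarrow> 'a) \<Rightarrow> 'a)
    \<Rightarrow> ('g \<Rightarrow> 'a) \<Rightarrow> 'a" where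
  "convolution G \<mu> \<nu> = (\<lambda>\<phi>\<in>continuous_functions G.
    measure_integral G \<mu> (\<lambda>x. measure_integral G \<nu> (\<lambda>y. \<phi> (x \<otimes>\<^bsub>G\<^esub> y))))"

definition iwasawa_algebra :: "'g::topological_space monoid
    \<Rightarrow> (('g \<Rightarrow> 'a::{field_char_0,metric_space}) \<Rightarrow> 'a) ring" where
  "iwasawa_algebra G =
    \<lparr>carrier = measures_on G,
     mult = convolution G,
     one = dirac G \<one>\<^bsub>G\<^esub>,
     zero = (\<lambda>\<phi>\<in>continuous_functions G. 0),
     add = (\<lambda>\<mu> \<nu>. \<lambda>\<phi>\<in>continuous_functions G. \<mu> \<phi> + \<nu> \<phi>)\<rparr>"


section \<open>The total ring of fractions of a commutative ring\<close>

definition regular_elements :: "('r, 'm) ring_scheme \<Rightarrow> 'r set" where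
  "regular_elements R = {s \<in> carrier R. \<forall>a\<in>carrier R. a \<otimes>\<^bsub>R\<^esub> s = \<zero>\<^bsub>R\<^esub> \<longrightarrow> a = \<zero>\<^bsub>R\<^esub>}"

definition fraction_rel :: "('r, 'm) ring_scheme \<Rightarrow> (('r \<times> 'r) \<times> ('r \<times> 'r)) set" where
  "fraction_rel R = {((a, s), (b, t)).
    a \<in> carrier R \<and> s \<in> regular_elements R \<and> b \<in> carrier R \<and> t \<in> regular_elements R \<and>
    a \<otimes>\<^bsub>R\<^esub> t = b \<otimes>\<^bsub>R\<^esub> s}"

definition fraction :: "('r, 'm) ring_scheme \<Rightarrow> 'r \<Rightarrow> 'r \<Rightarrow> ('r \<times> 'r) set" where
  "fraction R a s = fraction_rel R `` {(a, s)}"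

definition total_fraction_ring :: "('r, 'm) ring_scheme \<Rightarrow> ('r \<times> 'r) set ring" where
  "total_fraction_ring R =
    \<lparr>carrier = (carrier R \<times> regular_elements R) // fraction_rel R,
     mult = (\<lambda>X Y. \<Union>(a, s)\<in>X. \<Union>(b, t)\<in>Y. fraction R (a \<otimes>\<^bsub>R\<^esub> b) (s \<otimes>\<^bsub>R\<^esub> t)),
     one = fraction R \<one>\<^bsub>R\<^esub> \<one>\<^bsub>R\<^esub>,
     zero = fraction R \<zero>\<^bsub>R\<^esub> \<one>\<^bsub>R\<^esub>,
     add = (\<lambda>X Y. \<Union>(a, s)\<in>X. \<Union>(b, t)\<in>Y.
       fraction R (a \<otimes>\<^bsub>R\<^esub> t \<oplus>\<^bsub>R\<^esub> b \<otimes>\<^bsub>R\<^esub> s) (s \<otimes>\<^bsub>R\<^esub> t))\<rparr>"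

definition fraction_embed :: "('r, 'm) ring_scheme \<Rightarrow> 'r \<Rightarrow> ('r \<times> 'r) set" where
  "fraction_embed R a = fraction R a \<one>\<^bsub>R\<^esub>"


section \<open>Pseudo-measures\<close>

text \<open>The element ([g] - [1]) \<open>\<xi>\<close> of the total ring of fractions of the Iwasawa algebra.\<close>

definition augmentation_mult :: "'g::topological_space monoid \<Rightarrow> 'g
    \<Rightarrow> ((('g \<Rightarrow> 'a::{field_char_0,metric_space}) \<Rightarrow> 'a) \<times> (('g \<Rightarrow> 'a) \<Rightarrow> 'a)) set
    \<Rightarrow> ((('g \<Rightarrow> 'a) \<Rightarrow> 'a) \<times> (('g \<Rightarrow> 'a) \<Rightarrow> 'a)) set" where
  "augmentation_mult G g \<xi> =
    fraction_embed (iwasawa_algebra G) (dirac G g \<ominus>\<^bsub>iwasawa_algebra G\<^esub> dirac G \<one>\<^bsub>G\<^esub>)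
      \<otimes>\<^bsub>total_fraction_ring (iwasawa_algebra G)\<^esub> \<xi>"

definition pseudo_measures :: "'g::topological_space monoid
    \<Rightarrow> ((('g \<Rightarrow> 'a::{field_char_0,metric_space}) \<Rightarrow> 'a) \<times> (('g \<Rightarrow> 'a) \<Rightarrow> 'a)) set set"
  where "pseudo_measures G =
    {\<xi> \<in> carrier (total_fraction_ring (iwasawa_algebra G)).
      \<forall>g\<in>carrier G. augmentation_mult G g \<xi>
        \<in> fraction_embed (iwasawa_algebra G) ` carrier (iwasawa_algebra G)}"

text \<open>
  For a non-trivial continuous character \<open>\<kappa>\<close> of G with values in the ring of integers of L. The
  measure ([g] - [1]) \<open>\<xi>\<close> is recovered from its image in the total ring of fractions, and g is an
  arbitrary element with \<open>\<kappa>(g) \<noteq> 1\<close>; the value does not depend on its choice.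
\<close>

definition pseudo_measure_integral :: "'g::topological_space monoid
    \<Rightarrow> ((('g \<Rightarrow> 'a::{field_char_0,metric_space}) \<Rightarrow> 'a) \<times> (('g \<Rightarrow> 'a) \<Rightarrow> 'a)) set
    \<Rightarrow> ('g \<Rightarrow> 'a) \<Rightarrow> 'a" where
  "pseudo_measure_integral G \<xi> \<kappa> =
    (let g = (SOME g. g \<in> carrier G \<and> \<kappa> g \<noteq> 1);
         \<mu> = the_inv_into (carrier (iwasawa_algebra G)) (fraction_embed (iwasawa_algebra G))
               (augmentation_mult G g \<xi>)
     in inverse (\<kappa> g - 1) * measure_integral G \<mu> \<kappa>)"


section \<open>The Riemann zeta function\<close>

text \<open>
  The analytic continuation of the Dirichlet series to the complex plane without 1, which
  determines all values except the irrelevant one at 1.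
\<close>

definition riemann_zeta :: "complex \<Rightarrow> complex" where
  "riemann_zeta = (SOME f. f holomorphic_on - {1} \<and>
    (\<forall>s. Re s > 1 \<longrightarrow> (\<lambda>n. 1 / of_nat (Suc n) powr s) sums f s))"

end

theory Submission
  imports Defs "HOL-Number_Theory.Number_Theory"
begin

text \<open>
  Hasse's series \<open>(s - 1) \<zeta>(s) = \<Sum>n. (n + 1)\<^sup>-\<^sup>1 \<Sum>j\<le>n. (-1)\<^sup>j (n choose j) (j + 1)\<^sup>1\<^sup>-\<^sup>s\<close> converges for all s, and
  at \<open>s = 1 - k\<close> it is a finite sum that, by Newton interpolation, is also the p-adic limit of
  \<open>p\<^sup>-\<^sup>N \<Sum>a\<le>p\<^sup>N. a\<^sup>k\<close>. Polynomials without constant term are dense in the continuous functions on the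
  p-adic units, so a measure is determined by its moments of positive order, and the Iwasawa algebra
  is a ring of moment sequences with pointwise operations. For every unit g the regularised Bernoulli
  distribution is a measure \<open>\<mu>\<^sub>g\<close> whose k-th moment is \<open>g\<^sup>k - 1\<close> times the prescribed value, whence
  \<open>([g] - [1]) \<mu>\<^sub>2 = ([2] - [1]) \<mu>\<^sub>g\<close>; since \<open>[2] - [1]\<close> has no vanishing moment it is regular, and
  \<open>\<mu>\<^sub>2 / ([2] - [1])\<close> is the only solution.
\<close>

section \<open>Hasse's globally convergent series for the zeta function\<close>

text \<open>\<open>riemann_zeta\<close> is an arbitrary choice among analytic continuations, so one
  continuation has to be constructed whose values at 1 - k are visibly rational. Hasse's series also
  suits the p-adic side: its coefficients at 1 - k are differences of the powers (j + 1)^k, which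
  likewise expand the power sums behind the p-adic moments, so the complex and the p-adic value are
  the same finite rational sum. Order 0 is left out throughout, since [g] - [1] has total mass 0 and
  a pseudo-measure may have a pole at the trivial character. The remaining monomials still suffice
  because x^m tends to 1 uniformly on the units as m runs through the Euler exponents of p^N. The
  denominator is built from 2 because 2 is a unit for odd p and no positive power of it is
  1.\<close>

text \<open>This is (-1)^n times the n-th forward difference of f at 0. The ring is general because
  the differences occur over the complex numbers and over the rationals.\<close>

definition alt_diff :: "(nat \<Rightarrow> 'a::comm_ring_1) \<Rightarrow> nat \<Rightarrow> 'a" where
  "alt_diff f n = (\<Sum>j\<le>n. (- 1) ^ j * of_nat (n choose j) * f j)"

lemma alt_diff_0 [simp]: "alt_diff f 0 = f 0"
  by (simp add: alt_diff_def)

lemma alt_diff_Suc: "alt_diff f (Suc n) = alt_diff f n - alt_diff (\<lambda>j. f (Suc j)) n"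
proof -
  have "alt_diff f (Suc n) = f 0 + (\<Sum>j\<le>n. (- 1) ^ Suc j * of_nat (Suc n choose Suc j) * f (Suc j))"
    unfolding alt_diff_def by (subst sum.atMost_Suc_shift) simp
  also have "\<dots> = f 0 + (\<Sum>j\<le>n. (- 1) ^ Suc j * of_nat (n choose Suc j) * f (Suc j))
       - alt_diff (\<lambda>j. f (Suc j)) n"
    by (simp add: alt_diff_def algebra_simps sum.distrib sum_negf sum_subtractf)
  also have "f 0 + (\<Sum>j\<le>n. (- 1) ^ Suc j * of_nat (n choose Suc j) * f (Suc j)) =
      (\<Sum>j\<le>Suc n. (- 1) ^ j * of_nat (n choose j) * f j)"
    by (subst sum.atMost_Suc_shift) simp
  also have "\<dots> = alt_diff f n"
    by (simp add: alt_diff_def binomial_eq_0)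
  finally show ?thesis .
qed

text \<open>The alternating binomial transform is its own inverse. The induction on x generalises f,
  since the step applies the hypothesis to the shifted function.\<close>

lemma newton_interpolation:
  "f x = (\<Sum>n\<le>x. (- 1) ^ n * of_nat (x choose n) * alt_diff f n)"
proof (induction x arbitrary: f)
  case (Suc x)
  let ?D = "alt_diff f"
  have "f (Suc x) = (\<Sum>n\<le>x. (- 1) ^ n * of_nat (x choose n) * (?D n - ?D (Suc n)))"
    using Suc.IH[of "\<lambda>j. f (Suc j)"] by (simp add: alt_diff_Suc)
  also have "\<dots> = (\<Sum>n\<le>x. (- 1) ^ n * of_nat (x choose n) * ?D n)
      + (\<Sum>n\<le>x. (- 1) ^ Suc n * of_nat (x choose n) * ?D (Suc n))"
    by (simp add: algebra_simps sum.distrib sum_negf sum_subtractf)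
  also have "(\<Sum>n\<le>x. (- 1) ^ n * of_nat (x choose n) * ?D n) =
      (\<Sum>n\<le>Suc x. (- 1) ^ n * of_nat (x choose n) * ?D n)"
    by (simp add: binomial_eq_0)
  also have "\<dots> = ?D 0 + (\<Sum>n\<le>x. (- 1) ^ Suc n * of_nat (x choose Suc n) * ?D (Suc n))"
    by (subst sum.atMost_Suc_shift) simp
  also have "\<dots> + (\<Sum>n\<le>x. (- 1) ^ Suc n * of_nat (x choose n) * ?D (Suc n)) =
      ?D 0 + (\<Sum>n\<le>x. (- 1) ^ Suc n * of_nat (Suc x choose Suc n) * ?D (Suc n))"
    by (simp add: algebra_simps sum.distrib sum_subtractf sum_negf)
  also have "\<dots> = (\<Sum>n\<le>Suc x. (- 1) ^ n * of_nat (Suc x choose n) * ?D n)"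
    by (subst sum.atMost_Suc_shift) simp
  finally show ?case .
qed simp

section \<open>Differences of complex powers\<close>

text \<open>The shift r is carried along because raising n or lowering s brings in differences with
  shift r + 1, and because the series is later telescoped over r.\<close>

definition hasse_diff :: "nat \<Rightarrow> nat \<Rightarrow> complex \<Rightarrow> complex" where
  "hasse_diff n r s = alt_diff (\<lambda>j. of_nat (j + 1 + r) powr (- s)) n"

lemma hasse_diff_sum:
  "hasse_diff n r s = (\<Sum>j\<le>n. (- 1) ^ j * of_nat (n choose j) * of_nat (j + 1 + r) powr (- s))"
  by (simp add: hasse_diff_def alt_diff_def)

lemma hasse_diff_Suc: "hasse_diff (Suc n) r s = hasse_diff n r s - hasse_diff n (Suc r) s"
  unfolding hasse_diff_def alt_diff_Suc by simp

text \<open>Lowering s by 1 multiplies the j-th term by j + 1 + r = (1 + r) + j; the part j is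
  absorbed by j (n+1 choose j) = (n+1) (n choose j-1), which shifts r. This identity carries the
  bounds into left half-planes.\<close>

lemma hasse_diff_minus_one:
  "hasse_diff (Suc n) r (s - 1) =
     of_nat (1 + r) * hasse_diff (Suc n) r s - of_nat (Suc n) * hasse_diff n (Suc r) s"
proof -
  let ?t = "\<lambda>j. of_nat (j + 1 + r) powr (- s) :: complex"
  have pw: "of_nat (j + 1 + r) powr (- (s - 1)) = of_nat (j + 1 + r) * ?t j" for j
    using powr_add[of "of_nat (j + 1 + r) :: complex" "-s" 1] by (simp add: mult.commute)
  have "hasse_diff (Suc n) r (s - 1) =
      (\<Sum>j\<le>Suc n. of_nat (1 + r) * ((- 1) ^ j * of_nat (Suc n choose j) * ?t j)
        + (- 1) ^ j * of_nat (j * (Suc n choose j)) * ?t j)"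
    unfolding hasse_diff_sum by (intro sum.cong refl, subst pw) (simp add: algebra_simps)
  also have "\<dots> = of_nat (1 + r) * hasse_diff (Suc n) r s
      + (\<Sum>j\<le>Suc n. (- 1) ^ j * of_nat (j * (Suc n choose j)) * ?t j)"
    unfolding hasse_diff_sum by (simp only: sum.distrib sum_distrib_left)
  also have "(\<Sum>j\<le>Suc n. (- 1) ^ j * of_nat (j * (Suc n choose j)) * ?t j) =
      (\<Sum>j\<le>n. (- 1) ^ Suc j * of_nat (Suc j * (Suc n choose Suc j)) * ?t (Suc j))"
    by (subst sum.atMost_Suc_shift) simp
  also have "\<dots> = (\<Sum>j\<le>n. - (of_nat (Suc n) * ((- 1) ^ j * of_nat (n choose j) *
      of_nat (j + 1 + Suc r) powr (- s))))"
    by (intro sum.cong refl, simp only: Suc_times_binomial) (simp add: algebra_simps)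
  also have "\<dots> = - (of_nat (Suc n) * hasse_diff n (Suc r) s)"
    unfolding hasse_diff_sum by (simp only: sum_negf sum_distrib_left)
  finally show ?thesis by simp
qed

text \<open>An n-th difference annihilates polynomials of degree k < n; this makes Hasse's series
  finite at 1 - k.\<close>

lemma hasse_diff_neg_of_nat: "n > k \<Longrightarrow> hasse_diff n r (- of_nat k) = 0"
proof (induction k arbitrary: n r)
  case 0
  then show ?case
    using choose_alternating_sum[of n, where 'a = complex]
    by (simp add: hasse_diff_sum del: of_nat_Suc of_nat_add)
next
  case (Suc k)
  then obtain m where m: "n = Suc m" "m > k" by (cases n) auto
  have "hasse_diff n r (- of_nat k - 1) = 0"
    unfolding m(1) hasse_diff_minus_one using Suc.IH[of "Suc m" r] Suc.IH[of m "Suc r"] m(2) by simp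
  moreover have "- of_nat k - 1 = (- of_nat (Suc k) :: complex)" by simp
  ultimately show ?case by (simp only:)
qed

section \<open>Integral representation through the Gamma function\<close>

text \<open>The Gamma integral restated for \<open>lborel\<close>, where linear substitution and
  dominated convergence are applied to it.\<close>

lemma has_bochner_integral_Gamma:
  assumes "Re s > 0"
  shows "has_bochner_integral lborel
    (\<lambda>t. indicator {0<..} t *\<^sub>R (of_real t powr (s - 1) * of_real (exp (- t)))) (Gamma s)"
    (is "has_bochner_integral _ ?f _")
proof -
  have meas: "?f \<in> borel_measurable lborel"
  proof -
    have "set_borel_measurable borel {0<..} (\<lambda>t. of_real t powr (s - 1) * of_real (exp (- t)) :: complex)"
      unfolding set_borel_measurable_def
      by (intro borel_measurable_continuous_on_indicator continuous_intros) auto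
    then show ?thesis by (simp add: set_borel_measurable_def)
  qed
  have eq: "of_real t powr (s - 1) / of_real (exp t) = of_real t powr (s - 1) * (of_real (exp (- t)) :: complex)" for t
    by (simp add: exp_minus field_simps)
  have "set_integrable lebesgue {0<..} (\<lambda>t. of_real t powr (s - 1) * of_real (exp (- t)) :: complex)"
    using absolutely_integrable_Gamma_integral'[OF assms] unfolding eq .
  then have int: "integrable lborel ?f"
    using meas by (simp add: set_integrable_def integrable_completion)
  have "integral\<^sup>L lborel ?f = set_lebesgue_integral lebesgue {0<..} (\<lambda>t. of_real t powr (s - 1) * of_real (exp (- t)))"
    using meas by (simp add: set_lebesgue_integral_def integral_completion)
  also have "\<dots> = integral {0<..} (\<lambda>t. of_real t powr (s - 1) * of_real (exp (- t)))"
    using absolutely_integrable_Gamma_integral'[OF assms] unfolding eq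
    by (rule set_lebesgue_integral_eq_integral(2))
  also have "\<dots> = Gamma s"
    using Gamma_integral_complex'[OF assms] unfolding eq by (rule integral_unique)
  finally show ?thesis using int by (simp add: has_bochner_integral_iff)
qed

lemma has_bochner_integral_Gamma_scaled:
  assumes "Re s > 0" "a > 0"
  shows "has_bochner_integral lborel
    (\<lambda>t. indicator {0<..} t *\<^sub>R (of_real t powr (s - 1) * of_real (exp (- a * t))))
    (Gamma s * of_real a powr (- s))" (is "has_bochner_integral _ ?g _")
proof -
  let ?f = "\<lambda>t. indicator {0<..} t *\<^sub>R (of_real t powr (s - 1) * of_real (exp (- t))) :: complex"
  have "has_bochner_integral lborel (\<lambda>t. ?f (0 + a * t)) (Gamma s /\<^sub>R \<bar>a\<bar>)"
    using has_bochner_integral_Gamma[OF assms(1)] assms(2)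
    by (subst (asm) lborel_has_bochner_integral_real_affine_iff[where c = a and t = 0]) auto
  \<comment> \<open>The factor a^(1 - s) cancels the a^(s - 1) that splits off from (a t)^(s -
    1).\<close>
  then have "has_bochner_integral lborel (\<lambda>t. of_real a powr (1 - s) * ?f (0 + a * t))
     (of_real a powr (1 - s) * (Gamma s /\<^sub>R \<bar>a\<bar>))"
    by (intro has_bochner_integral_mult_right) auto
  moreover have "of_real a powr (1 - s) * ?f (0 + a * t) = ?g t" for t
  proof (cases "t > 0")
    case True
    then have "(of_real (a * t) :: complex) powr (s - 1) = of_real a powr (s - 1) * of_real t powr (s - 1)"
      using assms by (simp add: powr_times_real)
    moreover have "of_real a powr (1 - s) * of_real a powr (s - 1) = (1::complex)"
      using assms(2) by (simp add: powr_add[symmetric])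
    ultimately show ?thesis using True assms(2) 
      by (simp add: indicator_def zero_less_mult_iff) 
  qed (use assms in \<open>auto simp: indicator_def zero_less_mult_iff\<close>)
  moreover have "of_real a powr (1 - s) * (Gamma s /\<^sub>R \<bar>a\<bar>) = Gamma s * of_real a powr (- s)"
    using assms(2) powr_add[of "of_real a :: complex" "-s" 1]
    by (simp add: scaleR_conv_of_real field_simps)
  ultimately show ?thesis by simp
qed

text \<open>Under the integral the alternating binomial sum becomes (1 - exp(-t))^n, so the
  cancellation hidden in the difference turns into a nonnegative factor that can be
  estimated.\<close>

lemma has_bochner_integral_hasse_diff:
  assumes "Re s > 0"
  shows "has_bochner_integral lborel
    (\<lambda>t. indicator {0<..} t *\<^sub>R (of_real t powr (s - 1) *
       of_real (exp (- real (1 + r) * t) * (1 - exp (- t)) ^ n)))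
    (Gamma s * hasse_diff n r s)"
proof -
  have "has_bochner_integral lborel
     (\<lambda>t. \<Sum>j\<le>n. (- 1) ^ j * of_nat (n choose j) * (indicator {0<..} t *\<^sub>R
       (of_real t powr (s - 1) * of_real (exp (- real (j + 1 + r) * t)))))
     (\<Sum>j\<le>n. (- 1) ^ j * of_nat (n choose j) * (Gamma s * of_real (real (j + 1 + r)) powr (- s)))"
    by (intro has_bochner_integral_sum has_bochner_integral_mult_right
        has_bochner_integral_Gamma_scaled assms) auto
  moreover have "(\<Sum>j\<le>n. (- 1) ^ j * of_nat (n choose j) * (Gamma s * of_real (real (j + 1 + r)) powr (- s)))
     = Gamma s * hasse_diff n r s"
    by (simp add: hasse_diff_sum sum_distrib_left mult_ac)
  moreover have "(\<Sum>j\<le>n. (- 1) ^ j * of_nat (n choose j) * (indicator {0<..} t *\<^sub>R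
       (of_real t powr (s - 1) * of_real (exp (- real (j + 1 + r) * t))))) =
     indicator {0<..} t *\<^sub>R (of_real t powr (s - 1) *
       of_real (exp (- real (1 + r) * t) * (1 - exp (- t)) ^ n))" for t :: real
  proof -
    have "(1 - exp (- t)) ^ n = (\<Sum>j\<le>n. of_nat (n choose j) * (- exp (- t)) ^ j)"
      using binomial_ring[of "- exp (- t)" 1 n] by simp
    also have "\<dots> = (\<Sum>j\<le>n. (- 1) ^ j * of_nat (n choose j) * exp (- real j * t))"
      by (intro sum.cong refl) (simp add: power_minus[of "exp (-t)"] exp_of_nat_mult[symmetric])
    finally have "exp (- real (1 + r) * t) * (1 - exp (- t)) ^ n =
       (\<Sum>j\<le>n. (- 1) ^ j * of_nat (n choose j) * (exp (- real (1 + r) * t) * exp (- real j * t)))"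
      by (simp add: sum_distrib_left mult_ac)
    also have "\<dots> = (\<Sum>j\<le>n. (- 1) ^ j * of_nat (n choose j) * exp (- real (j + 1 + r) * t))"
      by (simp add: exp_add[symmetric] algebra_simps)
    finally show ?thesis
      by (simp only: of_real_sum sum_distrib_left scaleR_sum_right) (simp add: mult_ac)
  qed
  ultimately show ?thesis by simp
qed

section \<open>Decay of the differences\<close>

text \<open>y^a exp(-y) is largest at y = a, which is the origin of the constant exp(a ln a -
  a).\<close>

lemma powr_le_const_mult_exp:
  assumes "a > (0::real)"
  obtains C where "C > 0" "\<And>y. y \<ge> 0 \<Longrightarrow> y powr a \<le> C * exp y"
proof
  show "exp (a * ln a - a) > 0" by simp
  fix y :: real assume "y \<ge> 0"
  show "y powr a \<le> exp (a * ln a - a) * exp y"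
  proof (cases "y = 0")
    case False
    with \<open>y \<ge> 0\<close> have y: "y > 0" by simp
    have "ln (y / a) \<le> y / a - 1" using y assms by (intro ln_le_minus_one) auto
    then have "a * ln (y / a) \<le> a * (y / a - 1)" using assms by (intro mult_left_mono) auto
    then have "a * ln y \<le> a * ln a - a + y" using y assms by (simp add: ln_div algebra_simps)
    then show ?thesis using y by (simp add: powr_def exp_add[symmetric])
  qed simp
qed

lemma has_bochner_integral_Gamma_scaled_real:
  fixes x a :: real
  assumes "x > 0" "a > 0"
  shows "has_bochner_integral lborel
    (\<lambda>t. indicator {0<..} t * (t powr (x - 1) * exp (- a * t))) (Gamma x * a powr (- x))"
proof -
  have "has_bochner_integral lborel
    (\<lambda>t. Re (indicator {0<..} t *\<^sub>R (of_real t powr (of_real x - 1) * of_real (exp (- a * t)))))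
    (Re (Gamma (of_real x) * of_real a powr (- of_real x)))"
    by (intro has_bochner_integral_Re has_bochner_integral_Gamma_scaled) (use assms in auto)
  moreover have "Re (Gamma (of_real x) * of_real a powr (- of_real x)) = Gamma x * a powr (- x)"
    using assms powr_of_real[of a "-x"] by (simp add: Gamma_complex_of_real del: powr_of_real)
  moreover have "Re (indicator {0<..} t *\<^sub>R (of_real t powr (of_real x - 1) * of_real (exp (- a * t)))) =
     indicator {0<..} t * (t powr (x - 1) * exp (- a * t))" for t :: real
    using powr_of_real[of t "x - 1"] by (cases "t > 0") (auto simp del: powr_of_real)
  ultimately show ?thesis by (simp only:)
qed

text \<open>The part exp(-a t) of the exponential is spent on taming (1 - exp(-t))^n uniformly in t;
  the rest, exp(-(1 + r - a) t), must still decay, whence a < 1 + r. The constant depends only on a,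
  which gives uniformity in n, r and s at once.\<close>

lemma norm_Gamma_hasse_diff_le:
  assumes "a > (0::real)"
  obtains C where "C > 0"
    "\<And>n r s. \<lbrakk>a < 1 + real r; Re s > 0\<rbrakk> \<Longrightarrow> norm (Gamma s * hasse_diff n r s) \<le>
       C * real (Suc n) powr (- a) * (Gamma (Re s) * (1 + real r - a) powr (- Re s))"
proof -
  obtain D where D: "D > 0" "\<And>y. y \<ge> 0 \<Longrightarrow> y powr a \<le> D * exp y"
    using powr_le_const_mult_exp[OF assms] by metis
  have key: "exp (- a * t) * (1 - exp (- t)) ^ n \<le> (exp 1 * D) * real (Suc n) powr (- a)"
    if "t > 0" for t n
  proof -
    define u where "u = exp (- t)"
    have u: "0 < u" "u < 1" using that by (auto simp: u_def)
    \<comment> \<open>1 - u <= exp(-u) gives exp(-n u); since u < 1, the factor exp 1 trades n for n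
      + 1, which stays positive at n = 0.\<close>
    have 1: "(1 - u) ^ n \<le> exp 1 * exp (- (real (Suc n) * u))"
    proof -
      have "(1 - u) ^ n \<le> exp (- u) ^ n"
        using u exp_ge_add_one_self[of "-u"] by (intro power_mono) auto
      also have "\<dots> = exp (- (real n * u))" by (simp add: exp_of_nat_mult[symmetric])
      also have "\<dots> \<le> exp (1 + - (real (Suc n) * u))" using u by (simp add: algebra_simps)
      finally show ?thesis by (simp only: exp_add)
    qed
    have 2: "exp (- a * t) = (real (Suc n) * u) powr a * real (Suc n) powr (- a)"
    proof -
      have "exp (- a * t) = u powr a" by (simp add: u_def powr_def)
      moreover have "(real (Suc n) * u) powr a = real (Suc n) powr a * u powr a"
        by (rule powr_mult)
      moreover have "real (Suc n) powr a * real (Suc n) powr (- a) = 1"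
        by (simp add: powr_add[symmetric])
      ultimately show ?thesis by (simp add: mult_ac)
    qed
    have "exp (- a * t) * (1 - u) ^ n \<le> exp (- a * t) * (exp 1 * exp (- (real (Suc n) * u)))"
      using 1 by (intro mult_left_mono) simp_all
    also have "\<dots> = exp 1 * real (Suc n) powr (- a) * ((real (Suc n) * u) powr a * exp (- (real (Suc n) * u)))"
      unfolding 2 by (simp only: mult_ac)
    also have "\<dots> \<le> exp 1 * real (Suc n) powr (- a) * (D * exp (real (Suc n) * u) * exp (- (real (Suc n) * u)))"
      using u by (intro mult_left_mono mult_right_mono D(2)) auto
    also have "\<dots> = (exp 1 * D) * real (Suc n) powr (- a)" by (simp add: exp_minus)
    finally show ?thesis by (simp add: u_def)
  qed
  show ?thesis
  proof
    show "exp 1 * D > 0" using D by simp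
    fix n r s assume r: "a < 1 + real r" and s: "Re s > 0"
    let ?f = "\<lambda>t. indicator {0<..} t *\<^sub>R (of_real t powr (s - 1) *
       of_real (exp (- real (1 + r) * t) * (1 - exp (- t)) ^ n)) :: complex"
    let ?g = "\<lambda>t. exp 1 * D * real (Suc n) powr (- a) *
        (indicator {0<..} t * (t powr (Re s - 1) * exp (- (1 + real r - a) * t)))"
    have f: "has_bochner_integral lborel ?f (Gamma s * hasse_diff n r s)"
      by (rule has_bochner_integral_hasse_diff[OF s])
    have g: "has_bochner_integral lborel ?g
       (exp 1 * D * real (Suc n) powr (- a) * (Gamma (Re s) * (1 + real r - a) powr (- Re s)))"
      using r s by (intro has_bochner_integral_mult_right has_bochner_integral_Gamma_scaled_real) auto
    have "norm (integral\<^sup>L lborel ?f) \<le> integral\<^sup>L lborel ?g"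
    proof (rule Bochner_Integration.integral_norm_bound_integral)
      fix t :: real
      show "norm (?f t) \<le> ?g t"
      proof (cases "t > 0")
        case True
        have "norm (?f t) = t powr (Re s - 1) * (exp (- real (1 + r) * t) * (1 - exp (- t)) ^ n)"
          using True by (simp add: norm_mult norm_powr_real_powr abs_mult power_abs
              del: of_real_mult of_real_diff of_real_power of_real_exp)
        also have "\<dots> = t powr (Re s - 1) * exp (- (1 + real r - a) * t) * (exp (- a * t) * (1 - exp (- t)) ^ n)"
        proof -
          have "exp (- real (1 + r) * t) = exp (- (1 + real r - a) * t) * exp (- a * t)"
            by (simp add: exp_add[symmetric] algebra_simps)
          then show ?thesis by (simp only: mult_ac)
        qed
        also have "\<dots> \<le> t powr (Re s - 1) * exp (- (1 + real r - a) * t) * ((exp 1 * D) * real (Suc n) powr (- a))"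
          by (intro mult_left_mono key True) auto
        also have "\<dots> = ?g t" using True by simp
        finally show ?thesis .
      qed simp
    qed (use f g in \<open>auto simp: has_bochner_integral_iff\<close>)
    then show "norm (Gamma s * hasse_diff n r s) \<le>
        exp 1 * D * real (Suc n) powr (- a) * (Gamma (Re s) * (1 + real r - a) powr (- Re s))"
      using f g by (simp only: has_bochner_integral_iff)
  qed
qed

lemma hasse_diff_holomorphic [holomorphic_intros]: "hasse_diff n r holomorphic_on A"
  unfolding hasse_diff_sum[abs_def] by (intro holomorphic_intros) (auto simp: complex_nonpos_Reals_iff)

text \<open>The integral gives the bound for Re s > 0 only; each induction step moves one unit to
  the left through \<open>hasse_diff_minus_one\<close>. The exponent r + 1/2 lies below 1 + r, grows
  with r so as to absorb the factor n + 1 of the recursion, and at r = 0 leaves (n+1)^(-3/2) after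
  division by n + 1.\<close>

lemma hasse_diff_bound_compact:
  assumes "compact K" "K \<subseteq> {s. Re s > - real m}"
  shows "\<exists>B\<ge>0. \<forall>s\<in>K. \<forall>n. norm (hasse_diff n r s) \<le> B * real (Suc n) powr (- (real r + 1/2))"
  using assms
proof (induction m arbitrary: K r)
  case 0
  obtain C where C: "C > 0" "\<And>n r' s. \<lbrakk>real r + 1/2 < 1 + real r'; Re s > 0\<rbrakk> \<Longrightarrow> norm (Gamma s * hasse_diff n r' s) \<le>
       C * real (Suc n) powr (- (real r + 1/2)) * (Gamma (Re s) * (1 + real r' - (real r + 1/2)) powr (- Re s))"
    using norm_Gamma_hasse_diff_le[of "real r + 1/2"] by auto
  \<comment> \<open>The part of the bound that depends on s, with 1/2 = 1 + r - (r + 1/2); it is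
    continuous, hence bounded on K.\<close>
  define h where "h = (\<lambda>s. C * norm (rGamma s) * (Gamma (Re s) * (1 / 2) powr (- Re s)))"
  have "continuous_on K h"
    unfolding h_def using 0
    by (intro continuous_intros continuous_on_compose2[OF continuous_on_Gamma[of "{0<..}"]])
       (auto simp: subset_eq elim!: nonpos_Ints_cases)
  then have "compact (h ` K)" using 0 by (intro compact_continuous_image)
  then have "bounded (h ` K)" by (rule compact_imp_bounded)
  then obtain B where B: "B > 0" "\<And>s. s \<in> K \<Longrightarrow> norm (h s) \<le> B"
    unfolding bounded_pos by auto
  have "norm (hasse_diff n r s) \<le> B * real (Suc n) powr (- (real r + 1/2))" if "s \<in> K" for s n
  proof -
    have s: "Re s > 0" using that 0 by auto
    then have "Gamma s \<noteq> 0" by (auto simp: Gamma_eq_zero_iff elim!: nonpos_Ints_cases)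
    then have "hasse_diff n r s = rGamma s * (Gamma s * hasse_diff n r s)"
      by (simp add: rGamma_inverse_Gamma)
    then have "norm (hasse_diff n r s) = norm (rGamma s) * norm (Gamma s * hasse_diff n r s)"
      by (metis norm_mult)
    also have "\<dots> \<le> norm (rGamma s) * (C * real (Suc n) powr (- (real r + 1/2)) *
        (Gamma (Re s) * (1 / 2) powr (- Re s)))"
      using C(2)[of r s n] s by (intro mult_left_mono) auto
    also have "\<dots> = h s * real (Suc n) powr (- (real r + 1/2))" by (simp add: h_def)
    also have "\<dots> \<le> B * real (Suc n) powr (- (real r + 1/2))"
      using B(2)[OF that] by (intro mult_right_mono) auto
    finally show ?thesis .
  qed
  then show ?case using B(1) by (intro exI[of _ B]) auto
next
  case (Suc m)
  let ?K = "(\<lambda>s. s + 1) ` K"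
  have K: "compact ?K" "?K \<subseteq> {s. Re s > - real m}"
    using Suc.prems by (auto intro!: compact_continuous_image continuous_intros)
  obtain B1 where B1: "B1 \<ge> 0" "\<And>s n. s \<in> K \<Longrightarrow> norm (hasse_diff n r (s + 1)) \<le> B1 * real (Suc n) powr (- (real r + 1/2))"
    using Suc.IH[OF K, of r] by auto
  obtain B2 where B2: "B2 \<ge> 0" "\<And>s n. s \<in> K \<Longrightarrow> norm (hasse_diff n (Suc r) (s + 1)) \<le> B2 * real (Suc n) powr (- (real (Suc r) + 1/2))"
    using Suc.IH[OF K, of "Suc r"] by auto
  have "compact (hasse_diff 0 r ` K)"
    using Suc.prems by (intro compact_continuous_image holomorphic_on_imp_continuous_on hasse_diff_holomorphic)
  then have "bounded (hasse_diff 0 r ` K)" by (rule compact_imp_bounded)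
  then obtain B0 where B0: "B0 > 0" "\<And>s. s \<in> K \<Longrightarrow> norm (hasse_diff 0 r s) \<le> B0"
    unfolding bounded_pos by auto
  \<comment> \<open>\<open>B0\<close> covers n = 0, where the recursion does not apply; the power of
    2 pays for replacing k + 1 by k + 2 = n + 1.\<close>
  define B where "B = B0 + real (1 + r) * B1 + B2 * 2 powr (real r + 1/2)"
  have "norm (hasse_diff n r s) \<le> B * real (Suc n) powr (- (real r + 1/2))" if s: "s \<in> K" for s n
  proof (cases n)
    case 0
    have "B0 \<le> B" using B1 B2 by (simp add: B_def)
    then show ?thesis using 0 B0(2)[OF s] by simp
  next
    case n: (Suc k)
    have "hasse_diff (Suc k) r ((s + 1) - 1) =
       of_nat (1 + r) * hasse_diff (Suc k) r (s + 1) - of_nat (Suc k) * hasse_diff k (Suc r) (s + 1)"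
      by (rule hasse_diff_minus_one)
    then have "norm (hasse_diff (Suc k) r s) \<le>
       norm (of_nat (1 + r) * hasse_diff (Suc k) r (s + 1)) + norm (of_nat (Suc k) * hasse_diff k (Suc r) (s + 1))"
      by (simp add: norm_triangle_ineq4 del: of_nat_Suc of_nat_add)
    also have "\<dots> = real (1 + r) * norm (hasse_diff (Suc k) r (s + 1)) + real (Suc k) * norm (hasse_diff k (Suc r) (s + 1))"
      by (simp only: norm_mult norm_of_nat)
    also have "\<dots> \<le> real (1 + r) * (B1 * real (Suc (Suc k)) powr (- (real r + 1/2)))
       + real (Suc k) * (B2 * real (Suc k) powr (- (real (Suc r) + 1/2)))"
      by (intro add_mono mult_left_mono B1 B2 s) auto
    also have "real (Suc k) * (B2 * real (Suc k) powr (- (real (Suc r) + 1/2))) =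
        B2 * real (Suc k) powr (- (real r + 1/2))"
      using powr_add[of "real (Suc k)" 1 "- (real (Suc r) + 1/2)"] by (simp add: algebra_simps)
    also have "real (Suc k) powr (- (real r + 1/2)) \<le>
        2 powr (real r + 1/2) * real (Suc (Suc k)) powr (- (real r + 1/2))"
    proof -
      have "real (Suc (Suc k)) powr (real r + 1/2) \<le> (2 * real (Suc k)) powr (real r + 1/2)"
        by (intro powr_mono2) auto
      then show ?thesis by (simp only: powr_mult powr_minus) (simp add: field_simps)
    qed
    finally have "norm (hasse_diff (Suc k) r s) \<le> real (1 + r) * (B1 * real (Suc (Suc k)) powr (- (real r + 1/2)))
       + B2 * (2 powr (real r + 1/2) * real (Suc (Suc k)) powr (- (real r + 1/2)))"
      using B2(1) by (simp add: mult_left_mono)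
    then have "norm (hasse_diff (Suc k) r s) \<le> (real (1 + r) * B1 + B2 * 2 powr (real r + 1/2)) *
        real (Suc (Suc k)) powr (- (real r + 1/2))"
      by (simp only: distrib_right mult.assoc)
    also have "\<dots> \<le> B * real (Suc (Suc k)) powr (- (real r + 1/2))"
      using B0(1) by (intro mult_right_mono) (auto simp: B_def)
    finally show ?thesis by (simp add: n)
  qed
  moreover have "B \<ge> 0" using B0(1) B1(1) B2(1) by (simp add: B_def)
  ultimately show ?case by blast
qed

lemma summable_Suc_powr: "summable (\<lambda>n. real (Suc n) powr (- (3/2)))"
  using summable_Suc_iff[of "\<lambda>n. real n powr (- (3/2))"] summable_real_powr_iff[of "- (3/2)"]
  by simp

lemma hasse_diff_summable:
  assumes "Re s > 0"
  shows "summable (\<lambda>n. norm (hasse_diff n r s / of_nat (Suc n)))"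
proof -
  obtain B where B: "B \<ge> 0" "\<And>n. norm (hasse_diff n r s) \<le> B * real (Suc n) powr (- (real r + 1/2))"
    using hasse_diff_bound_compact[of "{s}" 0 r] assms by auto
  have "summable (\<lambda>n. B * real (Suc n) powr (- (3/2)))"
    by (intro summable_mult summable_Suc_powr)
  then show ?thesis
  proof (rule summable_comparison_test'[where N = 0])
    fix n
    have "norm (norm (hasse_diff n r s / of_nat (Suc n))) = norm (hasse_diff n r s) / real (Suc n)"
      by (simp add: norm_divide del: of_nat_Suc)
    also have "\<dots> \<le> B * real (Suc n) powr (- (real r + 1/2)) / real (Suc n)"
      using B(2)[of n] by (intro divide_right_mono) auto
    also have "\<dots> \<le> B * real (Suc n) powr (- (1/2)) / real (Suc n)"
      using B(1) by (intro divide_right_mono mult_left_mono powr_mono) auto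
    also have "\<dots> = B * real (Suc n) powr (- (3/2))"
      using powr_add[of "real (Suc n)" "-1" "-(1/2)"] by (simp add: powr_minus_divide field_simps)
    finally show "norm (norm (hasse_diff n r s / of_nat (Suc n))) \<le> B * real (Suc n) powr (- (3/2))" .
  qed
qed

section \<open>The continuation of (s - 1) zeta(s)\<close>

definition hasse_series :: "complex \<Rightarrow> complex" where
  "hasse_series s = (\<Sum>n. hasse_diff n 0 (s - 1) / of_nat (Suc n))"

lemma hasse_series_holomorphic: "hasse_series holomorphic_on A"
proof -
  have "hasse_series holomorphic_on UNIV"
  proof (rule holomorphic_uniform_sequence)
    show "(\<lambda>s. \<Sum>n<N. hasse_diff n 0 (s - 1) / of_nat (Suc n)) holomorphic_on UNIV" for N
      by (intro holomorphic_intros holomorphic_on_compose_gen[of "\<lambda>s. s - 1" _ "hasse_diff _ 0" UNIV, unfolded o_def]) auto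
    fix x :: complex
    let ?K = "(\<lambda>s. s - 1) ` cball x 1"
    \<comment> \<open>On \<open>cball x 1\<close> the real part of s - 1 is at least Re x -
      2.\<close>
    obtain m :: nat where m: "real m > 2 - Re x" using reals_Archimedean2 by blast
    have "- real m < Re s - 1" if "norm (x - s) \<le> 1" for s
      using that m abs_Re_le_cmod[of "x - s"] by simp
    then have "?K \<subseteq> {s. Re s > - real m}" by (auto simp: dist_norm)
    moreover have "compact ?K" by (intro compact_continuous_image continuous_intros) auto
    ultimately obtain B where B: "B \<ge> 0"
        "\<And>s n. s \<in> cball x 1 \<Longrightarrow> norm (hasse_diff n 0 (s - 1)) \<le> B * real (Suc n) powr (- (1/2))"
      using hasse_diff_bound_compact[of ?K m 0] by auto
    have "uniform_limit (cball x 1) (\<lambda>N s. \<Sum>n<N. hasse_diff n 0 (s - 1) / of_nat (Suc n)) hasse_series sequentially"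
      unfolding hasse_series_def[abs_def]
    proof (rule Weierstrass_m_test)
      show "summable (\<lambda>n. B * real (Suc n) powr (- (3/2)))"
        by (intro summable_mult summable_Suc_powr)
      fix n s assume s: "s \<in> cball x 1"
      have "norm (hasse_diff n 0 (s - 1) / of_nat (Suc n)) = norm (hasse_diff n 0 (s - 1)) / real (Suc n)"
        by (simp add: norm_divide del: of_nat_Suc)
      also have "\<dots> \<le> B * real (Suc n) powr (- (1/2)) / real (Suc n)"
        using B(2)[OF s, of n] by (intro divide_right_mono) auto
      also have "\<dots> = B * real (Suc n) powr (- (3/2))"
        using powr_add[of "real (Suc n)" "-1" "-(1/2)"] by (simp add: powr_minus_divide field_simps)
      finally show "norm (hasse_diff n 0 (s - 1) / of_nat (Suc n)) \<le> B * real (Suc n) powr (- (3/2))" .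
    qed
    then show "\<exists>d>0. cball x d \<subseteq> UNIV \<and> uniform_limit (cball x d)
        (\<lambda>N s. \<Sum>n<N. hasse_diff n 0 (s - 1) / of_nat (Suc n)) hasse_series sequentially"
      by (intro exI[of _ 1]) auto
  qed auto
  then show ?thesis by (rule holomorphic_on_subset) auto
qed

text \<open>The sum of (1 - exp(-t))^(n+1)/(n+1) is -ln(exp(-t)) = t, so the integrals add up to the
  Gamma integral at w + 1. The partial sums are nonnegative and at most t, so t times the remaining
  factor dominates.\<close>

lemma hasse_diff_Suc_sums:
  assumes w: "Re w > 0"
  shows "(\<lambda>n. hasse_diff (Suc n) r w / of_nat (Suc n)) sums (w * of_nat (Suc r) powr (- w - 1))"
proof -
  let ?c = "\<lambda>t. indicator {0<..} t *\<^sub>R (of_real t powr (w - 1) * of_real (exp (- real (1 + r) * t)) :: complex)"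
  let ?p = "\<lambda>N t. \<Sum>n<N. (1 - exp (- t)) ^ Suc n / real (Suc n)"
  let ?s = "\<lambda>N t. \<Sum>n<N. indicator {0<..} t *\<^sub>R (of_real t powr (w - 1) *
       of_real (exp (- real (1 + r) * t) * (1 - exp (- t)) ^ Suc n)) / of_nat (Suc n) :: complex"
  let ?f = "\<lambda>t. indicator {0<..} t *\<^sub>R (of_real t powr (w + 1 - 1) * of_real (exp (- real (1 + r) * t))) :: complex"
  let ?w = "\<lambda>t. indicator {0<..} t * (t powr (Re w + 1 - 1) * exp (- real (1 + r) * t))"
  have s: "has_bochner_integral lborel (?s N) (\<Sum>n<N. Gamma w * hasse_diff (Suc n) r w / of_nat (Suc n))" for N
    by (intro has_bochner_integral_sum has_bochner_integral_divide_zero has_bochner_integral_hasse_diff w)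
  have f: "has_bochner_integral lborel ?f (Gamma (w + 1) * of_real (real (1 + r)) powr (- (w + 1)))"
    using w by (intro has_bochner_integral_Gamma_scaled) auto
  have b: "has_bochner_integral lborel ?w (Gamma (Re w + 1) * real (1 + r) powr (- (Re w + 1)))"
    using w by (intro has_bochner_integral_Gamma_scaled_real) auto
  have s_eq: "?s N t = ?c t * of_real (?p N t)" for N t
    by (simp add: sum_distrib_left scaleR_conv_of_real mult_ac)
  have lim: "(\<lambda>n. (1 - exp (- t)) ^ Suc n / real (Suc n)) sums t" if "t > 0" for t :: real
  proof -
    have "(\<lambda>n. - ((- (exp (- t) - 1)) ^ n) / real n) sums ln (1 + (exp (- t) - 1))"
      using that by (intro ln_series') auto
    then have "(\<lambda>n. - (- ((1 - exp (- t)) ^ n) / real n)) sums t"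
      by (subst sums_minus[of _ "-t", simplified]) auto
    then show ?thesis by (subst sums_Suc_iff) simp
  qed
  have "(\<lambda>N. integral\<^sup>L lborel (?s N)) \<longlonglongrightarrow> integral\<^sup>L lborel ?f"
  proof (rule integral_dominated_convergence[where w = ?w])
    show "AE t in lborel. (\<lambda>N. ?s N t) \<longlonglongrightarrow> ?f t"
    proof (rule AE_I2)
      fix t :: real
      show "(\<lambda>N. ?s N t) \<longlonglongrightarrow> ?f t"
      proof (cases "t > 0")
        case True
        have "(\<lambda>N. ?c t * of_real (?p N t)) \<longlonglongrightarrow> ?c t * of_real t"
          using lim[OF True] unfolding sums_def by (intro tendsto_intros)
        moreover have "?c t * of_real t = ?f t"
          using True powr_add[of "of_real t :: complex" "w - 1" 1] by (simp add: mult_ac)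
        ultimately show ?thesis by (simp only: s_eq)
      qed simp
    qed
    show "AE t in lborel. norm (?s N t) \<le> ?w t" for N
    proof (rule AE_I2)
      fix t :: real
      show "norm (?s N t) \<le> ?w t"
      proof (cases "t > 0")
        case True
        have p: "0 \<le> ?p N t" using True by (intro sum_nonneg) auto
        have "?p N t \<le> t"
          using sums_unique[OF lim[OF True]] sum_le_suminf[OF sums_summable[OF lim[OF True]], of "{..<N}"] True
          by simp
        then have "norm (?c t * of_real (?p N t)) \<le> norm (?c t) * t"
          using p unfolding norm_mult by (intro mult_left_mono) (auto simp del: of_real_sum)
        also have "\<dots> = ?w t"
          using True powr_add[of t "Re w - 1" 1] by (simp add: norm_mult norm_powr_real_powr mult_ac)
        finally show ?thesis by (simp only: s_eq)
      qed simp
    qed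
  qed (use s f b in \<open>auto simp: has_bochner_integral_iff\<close>)
  then have "(\<lambda>N. \<Sum>n<N. Gamma w * hasse_diff (Suc n) r w / of_nat (Suc n)) \<longlonglongrightarrow>
      Gamma (w + 1) * of_real (real (1 + r)) powr (- (w + 1))"
    using s f by (simp only: has_bochner_integral_iff)
  then have 1: "(\<lambda>n. Gamma w * hasse_diff (Suc n) r w / of_nat (Suc n)) sums
      (Gamma (w + 1) * of_real (real (1 + r)) powr (- (w + 1)))"
    unfolding sums_def .
  have "w \<notin> \<int>\<^sub>\<le>\<^sub>0" using w by (auto elim!: nonpos_Ints_cases)
  then have G: "Gamma w \<noteq> 0" "Gamma (w + 1) = w * Gamma w"
    by (auto simp: Gamma_eq_zero_iff Gamma_plus1)
  have "Gamma w * hasse_diff (Suc n) r w / of_nat (Suc n) / Gamma w = hasse_diff (Suc n) r w / of_nat (Suc n)" for n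
    using G(1) by (metis nonzero_mult_div_cancel_left times_divide_eq_right)
  moreover have "Gamma (w + 1) * of_real (real (1 + r)) powr (- (w + 1)) / Gamma w = w * of_nat (Suc r) powr (- w - 1)"
    using G(1) unfolding G(2) by simp
  ultimately show ?thesis using sums_divide[OF 1, of "Gamma w"] by (simp only:)
qed

text \<open>Let T r be Hasse's series with shift r. By \<open>hasse_diff_Suc\<close> and the
  preceding sum, T r - T (r+1) is w (r+1)^(-w-1); since T r tends to 0, telescoping over r turns T 0
  into w times the Dirichlet series.\<close>

lemma hasse_series_eq:
  assumes s: "Re s > 1"
  shows "(\<lambda>n. (s - 1) * (1 / of_nat (Suc n) powr s)) sums hasse_series s"
proof -
  define w where "w = s - 1"
  have w: "Re w > 0" using s by (simp add: w_def)
  define T where "T = (\<lambda>r. \<Sum>n. hasse_diff n r w / of_nat (Suc n))"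
  have summ: "summable (\<lambda>n. hasse_diff n r w / of_nat (Suc n))" for r
    using hasse_diff_summable[OF w] by (rule summable_norm_cancel)
  have diff: "T r - T (Suc r) = w * of_nat (Suc r) powr (- w - 1)" for r
  proof -
    have "T r - T (Suc r) = (\<Sum>n. hasse_diff n r w / of_nat (Suc n) - hasse_diff n (Suc r) w / of_nat (Suc n))"
      unfolding T_def by (rule suminf_diff[OF summ summ])
    also have "\<dots> = (\<Sum>n. hasse_diff (Suc n) r w / of_nat (Suc n))"
      by (simp add: hasse_diff_Suc diff_divide_distrib)
    finally show ?thesis using sums_unique[OF hasse_diff_Suc_sums[OF w, of r]] by simp
  qed
  \<comment> \<open>The bound with exponent 1/2 leaves a factor (r + 1/2)^(-Re w) independent of n,
    and Re w > 0.\<close>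
  have "T \<longlonglongrightarrow> 0"
  proof -
    obtain C where C: "C > 0" "\<And>n r s. \<lbrakk>1/2 < 1 + real r; Re s > 0\<rbrakk> \<Longrightarrow> norm (Gamma s * hasse_diff n r s) \<le>
       C * real (Suc n) powr (- (1/2)) * (Gamma (Re s) * (1 + real r - 1/2) powr (- Re s))"
      using norm_Gamma_hasse_diff_le[of "1/2"] by auto
    define D where "D = norm (rGamma w) * C * Gamma (Re w)"
    have "w \<notin> \<int>\<^sub>\<le>\<^sub>0" using w by (auto elim!: nonpos_Ints_cases)
    then have G: "Gamma w \<noteq> 0" by (auto simp: Gamma_eq_zero_iff)
    have bound: "norm (hasse_diff n r w / of_nat (Suc n)) \<le> D * (real r + 1/2) powr (- Re w) * real (Suc n) powr (- (3/2))" for n r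
    proof -
      have "hasse_diff n r w = rGamma w * (Gamma w * hasse_diff n r w)"
        using G by (simp add: rGamma_inverse_Gamma)
      then have "norm (hasse_diff n r w) = norm (rGamma w) * norm (Gamma w * hasse_diff n r w)"
        by (metis norm_mult)
      also have "\<dots> \<le> norm (rGamma w) * (C * real (Suc n) powr (- (1/2)) * (Gamma (Re w) * (1 + real r - 1/2) powr (- Re w)))"
        by (intro mult_left_mono C(2) w) auto
      also have "\<dots> = D * (real r + 1/2) powr (- Re w) * real (Suc n) powr (- (1/2))"
        by (simp add: D_def add.commute mult_ac)
      finally have "norm (hasse_diff n r w / of_nat (Suc n)) \<le>
           D * (real r + 1/2) powr (- Re w) * real (Suc n) powr (- (1/2)) / real (Suc n)"
        unfolding norm_divide norm_of_nat by (intro divide_right_mono) auto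
      also have "\<dots> = D * (real r + 1/2) powr (- Re w) * real (Suc n) powr (- (3/2))"
        using powr_add[of "real (Suc n)" "-1" "-(1/2)"] by (simp add: powr_minus_divide field_simps)
      finally show ?thesis .
    qed
    note sb = summable_Suc_powr
    define E where "E = D * (\<Sum>n. real (Suc n) powr (- (3/2)))"
    have "norm (T r) \<le> E * (real r + 1/2) powr (- Re w)" for r
    proof -
      have "norm (T r) \<le> (\<Sum>n. D * (real r + 1/2) powr (- Re w) * real (Suc n) powr (- (3/2)))"
        unfolding T_def by (intro norm_suminf_le bound summable_mult sb)
      also have "\<dots> = E * (real r + 1/2) powr (- Re w)"
        by (subst suminf_mult[OF sb]) (simp only: E_def mult_ac)
      finally show ?thesis .
    qed
    then have "eventually (\<lambda>r. norm (T r) \<le> E * (real r + 1/2) powr (- Re w)) sequentially"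
      by (intro always_eventually allI)
    moreover have "(\<lambda>r. E * (real r + 1/2) powr (- Re w)) \<longlonglongrightarrow> 0"
    proof (intro tendsto_mult_right_zero tendsto_neg_powr)
      show "filterlim (\<lambda>r. real r + 1 / 2) at_top sequentially" by real_asymp
    qed (use w in auto)
    ultimately show ?thesis by (rule Lim_null_comparison)
  qed
  from telescope_sums'[OF this] have "(\<lambda>r. w * of_nat (Suc r) powr (- w - 1)) sums T 0"
    unfolding diff by simp
  moreover have "w * of_nat (Suc r) powr (- w - 1) = (s - 1) * (1 / of_nat (Suc r) powr s)" for r
    by (simp add: w_def powr_minus_divide algebra_simps del: of_nat_Suc)
  moreover have "T 0 = hasse_series s" by (simp add: T_def hasse_series_def w_def)
  ultimately show ?thesis by simp
qed

text \<open>The quotient witnesses that the choice in \<open>riemann_zeta\<close> is not empty; the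
  chosen function agrees with it for Re s > 1, hence by the identity theorem on the connected
  punctured plane.\<close>

lemma riemann_zeta_eq:
  assumes "s \<noteq> 1"
  shows "riemann_zeta s = hasse_series s / (s - 1)"
proof -
  let ?P = "\<lambda>f. f holomorphic_on - {1} \<and> (\<forall>s. Re s > 1 \<longrightarrow> (\<lambda>n. 1 / of_nat (Suc n) powr s) sums f s)"
  let ?h = "\<lambda>s. hasse_series s / (s - 1)"
  have h: "?P ?h"
  proof (intro conjI allI impI)
    show "?h holomorphic_on - {1}" by (intro holomorphic_intros hasse_series_holomorphic) auto
    fix s :: complex assume "Re s > 1"
    moreover from this have "s - 1 \<noteq> 0" by auto
    ultimately show "(\<lambda>n. 1 / of_nat (Suc n) powr s) sums ?h s"
      using sums_divide[OF hasse_series_eq, of s "s - 1"]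
      by (simp only: nonzero_mult_div_cancel_left simp_thms)
  qed
  have z: "?P riemann_zeta" unfolding riemann_zeta_def by (rule someI[where P = ?P, OF h])
  show ?thesis
  proof (rule analytic_continuation_open[of "{s. Re s > 1}" "- {1}" riemann_zeta ?h s])
    show "open {s. Re s > 1}" by (rule open_halfspace_Re_gt)
    show "{s. Re s > 1} \<noteq> {}" by (auto intro!: exI[of _ 2])
    show "connected (- {1::complex})"
      using connected_punctured_universe[of "1::complex"] by simp
    show "riemann_zeta z = ?h z" if "z \<in> {s. Re s > 1}" for z
      using that h z sums_unique2 by blast
  qed (use h z assms in auto)
qed

section \<open>Rational values of zeta\<close>

text \<open>For k > 0 this is (s - 1) zeta(s) at s = 1 - k, that is -k zeta(1 - k): the Bernoulli
  number B_k in the convention B_1 = 1/2.\<close>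

definition zeta_numerator :: "nat \<Rightarrow> rat" where
  "zeta_numerator k = (\<Sum>n\<le>k. alt_diff (\<lambda>j. of_nat (Suc j) ^ k) n / of_nat (Suc n))"

lemma hasse_diff_eq_of_rat:
  "hasse_diff n 0 (- of_nat k) = of_rat (alt_diff (\<lambda>j. of_nat (Suc j) ^ k) n)"
  by (simp add: hasse_diff_sum alt_diff_def of_rat_sum of_rat_mult of_rat_power powr_nat' of_rat_minus
      del: of_nat_add of_nat_Suc)

text \<open>The identity is pulled back from the complex numbers through the injective
  \<open>of_rat\<close>.\<close>

lemma alt_diff_power_eq_0:
  assumes "n > k"
  shows "alt_diff (\<lambda>j. of_nat (Suc j) ^ k :: rat) n = 0"
  using hasse_diff_neg_of_nat[OF assms, of 0] by (simp add: hasse_diff_eq_of_rat)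

lemma riemann_zeta_one_minus_of_nat:
  assumes "k > 0"
  shows "riemann_zeta (1 - of_nat k) = of_rat (- zeta_numerator k / of_nat k)"
proof -
  have "hasse_series (1 - of_nat k) = (\<Sum>n. hasse_diff n 0 (- of_nat k) / of_nat (Suc n))"
    by (simp add: hasse_series_def)
  also have "\<dots> = (\<Sum>n\<le>k. hasse_diff n 0 (- of_nat k) / of_nat (Suc n))"
    by (intro suminf_finite) (auto simp: hasse_diff_neg_of_nat)
  also have "\<dots> = of_rat (zeta_numerator k)"
    unfolding hasse_diff_eq_of_rat zeta_numerator_def of_rat_sum of_rat_divide of_rat_of_nat_eq ..
  finally show ?thesis using assms
    by (subst riemann_zeta_eq) (auto simp: of_rat_divide of_rat_minus)
qed

section \<open>The total ring of fractions\<close>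

context cring
begin

lemma regular_elementsD: "s \<in> regular_elements R \<Longrightarrow> s \<in> carrier R"
  by (simp add: regular_elements_def)

lemma regular_elements_cancel:
  assumes "s \<in> regular_elements R" "a \<in> carrier R" "b \<in> carrier R" "a \<otimes> s = b \<otimes> s"
  shows "a = b"
proof -
  note s = regular_elementsD[OF assms(1)]
  have "(a \<ominus> b) \<otimes> s = \<zero>"
    using assms(2-4) s by (simp add: a_minus_def l_distr l_minus r_neg)
  then have "a \<ominus> b = \<zero>" using assms s by (simp add: regular_elements_def)
  moreover have "a = (a \<ominus> b) \<oplus> b" using assms(2,3) by (simp add: a_minus_def a_assoc l_neg)
  ultimately show ?thesis using assms(3) by simp
qed

lemma one_regular: "\<one> \<in> regular_elements R"
  by (simp add: regular_elements_def)

lemma regular_mult: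
  assumes "s \<in> regular_elements R" "t \<in> regular_elements R"
  shows "s \<otimes> t \<in> regular_elements R"
  unfolding regular_elements_def
proof (intro CollectI conjI ballI impI)
  note reg = assms[THEN regular_elementsD]
  show "s \<otimes> t \<in> carrier R" using reg by simp
  fix a assume a: "a \<in> carrier R" "a \<otimes> (s \<otimes> t) = \<zero>"
  then have "(a \<otimes> s) \<otimes> t = \<zero>" using reg by (simp add: m_assoc)
  then have "a \<otimes> s = \<zero>" using assms(2) a(1) reg by (simp add: regular_elements_def)
  then show "a = \<zero>" using assms(1) a(1) by (simp add: regular_elements_def)
qed

text \<open>Transitivity uses regularity: the relation is first obtained after multiplication by the
  middle denominator t, which is then cancelled.\<close>

lemma equiv_fraction_rel: "equiv (carrier R \<times> regular_elements R) (fraction_rel R)"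
proof (rule equivI)
  show "fraction_rel R \<subseteq> (carrier R \<times> regular_elements R) \<times> carrier R \<times> regular_elements R"
    by (auto simp: fraction_rel_def)
  show "refl_on (carrier R \<times> regular_elements R) (fraction_rel R)"
    by (auto simp: refl_on_def fraction_rel_def)
  show "sym (fraction_rel R)"
    by (auto simp: sym_def fraction_rel_def)
  show "trans (fraction_rel R)"
  proof (rule transI, clarify)
    fix a s b t c u
    assume "((a, s), b, t) \<in> fraction_rel R" "((b, t), c, u) \<in> fraction_rel R"
    then have mem: "a \<in> carrier R" "s \<in> regular_elements R" "b \<in> carrier R" "t \<in> regular_elements R"
        "c \<in> carrier R" "u \<in> regular_elements R"
      and eq: "a \<otimes> t = b \<otimes> s" "b \<otimes> u = c \<otimes> t"
      by (auto simp: fraction_rel_def)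
    note reg = mem(2,4,6)[THEN regular_elementsD]
    have "(a \<otimes> u) \<otimes> t = (a \<otimes> t) \<otimes> u" using mem reg by (simp add: m_ac)
    also have "\<dots> = (b \<otimes> u) \<otimes> s" using mem reg by (simp add: eq(1) m_ac)
    also have "\<dots> = (c \<otimes> s) \<otimes> t" using mem reg by (simp add: eq(2) m_ac)
    finally have "a \<otimes> u = c \<otimes> s" using regular_elements_cancel[of t "a \<otimes> u" "c \<otimes> s"] mem reg by simp
    then show "((a, s), c, u) \<in> fraction_rel R" using mem by (simp add: fraction_rel_def)
  qed
qed

lemma fraction_eq_iff:
  assumes "a \<in> carrier R" "s \<in> regular_elements R" "b \<in> carrier R" "t \<in> regular_elements R"
  shows "fraction R a s = fraction R b t \<longleftrightarrow> a \<otimes> t = b \<otimes> s"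
  unfolding fraction_def
  using eq_equiv_class_iff[OF equiv_fraction_rel, of "(a, s)" "(b, t)"] assms
  by (auto simp: fraction_rel_def)

lemma total_fraction_ring_carrierE:
  assumes "\<xi> \<in> carrier (total_fraction_ring R)"
  obtains a s where "a \<in> carrier R" "s \<in> regular_elements R" "\<xi> = fraction R a s"
  using assms by (auto simp: total_fraction_ring_def fraction_def elim!: quotientE)

lemma fraction_in_carrier:
  "\<lbrakk>a \<in> carrier R; s \<in> regular_elements R\<rbrakk> \<Longrightarrow> fraction R a s \<in> carrier (total_fraction_ring R)"
  by (auto simp: total_fraction_ring_def fraction_def intro!: quotientI)

text \<open>The product is a union over all pairs of representatives. It collapses to one class
  because the classes are nonempty and every pair yields the same fraction.\<close>

lemma fraction_mult:
  assumes "a \<in> carrier R" "s \<in> regular_elements R" "b \<in> carrier R" "t \<in> regular_elements R"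
  shows "fraction R a s \<otimes>\<^bsub>total_fraction_ring R\<^esub> fraction R b t = fraction R (a \<otimes> b) (s \<otimes> t)"
proof -
  have const: "fraction R (a' \<otimes> b') (s' \<otimes> t') = fraction R (a \<otimes> b) (s \<otimes> t)"
    if "(a', s') \<in> fraction R a s" "(b', t') \<in> fraction R b t" for a' s' b' t'
  proof -
    from that have mem: "a' \<in> carrier R" "s' \<in> regular_elements R" "b' \<in> carrier R" "t' \<in> regular_elements R"
      and eq: "a \<otimes> s' = a' \<otimes> s" "b \<otimes> t' = b' \<otimes> t"
      by (auto simp: fraction_def fraction_rel_def)
    note reg = assms(2,4)[THEN regular_elementsD] mem(2,4)[THEN regular_elementsD]
    have "(a' \<otimes> b') \<otimes> (s \<otimes> t) = (a' \<otimes> s) \<otimes> (b' \<otimes> t)" using assms mem reg by (simp add: m_ac)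
    also have "\<dots> = (a \<otimes> b) \<otimes> (s' \<otimes> t')" using assms mem reg by (simp add: eq[symmetric] m_ac)
    finally show ?thesis using assms mem 
      using fraction_eq_iff[of "a' \<otimes> b'" "s' \<otimes> t'" "a \<otimes> b" "s \<otimes> t"] regular_mult by simp
  qed
  have mem: "(a, s) \<in> fraction R a s" "(b, t) \<in> fraction R b t"
    using assms by (auto simp: fraction_def fraction_rel_def)
  have "(\<Union>y\<in>fraction R b t. fraction R (fst x \<otimes> fst y) (snd x \<otimes> snd y)) = fraction R (a \<otimes> b) (s \<otimes> t)"
    if "x \<in> fraction R a s" for x
  proof (rule SUP_eq_const)
    show "fraction R b t \<noteq> {}" using mem(2) by blast
    show "fraction R (fst x \<otimes> fst y) (snd x \<otimes> snd y) = fraction R (a \<otimes> b) (s \<otimes> t)"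
      if "y \<in> fraction R b t" for y
      using const[of "fst x" "snd x" "fst y" "snd y"] \<open>x \<in> fraction R a s\<close> that by simp
  qed
  moreover have "fraction R a s \<noteq> {}" using mem(1) by blast
  ultimately have "(\<Union>x\<in>fraction R a s. \<Union>y\<in>fraction R b t.
      fraction R (fst x \<otimes> fst y) (snd x \<otimes> snd y)) = fraction R (a \<otimes> b) (s \<otimes> t)"
    by (rule SUP_eq_const[rotated])
  then show ?thesis by (simp add: total_fraction_ring_def case_prod_unfold)
qed

lemma fraction_embed_eq_iff:
  "\<lbrakk>a \<in> carrier R; b \<in> carrier R\<rbrakk> \<Longrightarrow> fraction_embed R a = fraction_embed R b \<longleftrightarrow> a = b"
  unfolding fraction_embed_def by (subst fraction_eq_iff) (auto intro: one_regular)

lemma fraction_embed_mult_fraction: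
  assumes "c \<in> carrier R" "a \<in> carrier R" "s \<in> regular_elements R"
  shows "fraction_embed R c \<otimes>\<^bsub>total_fraction_ring R\<^esub> fraction R a s = fraction R (c \<otimes> a) s"
  using assms regular_elementsD[OF assms(3)]
  by (simp add: fraction_embed_def fraction_mult one_regular)

text \<open>Turns the condition that a fraction lies in the ring, as required of pseudo-measures,
  into a divisibility.\<close>

lemma fraction_eq_embed_iff:
  assumes "a \<in> carrier R" "s \<in> regular_elements R" "b \<in> carrier R"
  shows "fraction R a s = fraction_embed R b \<longleftrightarrow> a = b \<otimes> s"
  unfolding fraction_embed_def using assms by (subst fraction_eq_iff) (auto intro: one_regular)

end

section \<open>Arithmetic in a finite extension of the p-adic numbers\<close>

lemma inverse_diff_inverse_divide:
  fixes x y :: "'b::field"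
  assumes "x \<noteq> 0" "y \<noteq> 0"
  shows "inverse x - inverse y = (y - x) / (x * y)"
  using assms by (simp add: field_simps)

locale padic_field =
  fixes p :: nat and L :: "'a::{field_char_0,metric_space} itself"
  assumes prime_p: "prime p" and odd_p: "odd p"
    and extension: "finite_extension_Qp p TYPE('a)"
begin

section \<open>The absolute value on the integers\<close>

text \<open>Estimates are made against these discrete radii, so that they translate into congruences
  modulo p^N.\<close>

definition rad :: "nat \<Rightarrow> real" where
  "rad N = (1 / real p) ^ N"

lemma dist_absval: "dist x y = absval (x - y)" for x y :: 'a
  using extension by (simp add: finite_extension_Qp_def)

lemma absval_mult: "absval (x * y) = absval x * absval y" for x y :: 'a
  using extension by (simp add: finite_extension_Qp_def)

lemma absval_add_le_max: "absval (x + y) \<le> max (absval x) (absval y)" for x y :: 'a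
  using extension by (simp add: finite_extension_Qp_def)

lemma absval_p: "absval (of_nat p :: 'a) = 1 / real p"
  using extension by (simp add: finite_extension_Qp_def)

lemma absval_nonneg: "absval (x::'a) \<ge> 0"
  by (simp add: absval_def)

lemma absval_eq_0_iff: "absval (x::'a) = 0 \<longleftrightarrow> x = 0"
  by (simp add: absval_def)

lemma absval_0 [simp]: "absval (0::'a) = 0"
  by (simp add: absval_def)

lemma absval_1 [simp]: "absval (1::'a) = 1"
  using absval_mult[of 1 1] absval_eq_0_iff[of 1] by simp

lemma absval_power: "absval (x ^ n :: 'a) = absval x ^ n"
  by (induction n) (auto simp: absval_mult)

lemma absval_minus [simp]: "absval (- x :: 'a) = absval x"
proof -
  have "absval (-1 :: 'a) ^ 2 = 1"
    using absval_power[of "-1" 2] by simp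
  then have "absval (-1 :: 'a) = 1"
    using absval_nonneg[of "-1"] by (simp add: power2_eq_1_iff)
  then show ?thesis using absval_mult[of "-1" x] by simp
qed

lemma absval_minus_commute: "absval (x - y :: 'a) = absval (y - x)"
  using absval_minus[of "x - y"] by (simp del: absval_minus)

lemma absval_inverse: "absval (inverse x :: 'a) = inverse (absval x)"
proof (cases "x = 0")
  case False
  then have "absval x * absval (inverse x) = 1" by (simp flip: absval_mult)
  then show ?thesis by (simp add: inverse_unique)
qed simp

lemma absval_divide: "absval (x / y :: 'a) = absval x / absval y"
  by (simp add: divide_inverse absval_mult absval_inverse)

lemma absval_add_le: "\<lbrakk>absval x \<le> c; absval y \<le> c\<rbrakk> \<Longrightarrow> absval (x + y :: 'a) \<le> c"
  using absval_add_le_max[of x y] by linarith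

lemma absval_diff_le: "\<lbrakk>absval x \<le> c; absval y \<le> c\<rbrakk> \<Longrightarrow> absval (x - y :: 'a) \<le> c"
  using absval_add_le[of x c "-y"] by simp

lemma absval_triangle_le: "\<lbrakk>absval (x - y) \<le> c; absval (y - z) \<le> c\<rbrakk> \<Longrightarrow> absval (x - z :: 'a) \<le> c"
  using absval_add_le[of "x - y" c "y - z"] by simp

lemma absval_triangle_less: "\<lbrakk>absval (x - y) < c; absval (y - z) < c\<rbrakk> \<Longrightarrow> absval (x - z :: 'a) < c"
  using absval_add_le_max[of "x - y" "y - z"] by simp

lemma absval_sum_le:
  "\<lbrakk>0 \<le> c; \<And>i. i \<in> A \<Longrightarrow> absval (f i) \<le> c\<rbrakk> \<Longrightarrow> absval (sum f A :: 'a) \<le> c"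
  by (induction A rule: infinite_finite_induct) (auto intro: absval_add_le)

lemma absval_mult_le: "\<lbrakk>absval x \<le> c; absval y \<le> d\<rbrakk> \<Longrightarrow> absval (x * y :: 'a) \<le> c * d"
  unfolding absval_mult by (rule mult_mono) (auto intro: absval_nonneg order_trans)

lemma absval_mult_le_left: "\<lbrakk>absval x \<le> 1; absval y \<le> c\<rbrakk> \<Longrightarrow> absval (x * y :: 'a) \<le> c"
  using absval_mult_le[of x 1 y c] by simp

lemma absval_power_le_1: "absval x \<le> 1 \<Longrightarrow> absval (x ^ n :: 'a) \<le> 1"
  by (simp add: absval_power power_le_one absval_nonneg)

text \<open>In an ultrametric triangle the two longest sides are equal.\<close>

lemma absval_eq_of_close: "absval (x - y) < absval x \<Longrightarrow> absval y = absval (x::'a)"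
  using absval_add_le_max[of "x - y" y] absval_add_le_max[of "y - x" x] absval_minus_commute[of x y]
  by (auto simp: max_def split: if_splits)

lemma absval_of_nat_le_1: "absval (of_nat n :: 'a) \<le> 1"
  by (induction n) (auto intro: absval_add_le)

lemma absval_of_int_le_1: "absval (of_int z :: 'a) \<le> 1"
  by (cases z) (auto simp: absval_of_nat_le_1 simp del: of_nat_Suc)

lemma p_gt_2: "p > 2"
  using prime_p odd_p prime_ge_2_nat[of p] by (cases "p = 2") auto

lemma rad_pos [simp]: "rad N > 0"
  using p_gt_2 by (simp add: rad_def)

lemma rad_nonneg [simp]: "rad N \<ge> 0"
  using rad_pos[of N] by (rule less_imp_le)

lemma rad_0 [simp]: "rad 0 = 1"
  by (simp add: rad_def)

lemma rad_le_rad_iff: "rad M \<le> rad N \<longleftrightarrow> N \<le> M"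
  unfolding rad_def by (rule power_decreasing_iff) (use p_gt_2 in auto)

lemma rad_le_1: "rad N \<le> 1"
  using rad_le_rad_iff[of N 0] by simp

lemma rad_add: "rad (M + N) = rad M * rad N"
  by (simp add: rad_def power_add)

lemma rad_tendsto_0: "rad \<longlonglongrightarrow> 0"
  unfolding rad_def by (rule LIMSEQ_power_zero) (use p_gt_2 in auto)

lemma ex_rad_less:
  assumes "e > 0"
  shows "\<exists>N. rad N < e"
proof -
  have "eventually (\<lambda>N. rad N < e) sequentially"
    using rad_tendsto_0 assms by (rule order_tendstoD)
  then show ?thesis by (auto simp: eventually_sequentially)
qed

lemma absval_p_power: "absval (of_nat p ^ N :: 'a) = rad N"
  by (simp add: absval_power absval_p rad_def)

text \<open>If |n| < 1, then in a Bezout relation u n + v p = 1 both terms would have absolute value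
  below 1, by the ultrametric inequality so would 1.\<close>

lemma absval_of_nat_eq_1:
  assumes "\<not> p dvd n"
  shows "absval (of_nat n :: 'a) = 1"
proof (rule ccontr)
  assume "absval (of_nat n :: 'a) \<noteq> 1"
  then have less: "absval (of_nat n :: 'a) < 1" using absval_of_nat_le_1[of n] by simp
  have "coprime (int n) (int p)"
    using assms prime_p by (metis coprime_commute coprime_int_iff prime_imp_coprime)
  then obtain u v where uv: "u * int n + v * int p = 1"
    by (metis bezout_int coprime_imp_gcd_eq_1)
  have "1 = (of_int (u * int n + v * int p) :: 'a)" by (simp only: uv of_int_1)
  also have "\<dots> = of_int u * of_nat n + of_int v * of_nat p" by simp
  finally have "1 \<le> max (absval (of_int u * of_nat n :: 'a)) (absval (of_int v * of_nat p :: 'a))"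
    using absval_add_le_max[of "of_int u * of_nat n" "of_int v * of_nat p"] by (metis absval_1)
  moreover have "absval (of_int u * of_nat n :: 'a) < 1"
    using mult_mono[OF absval_of_int_le_1[of u] order_refl, of "absval (of_nat n :: 'a)"] less
    by (simp add: absval_mult absval_nonneg)
  moreover have "absval (of_int v * of_nat p :: 'a) < 1"
    using mult_mono[OF absval_of_int_le_1[of v] order_refl, of "absval (of_nat p :: 'a)"] p_gt_2
      absval_of_int_le_1[of v]
    by (simp add: absval_mult absval_p)
  ultimately show False by simp
qed

lemma absval_of_nat_le_rad_iff: "absval (of_nat n :: 'a) \<le> rad N \<longleftrightarrow> p ^ N dvd n"
proof
  assume "p ^ N dvd n"
  then obtain m where "n = p ^ N * m" ..
  then show "absval (of_nat n :: 'a) \<le> rad N"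
    using mult_left_le[OF absval_of_nat_le_1[of m], of "rad N"]
    by (simp add: absval_mult absval_p_power less_imp_le)
next
  assume le: "absval (of_nat n :: 'a) \<le> rad N"
  show "p ^ N dvd n"
  proof (cases "n = 0")
    case False
    then obtain u where u: "n = p ^ multiplicity p n * u" "\<not> p dvd u"
      using multiplicity_decompose'[of n p] prime_p by (metis not_prime_unit)
    then have "absval (of_nat n :: 'a) = rad (multiplicity p n)"
      by (metis absval_mult absval_p_power absval_of_nat_eq_1 mult.right_neutral of_nat_mult of_nat_power)
    then have "N \<le> multiplicity p n" using le by (simp add: rad_le_rad_iff)
    then show ?thesis by (rule multiplicity_dvd')
  qed simp
qed

lemma absval_of_int_le_rad_iff: "absval (of_int z :: 'a) \<le> rad N \<longleftrightarrow> int p ^ N dvd z"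
proof -
  have "absval (of_int z :: 'a) = absval (of_nat (nat \<bar>z\<bar>) :: 'a)"
    by (cases "z \<ge> 0") (auto simp: absval_minus_commute)
  then show ?thesis
    using dvd_nat_abs_iff[of "p ^ N" z] by (simp only: absval_of_nat_le_rad_iff of_nat_power)
qed

lemma absval_of_nat_diff_le_rad_iff:
  "absval (of_nat a - of_nat b :: 'a) \<le> rad N \<longleftrightarrow> [a = b] (mod p ^ N)"
proof -
  have "absval (of_nat a - of_nat b :: 'a) = absval (of_int (int a - int b) :: 'a)" by simp
  then show ?thesis
    by (simp only: absval_of_int_le_rad_iff) (metis cong_iff_dvd_diff cong_int_iff of_nat_power)
qed

section \<open>Limits in the ultrametric field\<close>

text \<open>The topology of the field is given only by its metric, so continuity of the ring
  operations is derived from the absolute value.\<close>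

lemma tendsto_absval: "(f \<longlongrightarrow> l) F \<longleftrightarrow> ((\<lambda>x. absval (f x - l :: 'a)) \<longlongrightarrow> 0) F"
  by (subst tendsto_dist_iff) (simp add: dist_absval)

lemma padic_tendsto_const_mult:
  assumes "(f \<longlongrightarrow> l) F"
  shows "((\<lambda>x. c * f x) \<longlongrightarrow> (c * l :: 'a)) F"
proof -
  have "absval (c * f x - c * l) = absval c * absval (f x - l)" for x
    by (simp only: absval_mult[symmetric] right_diff_distrib)
  then show ?thesis
    using tendsto_mult_left[OF assms[unfolded tendsto_absval], of "absval c"]
    unfolding tendsto_absval[of "\<lambda>x. c * f x"] by simp
qed

lemma padic_tendsto_add:
  assumes "(f \<longlongrightarrow> l) F" "(g \<longlongrightarrow> m) F"
  shows "((\<lambda>x. f x + g x) \<longlongrightarrow> (l + m :: 'a)) F"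
  unfolding tendsto_absval
proof (rule Lim_null_comparison)
  show "\<forall>\<^sub>F x in F. norm (absval (f x + g x - (l + m))) \<le> absval (f x - l) + absval (g x - m)"
  proof (rule always_eventually, rule allI)
    fix x
    have "absval (f x + g x - (l + m)) \<le> max (absval (f x - l)) (absval (g x - m))"
      using absval_add_le_max[of "f x - l" "g x - m"] by (simp add: algebra_simps)
    also have "\<dots> \<le> absval (f x - l) + absval (g x - m)"
      using absval_nonneg[of "f x - l"] absval_nonneg[of "g x - m"] by simp
    finally show "norm (absval (f x + g x - (l + m))) \<le> absval (f x - l) + absval (g x - m)"
      by (simp add: absval_nonneg)
  qed
  show "((\<lambda>x. absval (f x - l) + absval (g x - m)) \<longlongrightarrow> 0) F"
    using tendsto_add[OF assms[unfolded tendsto_absval]] by simp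
qed

lemma padic_tendsto_diff:
  assumes "(f \<longlongrightarrow> l) F" "(g \<longlongrightarrow> m) F"
  shows "((\<lambda>x. f x - g x) \<longlongrightarrow> (l - m :: 'a)) F"
  using padic_tendsto_add[OF assms(1) padic_tendsto_const_mult[OF assms(2), of "-1"]] by simp

lemma absval_le_of_tendsto:
  assumes "f \<longlonglongrightarrow> l" "\<And>n. n \<ge> N \<Longrightarrow> absval (f n - c :: 'a) \<le> e"
  shows "absval (l - c) \<le> e"
proof -
  have "(\<lambda>n. dist (f n) c) \<longlonglongrightarrow> dist l c" by (intro tendsto_dist assms(1) tendsto_const)
  then show ?thesis unfolding dist_absval
    by (rule LIMSEQ_le_const2) (use assms(2) in blast)
qed

section \<open>The subfield of p-adic numbers\<close>

lemma Qp_iff: "x \<in> Qp \<longleftrightarrow> (\<forall>e>0. \<exists>q. absval (x - of_rat q :: 'a) < e)"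
proof -
  have "dist (of_rat q) x = absval (x - of_rat q)" for q
    by (simp only: dist_absval absval_minus_commute[of x])
  then show ?thesis unfolding Qp_def closure_approachable by simp
qed

lemma of_rat_in_Qp [simp]: "of_rat q \<in> (Qp :: 'a set)"
  unfolding Qp_def by (rule subsetD[OF closure_subset rangeI])

lemma of_nat_in_Qp [simp]: "of_nat n \<in> (Qp :: 'a set)"
  using of_rat_in_Qp[of "of_nat n"] by (simp del: of_rat_in_Qp)

lemma of_int_in_Qp [simp]: "of_int n \<in> (Qp :: 'a set)"
  using of_rat_in_Qp[of "of_int n"] by (simp del: of_rat_in_Qp)

lemma zero_in_Qp [simp]: "0 \<in> (Qp :: 'a set)" and one_in_Qp [simp]: "1 \<in> (Qp :: 'a set)"
  using of_nat_in_Qp[of 0] of_nat_in_Qp[of 1] by auto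

lemma Qp_add:
  assumes "x \<in> Qp" "y \<in> Qp"
  shows "x + y \<in> (Qp :: 'a set)"
  unfolding Qp_iff
proof (intro allI impI)
  fix e :: real assume "e > 0"
  then obtain q r where "absval (x - of_rat q) < e" "absval (y - of_rat r) < e"
    using assms unfolding Qp_iff by meson
  then have "absval (x + y - of_rat (q + r)) < e"
    using absval_add_le_max[of "x - of_rat q" "y - of_rat r"] by (simp add: of_rat_add algebra_simps)
  then show "\<exists>q. absval (x + y - of_rat q) < e" ..
qed

lemma Qp_mult:
  assumes "x \<in> Qp" "y \<in> Qp"
  shows "x * y \<in> (Qp :: 'a set)"
  unfolding Qp_iff
proof (intro allI impI)
  fix e :: real assume e: "e > 0"
  obtain q where q: "absval (x - of_rat q) < e / (absval y + 1)"
    using assms(1) e absval_nonneg[of y] unfolding Qp_iff by (meson add_nonneg_pos divide_pos_pos zero_less_one)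
  obtain r where r: "absval (y - of_rat r) < e / (absval (of_rat q :: 'a) + 1)"
    using assms(2) e absval_nonneg[of "of_rat q"] unfolding Qp_iff
    by (meson add_nonneg_pos divide_pos_pos zero_less_one)
  have 1: "absval ((x - of_rat q) * y) < e"
  proof -
    have "absval (x - of_rat q) * absval y \<le> absval (x - of_rat q) * (absval y + 1)"
      using absval_nonneg by (intro mult_left_mono) auto
    also have "\<dots> < e" using q absval_nonneg[of y] by (simp add: field_simps)
    finally show ?thesis by (simp add: absval_mult)
  qed
  have 2: "absval (of_rat q * (y - of_rat r)) < e"
  proof -
    have "absval (y - of_rat r) * absval (of_rat q :: 'a) \<le> absval (y - of_rat r) * (absval (of_rat q :: 'a) + 1)"
      using absval_nonneg by (intro mult_left_mono) auto
    also have "\<dots> < e" using r absval_nonneg[of "of_rat q"] by (simp add: field_simps)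
    finally show ?thesis by (simp add: absval_mult mult.commute)
  qed
  have "x * y - of_rat (q * r) = (x - of_rat q) * y + of_rat q * (y - of_rat r)"
    by (simp add: of_rat_mult algebra_simps)
  then have "absval (x * y - of_rat (q * r)) < e"
    using 1 2 absval_add_le_max[of "(x - of_rat q) * y" "of_rat q * (y - of_rat r)"] by simp
  then show "\<exists>q. absval (x * y - of_rat q) < e" ..
qed

lemma Qp_inverse:
  assumes "x \<in> Qp"
  shows "inverse x \<in> (Qp :: 'a set)"
proof (cases "x = 0")
  case False
  then have pos: "absval x > 0" using absval_nonneg[of x] absval_eq_0_iff[of x] by linarith
  show ?thesis unfolding Qp_iff
  proof (intro allI impI)
    fix e :: real assume e: "e > 0"
    \<comment> \<open>The first bound forces |q| = |x|; the second pays for the denominator x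
      q.\<close>
    obtain q where q: "absval (x - of_rat q) < min (absval x) (e * absval x ^ 2)"
      using assms e pos unfolding Qp_iff by (meson min_less_iff_conj mult_pos_pos zero_less_power)
    then have eq: "absval (of_rat q :: 'a) = absval x" by (intro absval_eq_of_close) simp
    then have nz: "(of_rat q :: 'a) \<noteq> 0" using pos by auto
    have "inverse x - of_rat (inverse q) = (of_rat q - x) / (x * of_rat q)"
      unfolding of_rat_inverse by (rule inverse_diff_inverse_divide[OF False nz])
    then have "absval (inverse x - of_rat (inverse q)) = absval (of_rat q - x) / (absval x * absval x)"
      by (simp only: absval_divide absval_mult eq)
    also have "\<dots> < e"
      using q pos by (subst pos_divide_less_eq) (auto simp: absval_minus_commute[of x] power2_eq_square)
    finally show "\<exists>q. absval (inverse x - of_rat q) < e" ..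
  qed
qed simp

lemma Qp_minus: "x \<in> Qp \<Longrightarrow> - x \<in> (Qp :: 'a set)"
  using Qp_mult[of "-1" x] of_int_in_Qp[of "-1"] by simp

lemma Qp_diff: "\<lbrakk>x \<in> Qp; y \<in> Qp\<rbrakk> \<Longrightarrow> x - y \<in> (Qp :: 'a set)"
  using Qp_add[of x "-y"] Qp_minus by simp

lemma Qp_divide: "\<lbrakk>x \<in> Qp; y \<in> Qp\<rbrakk> \<Longrightarrow> x / y \<in> (Qp :: 'a set)"
  by (simp add: divide_inverse Qp_mult Qp_inverse)

lemma Qp_power: "x \<in> Qp \<Longrightarrow> x ^ n \<in> (Qp :: 'a set)"
  by (induction n) (auto intro: Qp_mult)

lemma complete_Qp: "complete (Qp :: 'a set)"
  using extension by (simp add: finite_extension_Qp_def)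

section \<open>Completeness of a finite extension\<close>

definition qp_span :: "'a set \<Rightarrow> 'a set" where
  "qp_span B = {\<Sum>b\<in>B. c b * b |c. \<forall>b\<in>B. c b \<in> Qp}"

lemma qp_spanI: "(\<And>b. b \<in> B \<Longrightarrow> c b \<in> Qp) \<Longrightarrow> (\<Sum>b\<in>B. c b * b) \<in> qp_span B"
  unfolding qp_span_def by blast

lemma qp_span_mult:
  assumes "x \<in> qp_span B" "a \<in> Qp"
  shows "a * x \<in> qp_span B"
proof -
  obtain c where c: "x = (\<Sum>b\<in>B. c b * b)" "\<forall>b\<in>B. c b \<in> Qp"
    using assms(1) by (auto simp: qp_span_def)
  have "a * x = (\<Sum>b\<in>B. (a * c b) * b)" by (simp add: c sum_distrib_left mult_ac)
  then show ?thesis using c(2) assms(2) qp_spanI[of B "\<lambda>b. a * c b"] by (simp add: Qp_mult)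
qed

lemma qp_span_insert:
  assumes "finite B" "b \<notin> B"
  shows "qp_span (insert b B) = {y + a * b |y a. y \<in> qp_span B \<and> a \<in> Qp}"
proof (intro equalityI subsetI)
  fix x assume "x \<in> qp_span (insert b B)"
  then obtain c where c: "x = (\<Sum>b\<in>insert b B. c b * b)" "\<forall>b\<in>insert b B. c b \<in> Qp"
    by (auto simp: qp_span_def)
  then have "x = (\<Sum>b\<in>B. c b * b) + c b * b" using assms by (simp add: add.commute)
  then show "x \<in> {y + a * b |y a. y \<in> qp_span B \<and> a \<in> Qp}"
    using c(2) unfolding qp_span_def by blast
next
  fix x assume "x \<in> {y + a * b |y a. y \<in> qp_span B \<and> a \<in> Qp}"
  then obtain c a where c: "x = (\<Sum>b\<in>B. c b * b) + a * b" "\<forall>b\<in>B. c b \<in> Qp" "a \<in> Qp"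
    by (auto simp: qp_span_def)
  have "(\<Sum>d\<in>B. (c(b := a)) d * d) = (\<Sum>d\<in>B. c d * d)"
    using assms(2) by (intro sum.cong) auto
  then have "x = (\<Sum>d\<in>insert b B. (c(b := a)) d * d)" using assms c(1) by (simp add: add.commute)
  moreover have "\<forall>d\<in>insert b B. (c(b := a)) d \<in> Qp" using c by auto
  ultimately show "x \<in> qp_span (insert b B)" unfolding qp_span_def by blast
qed

text \<open>A new generator b outside the span has positive distance e from it, because a complete
  subspace is closed. This bounds the coefficient of b by the whole vector, so along a Cauchy
  sequence both the coefficient and the remainder are Cauchy.\<close>

lemma complete_qp_span: "finite B \<Longrightarrow> complete (qp_span B)"
proof (induction B rule: finite_induct)
  case empty
  have "qp_span {} = {0}" by (simp add: qp_span_def)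
  then show ?case by (simp add: compact_imp_complete)
next
  case (insert b B)
  note span_eq = qp_span_insert[OF insert.hyps]
  show ?case
  proof (cases "b \<in> qp_span B")
    case True
    have "qp_span (insert b B) = qp_span B"
    proof (intro equalityI subsetI)
      fix x assume "x \<in> qp_span (insert b B)"
      then obtain y a where x: "x = y + a * b" "y \<in> qp_span B" "a \<in> Qp" unfolding span_eq by blast
      from x(2) obtain c where c: "y = (\<Sum>b\<in>B. c b * b)" "\<forall>b\<in>B. c b \<in> Qp"
        by (auto simp: qp_span_def)
      from qp_span_mult[OF True x(3)] obtain d where d: "a * b = (\<Sum>b\<in>B. d b * b)" "\<forall>b\<in>B. d b \<in> Qp"
        by (auto simp: qp_span_def)
      have "x = (\<Sum>b\<in>B. (c b + d b) * b)" by (simp add: x(1) c(1) d(1) sum.distrib distrib_right)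
      then show "x \<in> qp_span B" using c(2) d(2) qp_spanI[of B "\<lambda>b. c b + d b"] by (simp add: Qp_add)
    next
      fix x assume "x \<in> qp_span B"
      then show "x \<in> qp_span (insert b B)" unfolding span_eq
        using zero_in_Qp by (intro CollectI exI[of _ x] exI[of _ 0]) auto
    qed
    then show ?thesis using insert.IH by simp
  next
    case False
    have "closed (qp_span B)" using insert.IH by (rule complete_imp_closed)
    then have "open (- qp_span B)" by (simp add: open_Compl)
    then obtain e where e: "e > 0" "\<And>y. dist y b < e \<Longrightarrow> y \<notin> qp_span B"
      using False unfolding open_dist by auto
    \<comment> \<open>After division by a, the left summand becomes the negative of an element of
      the span, which keeps distance e from b.\<close>
    have lower: "e * absval a \<le> absval (y + a * b)" if "y \<in> qp_span B" "a \<in> Qp" for y a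
    proof (cases "a = 0")
      case False
      have "- inverse a * y \<in> qp_span B" using that by (intro qp_span_mult Qp_minus Qp_inverse)
      then have "e \<le> dist (- inverse a * y) b" using e(2) not_le_imp_less by metis
      also have "\<dots> = absval (inverse a * (y + a * b))"
      proof -
        have "- inverse a * y - b = - (inverse a * (y + a * b))" using False by (simp add: field_simps)
        then show ?thesis by (simp only: dist_absval absval_minus)
      qed
      also have "\<dots> = absval (y + a * b) / absval a"
        by (simp add: absval_mult absval_inverse divide_inverse mult.commute)
      finally show ?thesis
        using False absval_nonneg[of a] absval_eq_0_iff[of a] by (simp add: field_simps)
    qed (simp add: absval_nonneg)
    show ?thesis unfolding complete_def
    proof (intro allI impI)
      fix f :: "nat \<Rightarrow> 'a" assume f: "(\<forall>n. f n \<in> qp_span (insert b B)) \<and> Cauchy f"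
      then have "\<forall>n. \<exists>y a. f n = y + a * b \<and> y \<in> qp_span B \<and> a \<in> Qp" unfolding span_eq by blast
      then obtain y a where ya: "\<And>n. f n = y n + a n * b" "\<And>n. y n \<in> qp_span B" "\<And>n. a n \<in> Qp"
        by metis
      have span_diff: "u - v \<in> qp_span B" if "u \<in> qp_span B" "v \<in> qp_span B" for u v
      proof -
        from that obtain c d where "u = (\<Sum>b\<in>B. c b * b)" "\<forall>b\<in>B. c b \<in> Qp"
          "v = (\<Sum>b\<in>B. d b * b)" "\<forall>b\<in>B. d b \<in> Qp" by (auto simp: qp_span_def)
        then have "u - v = (\<Sum>b\<in>B. (c b - d b) * b)" "\<forall>b\<in>B. c b - d b \<in> Qp"
          by (auto simp: sum_subtractf left_diff_distrib intro: Qp_diff)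
        then show ?thesis using qp_spanI[of B "\<lambda>b. c b - d b"] by simp
      qed
      have diff: "e * dist (a m) (a n) \<le> dist (f m) (f n)" for m n
        using lower[of "y m - y n" "a m - a n"] span_diff ya
        by (simp add: dist_absval Qp_diff algebra_simps)
      have "Cauchy a"
      proof (rule metric_CauchyI)
        fix \<epsilon> :: real assume "\<epsilon> > 0"
        then have "e * \<epsilon> > 0" using e(1) by simp
        then obtain M where "\<forall>m\<ge>M. \<forall>n\<ge>M. dist (f m) (f n) < e * \<epsilon>"
          using f metric_CauchyD by blast
        then have "\<forall>m\<ge>M. \<forall>n\<ge>M. e * dist (a m) (a n) < e * \<epsilon>"
          using diff le_less_trans by blast
        then show "\<exists>M. \<forall>m\<ge>M. \<forall>n\<ge>M. dist (a m) (a n) < \<epsilon>" using e(1) by auto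
      qed
      then obtain l where l: "l \<in> Qp" "a \<longlonglongrightarrow> l" using complete_Qp ya(3) unfolding complete_def by blast
      have y_eq: "y = (\<lambda>n. f n - b * a n)" using ya(1) by (auto simp: fun_eq_iff mult.commute)
      have "Cauchy y"
      proof (rule metric_CauchyI)
        fix \<epsilon> :: real assume \<epsilon>: "\<epsilon> > 0"
        have "Cauchy (\<lambda>n. b * a n)" using padic_tendsto_const_mult[OF l(2)] by (intro LIMSEQ_imp_Cauchy)
        then obtain M where M: "\<forall>m\<ge>M. \<forall>n\<ge>M. dist (b * a m) (b * a n) < \<epsilon>"
          using \<epsilon> metric_CauchyD by blast
        obtain K where K: "\<forall>m\<ge>K. \<forall>n\<ge>K. dist (f m) (f n) < \<epsilon>"
          using f \<epsilon> metric_CauchyD by blast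
        have "dist (y m) (y n) < \<epsilon>" if "m \<ge> max M K" "n \<ge> max M K" for m n
        proof -
          have "dist (y m) (y n) = absval ((f m - f n) + (b * a n - b * a m))"
            by (simp add: y_eq dist_absval algebra_simps)
          also have "\<dots> \<le> max (dist (f m) (f n)) (dist (b * a n) (b * a m))"
            unfolding dist_absval by (rule absval_add_le_max)
          also have "\<dots> < \<epsilon>" using M K that by auto
          finally show ?thesis .
        qed
        then show "\<exists>M. \<forall>m\<ge>M. \<forall>n\<ge>M. dist (y m) (y n) < \<epsilon>" by blast
      qed
      then obtain k where k: "k \<in> qp_span B" "y \<longlonglongrightarrow> k"
        using insert.IH ya(2) unfolding complete_def by blast
      have "f = (\<lambda>n. y n + b * a n)" using ya(1) by (auto simp: fun_eq_iff mult.commute)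
      then have "f \<longlonglongrightarrow> k + b * l" using padic_tendsto_add[OF k(2) padic_tendsto_const_mult[OF l(2)]] by simp
      moreover have "k + b * l \<in> qp_span (insert b B)"
        unfolding span_eq using k(1) l(1)
        by (intro CollectI exI[of _ k] exI[of _ l]) (simp add: mult.commute)
      ultimately show "\<exists>l\<in>qp_span (insert b B). f \<longlonglongrightarrow> l" by blast
    qed
  qed
qed

text \<open>The finite degree of the extension enters here: limits of Riemann sums with values in
  the field must exist in it.\<close>

lemma complete_UNIV_padic: "complete (UNIV :: 'a set)"
proof -
  obtain B :: "'a set" where B: "finite B"
    "\<forall>x. \<exists>c :: 'a \<Rightarrow> 'a. (\<forall>b\<in>B. c b \<in> Qp) \<and> x = (\<Sum>b\<in>B. c b * b)"
    using extension unfolding finite_extension_Qp_def by blast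
  then have "qp_span B = UNIV" unfolding qp_span_def by blast
  then show ?thesis using complete_qp_span[OF B(1)] by simp
qed

text \<open>For an ultrametric, small consecutive differences already make a sequence
  Cauchy.\<close>

lemma padic_convergent:
  assumes "\<And>e. e > 0 \<Longrightarrow> \<exists>M. \<forall>n\<ge>M. absval (f (Suc n) - f n :: 'a) < e"
  shows "\<exists>l. f \<longlonglongrightarrow> l"
proof -
  have "Cauchy f"
  proof (rule metric_CauchyI)
    fix e :: real assume e: "e > 0"
    then obtain M where M: "\<forall>n\<ge>M. absval (f (Suc n) - f n) < e" using assms by blast
    have le: "absval (f n - f M) < e" if "n \<ge> M" for n
      using that
    proof (induction n rule: dec_induct)
      case (step n)
      then show ?case using M absval_triangle_less[of "f (Suc n)" "f n" e "f M"] by auto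
    qed (use e in simp)
    show "\<exists>M. \<forall>m\<ge>M. \<forall>n\<ge>M. dist (f m) (f n) < e"
      using le absval_triangle_less[of "f _" "f M" e "f _"] absval_minus_commute unfolding dist_absval by metis
  qed
  then show ?thesis using complete_UNIV_padic unfolding complete_def by blast
qed

section \<open>Integers, residues and units\<close>

lemma Zp_iff: "x \<in> (Zp :: 'a set) \<longleftrightarrow> x \<in> Qp \<and> absval x \<le> 1"
  by (simp add: Zp_def ring_of_integers_def)

text \<open>A nearby rational m/n in lowest terms has absolute value at most 1, so p does not divide
  n; inverting n modulo p^N turns m/n into a residue.\<close>

lemma Zp_approx_of_nat:
  assumes "x \<in> (Zp :: 'a set)"
  shows "\<exists>a < p ^ N. absval (x - of_nat a) \<le> rad N"
proof -
  obtain q where q: "absval (x - of_rat q) < rad N"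
    using assms Qp_iff[of x] rad_pos unfolding Zp_iff by blast
  obtain m n where mn: "quotient_of q = (m, n)" by (cases "quotient_of q")
  then have n: "n > 0" "coprime m n" by (auto dest: quotient_of_denom_pos quotient_of_coprime)
  have q_eq: "(of_rat q :: 'a) = of_int m / of_int n"
    by (metis quotient_of_div[OF mn] of_rat_divide of_rat_of_int_eq)
  have q1: "absval (of_rat q :: 'a) \<le> 1"
    using absval_diff_le[of x 1 "x - of_rat q"] q rad_le_1[of N] assms by (auto simp: Zp_iff)
  have "\<not> int p dvd n"
  proof
    assume pn: "int p dvd n"
    then have n_lt: "absval (of_int n :: 'a) \<le> rad 1"
      by (subst absval_of_int_le_rad_iff) simp
    have "\<not> int p dvd m" using pn n(2) prime_p
      by (metis coprime_common_divisor_int abs_of_nat of_nat_1_eq_iff not_prime_1)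
    then have "\<not> p dvd nat \<bar>m\<bar>" by (simp add: dvd_nat_abs_iff)
    then have "absval (of_nat (nat \<bar>m\<bar>) :: 'a) = 1" by (rule absval_of_nat_eq_1)
    then have m1: "absval (of_int m :: 'a) = 1"
      by (cases "m \<ge> 0") (auto simp: absval_minus_commute)
    have "rad 1 < 1" using p_gt_2 by (simp add: rad_def)
    moreover have "absval (of_int n :: 'a) > 0"
      using n(1) absval_nonneg[of "of_int n"] absval_eq_0_iff[of "of_int n"] by simp
    ultimately have "1 / absval (of_int n :: 'a) > 1" using n_lt by (simp add: field_simps)
    then show False using q1 m1 by (simp add: q_eq absval_divide)
  qed
  then have "\<not> p dvd nat \<bar>n\<bar>" by (simp add: dvd_nat_abs_iff)
  then have "absval (of_nat (nat \<bar>n\<bar>) :: 'a) = 1" by (rule absval_of_nat_eq_1)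
  then have n1: "absval (of_int n :: 'a) = 1" using n(1) by simp
  have "coprime n (int p ^ N)"
    using \<open>\<not> int p dvd n\<close> prime_p by (metis coprime_commute coprime_power_right_iff prime_imp_coprime prime_int_nat_transfer prime_nat_int_transfer)
  then obtain n' where n': "[n * n' = 1] (mod int p ^ N)" using cong_solve_coprime_int by blast
  then have d1: "absval (of_int (n * n' - 1) :: 'a) \<le> rad N"
    by (subst absval_of_int_le_rad_iff) (simp add: cong_iff_dvd_diff)
  define b where "b = (m * n') mod (int p ^ N)"
  have b: "b \<ge> 0" "b < int p ^ N" using p_gt_2 by (auto simp: b_def)
  have d2: "absval (of_int (m * n' - b) :: 'a) \<le> rad N"
    by (subst absval_of_int_le_rad_iff) (simp add: b_def minus_mod_eq_mult_div)
  have "of_int m / of_int n - of_int (m * n') = - (of_int m * of_int (n * n' - 1) / of_int n :: 'a)"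
    using n(1) by (simp add: field_simps)
  then have "absval (of_int m / of_int n - of_int (m * n') :: 'a) \<le> rad N"
    using absval_mult_le_left[OF absval_of_int_le_1 d1, of m]
    by (simp only: absval_minus absval_divide n1 div_by_1)
  then have "absval (of_rat q - of_int b :: 'a) \<le> rad N"
    using absval_triangle_le[OF _ d2[unfolded of_int_diff]] by (simp add: q_eq)
  then have "absval (x - of_int b) \<le> rad N"
    using absval_triangle_le[of x "of_rat q" "rad N" "of_int b"] q by simp
  moreover have "of_int b = (of_nat (nat b) :: 'a)" using b by simp
  moreover have "nat b < p ^ N" using b by (simp add: nat_less_iff)
  ultimately show ?thesis by metis
qed

definition residue :: "nat \<Rightarrow> 'a \<Rightarrow> nat" where
  "residue N x = (SOME a. a < p ^ N \<and> absval (x - of_nat a) \<le> rad N)"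

lemma residue_less: "x \<in> Zp \<Longrightarrow> residue N x < p ^ N"
  and absval_residue_le: "x \<in> Zp \<Longrightarrow> absval (x - of_nat (residue N x)) \<le> rad N"
  using someI_ex[OF Zp_approx_of_nat[of x N]] unfolding residue_def by auto

text \<open>The value group of the p-adic numbers has a gap between 1/p and 1. In a ramified
  extension this fails, hence the restriction to \<open>Zp\<close>.\<close>

lemma absval_le_rad_1_or_eq_1:
  assumes "x \<in> (Zp :: 'a set)"
  shows "absval x \<le> rad 1 \<or> absval x = 1"
proof (cases "p dvd residue 1 x")
  case True
  then have "absval (of_nat (residue 1 x) :: 'a) \<le> rad 1" by (subst absval_of_nat_le_rad_iff) simp
  then show ?thesis using absval_residue_le[OF assms, of 1] absval_add_le[of "x - of_nat (residue 1 x)" "rad 1"] by fastforce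
next
  case False
  have "rad 1 < 1" using p_gt_2 by (simp add: rad_def)
  then have "absval (of_nat (residue 1 x) - x) < absval (of_nat (residue 1 x) :: 'a)"
    using absval_residue_le[OF assms, of 1] absval_of_nat_eq_1[OF False] absval_minus_commute[of x] by simp
  then show ?thesis using absval_eq_of_close absval_of_nat_eq_1[OF False] by metis
qed

abbreviation units :: "'a set" where
  "units \<equiv> carrier Zp_units"

lemma units_iff: "x \<in> units \<longleftrightarrow> x \<in> Qp \<and> absval x = 1"
proof
  assume "x \<in> units"
  then obtain y where "x \<in> Zp" "y \<in> Zp" "x * y = 1" by (auto simp: Zp_units_def)
  then have "x \<in> Qp" "absval x \<le> 1" "absval y \<le> 1" "absval x * absval y = 1"
    by (auto simp: Zp_iff simp flip: absval_mult)
  moreover from this have "absval x * absval y \<le> absval x * 1"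
    using absval_nonneg by (intro mult_left_mono) auto
  ultimately show "x \<in> Qp \<and> absval x = 1" by simp
next
  assume x: "x \<in> Qp \<and> absval x = 1"
  then have "inverse x \<in> Zp" "x * inverse x = 1" by (auto simp: Zp_iff Qp_inverse absval_inverse simp flip: absval_eq_0_iff intro!: right_inverse)
  then show "x \<in> units" using x by (auto simp: Zp_units_def Zp_iff)
qed

lemma units_in_Zp: "x \<in> units \<Longrightarrow> x \<in> Zp"
  by (simp add: units_iff Zp_iff)

lemma absval_unit: "x \<in> units \<Longrightarrow> absval x = 1"
  by (simp add: units_iff)

lemma units_mult: "\<lbrakk>x \<in> units; y \<in> units\<rbrakk> \<Longrightarrow> x * y \<in> units"
  by (simp add: units_iff Qp_mult absval_mult)

lemma units_inverse: "x \<in> units \<Longrightarrow> inverse x \<in> units"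
  by (simp add: units_iff Qp_inverse absval_inverse)

lemma one_in_units [simp]: "1 \<in> units"
  by (simp add: units_iff)

lemma of_nat_in_units_iff: "of_nat n \<in> units \<longleftrightarrow> \<not> p dvd n"
proof -
  have "absval (of_nat n :: 'a) < 1" if "p dvd n"
  proof -
    have "absval (of_nat n :: 'a) \<le> rad 1" using that by (subst absval_of_nat_le_rad_iff) simp
    also have "\<dots> < 1" using p_gt_2 by (simp add: rad_def)
    finally show ?thesis .
  qed
  then show ?thesis by (auto simp: units_iff absval_of_nat_eq_1)
qed

lemma unit_of_close:
  assumes "x \<in> units" "absval (x - of_nat a) \<le> rad N" "N > 0"
  shows "\<not> p dvd a"
proof -
  have "absval (x - of_nat a) \<le> rad 1"
    using assms(2,3) rad_le_rad_iff[of N 1] by simp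
  also have "rad 1 < absval x" using p_gt_2 assms(1) by (simp add: rad_def absval_unit)
  finally have "absval (of_nat a :: 'a) = 1" using absval_eq_of_close assms(1) absval_unit by metis
  then show ?thesis using of_nat_in_units_iff[of a] by (simp add: units_iff)
qed

text \<open>Absolute value 1 is a closed condition in the complete \<open>Qp\<close>, and the
  naturals below p^N form a net of radius p^-N.\<close>

lemma compact_units: "compact units"
  unfolding compact_eq_totally_bounded
proof
  show "complete units" unfolding complete_def
  proof (intro allI impI)
    fix f :: "nat \<Rightarrow> 'a" assume f: "(\<forall>n. f n \<in> units) \<and> Cauchy f"
    then obtain l where l: "l \<in> Qp" "f \<longlonglongrightarrow> l"
      using complete_Qp unfolding complete_def by (meson units_iff)
    have "(\<lambda>n. dist (f n) 0) \<longlonglongrightarrow> dist l 0" by (intro tendsto_dist l(2) tendsto_const)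
    moreover have "dist (f n) 0 = 1" for n using f by (simp add: dist_absval absval_unit)
    ultimately have "absval l = 1" by (simp add: absval_def LIMSEQ_const_iff)
    then show "\<exists>l\<in>units. f \<longlonglongrightarrow> l" using l by (auto simp: units_iff)
  qed
  show "\<forall>e>0. \<exists>k. finite k \<and> units \<subseteq> (\<Union>x\<in>k. ball x e)"
  proof (intro allI impI)
    fix e :: real assume "e > 0"
    then obtain N where N: "rad N < e" using ex_rad_less by blast
    have "units \<subseteq> (\<Union>x\<in>of_nat ` {..<p ^ N}. ball x e)"
    proof
      fix x assume "x \<in> units"
      then obtain a where "a < p ^ N" "absval (x - of_nat a) \<le> rad N"
        using Zp_approx_of_nat units_in_Zp by blast
      then show "x \<in> (\<Union>x\<in>of_nat ` {..<p ^ N}. ball x e)"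
        using N absval_minus_commute[of x] by (force simp: dist_absval)
    qed
    then show "\<exists>k. finite k \<and> units \<subseteq> (\<Union>x\<in>k. ball x e)" by blast
  qed
qed

section \<open>Measures on the p-adic units\<close>

definition ucont :: "('a \<Rightarrow> 'a) \<Rightarrow> bool" where
  "ucont f \<longleftrightarrow> (\<forall>n. \<exists>m. \<forall>x\<in>units. \<forall>y\<in>units.
    absval (x - y) \<le> rad m \<longrightarrow> absval (f x - f y) \<le> rad n)"

text \<open>A counterpart of \<open>continuous_functions\<close> for total functions: only values on
  the units matter, so plain lambda terms can be handled without \<open>restrict\<close>;
  \<open>cfuns_iff\<close> makes the link.\<close>

definition integrand :: "('a \<Rightarrow> 'a) \<Rightarrow> bool" where
  "integrand f \<longleftrightarrow> (\<forall>x\<in>units. absval (f x) \<le> 1) \<and> ucont f"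

lemma ucontD:
  assumes "ucont f"
  obtains m where "\<And>x y. \<lbrakk>x \<in> units; y \<in> units; absval (x - y) \<le> rad m\<rbrakk> \<Longrightarrow> absval (f x - f y) \<le> rad n"
  using assms unfolding ucont_def by blast

lemma ucont_cong: "(\<And>x. x \<in> units \<Longrightarrow> f x = g x) \<Longrightarrow> ucont f \<longleftrightarrow> ucont g"
  by (simp add: ucont_def cong: ball_cong)

lemma integrand_cong: "(\<And>x. x \<in> units \<Longrightarrow> f x = g x) \<Longrightarrow> integrand f \<longleftrightarrow> integrand g"
  using ucont_cong[of f g] by (simp add: integrand_def cong: ball_cong)

lemma integrand_restrict [simp]: "integrand (restrict f units) \<longleftrightarrow> integrand f"
  by (rule integrand_cong) simp

lemma rad_Suc_less: "rad (Suc n) < rad n"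
  unfolding rad_def by (rule power_strict_decreasing) (use p_gt_2 in auto)

text \<open>Compactness of the units upgrades continuity to uniform continuity, with the exponents
  of p in place of epsilon and delta.\<close>

lemma ucont_iff_continuous_on: "ucont f \<longleftrightarrow> continuous_on units f"
proof
  assume f: "ucont f"
  show "continuous_on units f" unfolding continuous_on_iff
  proof (intro ballI allI impI)
    fix x e assume x: "x \<in> units" and "(0::real) < e"
    then obtain n where n: "rad n < e" using ex_rad_less by blast
    obtain m where m: "\<And>x y. \<lbrakk>x \<in> units; y \<in> units; absval (x - y) \<le> rad m\<rbrakk> \<Longrightarrow> absval (f x - f y) \<le> rad n"
      using ucontD[OF f] by metis
    have "dist (f x') (f x) < e" if "x' \<in> units" "dist x' x < rad m" for x'
    proof -
      have "absval (f x' - f x) \<le> rad n"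
        using m[OF that(1) x] that(2) by (simp add: dist_absval)
      then show ?thesis using n by (simp add: dist_absval)
    qed
    then show "\<exists>d>0. \<forall>x'\<in>units. dist x' x < d \<longrightarrow> dist (f x') (f x) < e"
      using rad_pos by blast
  qed
next
  assume "continuous_on units f"
  then have uc: "uniformly_continuous_on units f"
    using compact_units by (rule compact_uniformly_continuous)
  show "ucont f" unfolding ucont_def
  proof
    fix n
    obtain d where d: "d > 0"
      "\<And>x x'. x \<in> units \<Longrightarrow> x' \<in> units \<Longrightarrow> dist x' x < d \<Longrightarrow> dist (f x') (f x) < rad n"
      using uc rad_pos[of n] unfolding uniformly_continuous_on_def by metis
    obtain m where m: "rad m < d" using ex_rad_less[OF d(1)] by blast
    have "absval (f x - f y) \<le> rad n" if "x \<in> units" "y \<in> units" "absval (x - y) \<le> rad m" for x y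
      using d(2)[OF that(2,1)] that(3) m by (simp add: dist_absval)
    then show "\<exists>m. \<forall>x\<in>units. \<forall>y\<in>units. absval (x - y) \<le> rad m \<longrightarrow> absval (f x - f y) \<le> rad n"
      by blast
  qed
qed

abbreviation cfuns :: "('a \<Rightarrow> 'a) set" where
  "cfuns \<equiv> continuous_functions Zp_units"

abbreviation measures :: "(('a \<Rightarrow> 'a) \<Rightarrow> 'a) set" where
  "measures \<equiv> measures_on Zp_units"

lemma cfuns_iff: "\<phi> \<in> cfuns \<longleftrightarrow> \<phi> \<in> extensional units \<and> integrand \<phi>"
  unfolding continuous_functions_def integrand_def ucont_iff_continuous_on
  by (auto simp: PiE_iff ring_of_integers_def)

lemma restrict_in_cfuns: "integrand f \<Longrightarrow> restrict f units \<in> cfuns"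
  by (simp add: cfuns_iff)

lemma integrandD: "integrand f \<Longrightarrow> x \<in> units \<Longrightarrow> absval (f x) \<le> 1"
  by (simp add: integrand_def)

lemma ucont_lipschitz:
  "(\<And>x y. \<lbrakk>x \<in> units; y \<in> units\<rbrakk> \<Longrightarrow> absval (f x - f y) \<le> absval (x - y)) \<Longrightarrow> ucont f"
  unfolding ucont_def using order_trans by blast

lemma ucont_add:
  assumes "ucont f" "ucont g"
  shows "ucont (\<lambda>x. f x + g x)"
  unfolding ucont_def
proof
  fix n
  obtain m1 where m1: "\<And>x y. \<lbrakk>x \<in> units; y \<in> units; absval (x - y) \<le> rad m1\<rbrakk> \<Longrightarrow> absval (f x - f y) \<le> rad n"
    using ucontD[OF assms(1)] by metis
  obtain m2 where m2: "\<And>x y. \<lbrakk>x \<in> units; y \<in> units; absval (x - y) \<le> rad m2\<rbrakk> \<Longrightarrow> absval (g x - g y) \<le> rad n"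
    using ucontD[OF assms(2)] by metis
  have "absval ((f x + g x) - (f y + g y)) \<le> rad n"
    if xy: "x \<in> units" "y \<in> units" "absval (x - y) \<le> rad (max m1 m2)" for x y
  proof -
    have "rad (max m1 m2) \<le> rad m1" "rad (max m1 m2) \<le> rad m2" by (simp_all add: rad_le_rad_iff)
    then have "absval ((f x - f y) + (g x - g y)) \<le> rad n"
      using m1[OF xy(1,2)] m2[OF xy(1,2)] xy(3) by (intro absval_add_le) auto
    then show ?thesis by (simp add: algebra_simps)
  qed
  then show "\<exists>m. \<forall>x\<in>units. \<forall>y\<in>units. absval (x - y) \<le> rad m \<longrightarrow> absval ((f x + g x) - (f y + g y)) \<le> rad n"
    by blast
qed

text \<open>Clears denominators: a power of p makes any scalar integral.\<close>

lemma ex_absval_mult_rad_le: "\<exists>k. absval (c::'a) * rad k \<le> 1"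
proof -
  have "1 / (absval c + 1) > 0" using absval_nonneg[of c] by simp
  then obtain k where k: "rad k < 1 / (absval c + 1)" using ex_rad_less by blast
  have "absval c * rad k \<le> (absval c + 1) * rad k"
    using rad_pos[of k] by (intro mult_right_mono) auto
  also have "\<dots> \<le> 1" using k absval_nonneg[of c] by (simp add: field_simps)
  finally show ?thesis ..
qed

lemma ucont_cmult:
  assumes "ucont f"
  shows "ucont (\<lambda>x. c * f x)"
  unfolding ucont_def
proof
  fix n
  obtain k where k: "absval c * rad k \<le> 1" using ex_absval_mult_rad_le by blast
  obtain m where m: "\<And>x y. \<lbrakk>x \<in> units; y \<in> units; absval (x - y) \<le> rad m\<rbrakk> \<Longrightarrow> absval (f x - f y) \<le> rad (k + n)"
    using ucontD[OF assms] by metis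
  have "absval (c * f x - c * f y) \<le> rad n"
    if xy: "x \<in> units" "y \<in> units" "absval (x - y) \<le> rad m" for x y
  proof -
    have "absval (c * f x - c * f y) = absval c * absval (f x - f y)"
      by (simp only: absval_mult[symmetric] right_diff_distrib)
    also have "\<dots> \<le> absval c * rad (k + n)" using m[OF xy] by (intro mult_left_mono absval_nonneg)
    also have "\<dots> = (absval c * rad k) * rad n" by (simp add: rad_add)
    also have "\<dots> \<le> 1 * rad n" using k rad_pos[of n] by (intro mult_right_mono) auto
    finally show ?thesis by simp
  qed
  then show "\<exists>m. \<forall>x\<in>units. \<forall>y\<in>units. absval (x - y) \<le> rad m \<longrightarrow> absval (c * f x - c * f y) \<le> rad n"
    by blast
qed

lemma ucont_minus_const: "ucont f \<Longrightarrow> ucont (\<lambda>x. - f x)"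
  using ucont_cmult[of f "-1"] by simp

lemma integrand_const: "absval c \<le> 1 \<Longrightarrow> integrand (\<lambda>_. c)"
  by (auto simp: integrand_def ucont_def less_imp_le)

lemma integrand_ident: "integrand (\<lambda>x. x)"
  unfolding integrand_def using ucont_lipschitz[of "\<lambda>x. x"] by (simp add: absval_unit)

lemma integrand_inverse: "integrand inverse"
  unfolding integrand_def
proof (intro conjI ballI ucont_lipschitz)
  fix x y assume xy: "x \<in> units" "y \<in> units"
  then have nz: "x \<noteq> 0" "y \<noteq> 0" using absval_unit[of x] absval_unit[of y] by auto
  have "absval (inverse x - inverse y) = absval (y - x) / (absval x * absval y)"
    by (simp only: inverse_diff_inverse_divide[OF nz] absval_divide absval_mult)
  then show "absval (inverse x - inverse y) \<le> absval (x - y)"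
    using xy by (simp add: absval_unit absval_minus_commute[of x])
qed (simp add: absval_unit absval_inverse)

lemma integrand_add: "\<lbrakk>integrand f; integrand g\<rbrakk> \<Longrightarrow> integrand (\<lambda>x. f x + g x)"
  by (auto simp: integrand_def intro: ucont_add absval_add_le)

lemma integrand_cmult: "\<lbrakk>absval c \<le> 1; integrand f\<rbrakk> \<Longrightarrow> integrand (\<lambda>x. c * f x)"
  by (auto simp: integrand_def intro: ucont_cmult absval_mult_le_left)

lemma integrand_mult:
  assumes "integrand f" "integrand g"
  shows "integrand (\<lambda>x. f x * g x)"
  unfolding integrand_def
proof (intro conjI ballI)
  show "absval (f x * g x) \<le> 1" if "x \<in> units" for x
    using assms that by (intro absval_mult_le_left) (auto simp: integrand_def)
  show "ucont (\<lambda>x. f x * g x)" unfolding ucont_def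
  proof
    fix n
    obtain m1 where m1: "\<And>x y. \<lbrakk>x \<in> units; y \<in> units; absval (x - y) \<le> rad m1\<rbrakk> \<Longrightarrow> absval (f x - f y) \<le> rad n"
      using ucontD assms(1) unfolding integrand_def by metis
    obtain m2 where m2: "\<And>x y. \<lbrakk>x \<in> units; y \<in> units; absval (x - y) \<le> rad m2\<rbrakk> \<Longrightarrow> absval (g x - g y) \<le> rad n"
      using ucontD assms(2) unfolding integrand_def by metis
    have "absval (f x * g x - f y * g y) \<le> rad n"
      if xy: "x \<in> units" "y \<in> units" "absval (x - y) \<le> rad (max m1 m2)" for x y
    proof -
      have r: "rad (max m1 m2) \<le> rad m1" "rad (max m1 m2) \<le> rad m2" by (simp_all add: rad_le_rad_iff)
      have "absval (g x * (f x - f y) + f y * (g x - g y)) \<le> rad n"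
        using m1[OF xy(1,2)] m2[OF xy(1,2)] xy r assms
        by (intro absval_add_le absval_mult_le_left) (auto dest: integrandD)
      then show ?thesis by (simp add: algebra_simps)
    qed
    then show "\<exists>m. \<forall>x\<in>units. \<forall>y\<in>units. absval (x - y) \<le> rad m \<longrightarrow> absval (f x * g x - f y * g y) \<le> rad n"
      by blast
  qed
qed

lemma integrand_power: "integrand f \<Longrightarrow> integrand (\<lambda>x. f x ^ k)"
  by (induction k) (auto intro: integrand_mult integrand_const)

lemma integrand_monomial: "integrand (\<lambda>x. x ^ k)"
  by (rule integrand_power[OF integrand_ident])

lemma integrand_scale_arg:
  assumes "integrand f" "u \<in> units"
  shows "integrand (\<lambda>y. f (u * y))"
  unfolding integrand_def
proof (intro conjI ballI)
  show "absval (f (u * y)) \<le> 1" if "y \<in> units" for y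
    using assms units_mult that by (simp add: integrand_def)
  show "ucont (\<lambda>y. f (u * y))" unfolding ucont_def
  proof
    fix n
    obtain m where m: "\<And>x y. \<lbrakk>x \<in> units; y \<in> units; absval (x - y) \<le> rad m\<rbrakk> \<Longrightarrow> absval (f x - f y) \<le> rad n"
      using ucontD assms(1) unfolding integrand_def by metis
    have "absval (f (u * x) - f (u * y)) \<le> rad n" if "x \<in> units" "y \<in> units" "absval (x - y) \<le> rad m" for x y
    proof -
      have "absval (u * x - u * y) = absval u * absval (x - y)"
        by (simp only: absval_mult[symmetric] right_diff_distrib)
      then show ?thesis using that assms(2) by (intro m) (auto simp: units_mult absval_unit)
    qed
    then show "\<exists>m. \<forall>x\<in>units. \<forall>y\<in>units. absval (x - y) \<le> rad m \<longrightarrow> absval (f (u * x) - f (u * y)) \<le> rad n"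
      by blast
  qed
qed

section \<open>Integration against a measure\<close>

abbreviation integ :: "(('a \<Rightarrow> 'a) \<Rightarrow> 'a) \<Rightarrow> ('a \<Rightarrow> 'a) \<Rightarrow> 'a" where
  "integ \<equiv> measure_integral Zp_units"

lemma integ_cong: "(\<And>x. x \<in> units \<Longrightarrow> f x = g x) \<Longrightarrow> integ \<mu> f = integ \<mu> g"
  by (simp add: measure_integral_def cong: restrict_cong)

lemma integ_add:
  assumes "\<mu> \<in> measures" "integrand f" "integrand g"
  shows "integ \<mu> (\<lambda>x. f x + g x) = integ \<mu> f + integ \<mu> g"
proof -
  have "\<mu> (\<lambda>x\<in>units. restrict f units x + restrict g units x) = \<mu> (restrict f units) + \<mu> (restrict g units)"
    using assms restrict_in_cfuns[of f] restrict_in_cfuns[of g] unfolding measures_on_def by blast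
  then show ?thesis by (simp add: measure_integral_def cong: restrict_cong)
qed

lemma integ_cmult:
  assumes "\<mu> \<in> measures" "integrand f" "absval c \<le> 1"
  shows "integ \<mu> (\<lambda>x. c * f x) = c * integ \<mu> f"
proof -
  have "c \<in> ring_of_integers" using assms(3) by (simp add: ring_of_integers_def)
  then have "\<mu> (\<lambda>x\<in>units. c * restrict f units x) = c * \<mu> (restrict f units)"
    using assms(1) restrict_in_cfuns[OF assms(2)] unfolding measures_on_def by blast
  then show ?thesis by (simp add: measure_integral_def cong: restrict_cong)
qed

lemma absval_integ_le_1: "\<lbrakk>\<mu> \<in> measures; integrand f\<rbrakk> \<Longrightarrow> absval (integ \<mu> f) \<le> 1"
  using restrict_in_cfuns[of f]
  by (auto simp: measures_on_def measure_integral_def ring_of_integers_def PiE_iff)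

lemma integ_0: "\<mu> \<in> measures \<Longrightarrow> integ \<mu> (\<lambda>_. 0) = 0"
  using integ_cmult[of \<mu> "\<lambda>_. 0" 0] by (simp add: integrand_const)

text \<open>The difference f - g is p^n times an integrand, and the integral of that integrand is
  integral.\<close>

lemma absval_integ_diff_le:
  assumes \<mu>: "\<mu> \<in> measures" and f: "integrand f" and g: "integrand g"
    and close: "\<And>x. x \<in> units \<Longrightarrow> absval (f x - g x) \<le> rad n"
  shows "absval (integ \<mu> f - integ \<mu> g) \<le> rad n"
proof -
  let ?h = "\<lambda>x. (1 / of_nat p ^ n) * (f x + - g x)"
  have pn: "of_nat p ^ n \<noteq> (0::'a)" using p_gt_2 by simp
  have h: "integrand ?h" unfolding integrand_def
  proof (intro conjI ballI)
    show "ucont ?h"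
      using f g by (intro ucont_cmult ucont_add ucont_minus_const) (auto simp: integrand_def)
    show "absval (?h x) \<le> 1" if "x \<in> units" for x
    proof -
      have "absval (?h x) = absval (f x - g x) / rad n"
        by (simp only: absval_mult absval_divide absval_p_power absval_1) simp
      then show ?thesis using close[OF that] by simp
    qed
  qed
  have "integ \<mu> f = integ \<mu> (\<lambda>x. of_nat p ^ n * ?h x + g x)"
    using pn by (intro integ_cong) simp
  also have "\<dots> = of_nat p ^ n * integ \<mu> ?h + integ \<mu> g"
    using \<mu> h g rad_le_1[of n] by (subst integ_add) (auto intro!: integrand_cmult integ_cmult simp: absval_p_power simp del: times_divide_eq_left)
  finally have "absval (integ \<mu> f - integ \<mu> g) = rad n * absval (integ \<mu> ?h)"
    by (simp only: add_diff_cancel_right' absval_mult absval_p_power)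
  also have "\<dots> \<le> rad n * 1"
    using rad_pos[of n] absval_integ_le_1[OF \<mu> h] by (intro mult_left_mono) auto
  finally show ?thesis by simp
qed

text \<open>Lets a measure be given by a formula on total integrands; \<open>lip\<close> supplies
  the continuity clause.\<close>

lemma measureI:
  assumes add: "\<And>f g. \<lbrakk>integrand f; integrand g\<rbrakk> \<Longrightarrow> F (restrict (\<lambda>x. f x + g x) units) = F (restrict f units) + F (restrict g units)"
    and cmult: "\<And>c f. \<lbrakk>absval c \<le> 1; integrand f\<rbrakk> \<Longrightarrow> F (restrict (\<lambda>x. c * f x) units) = c * F (restrict f units)"
    and bound: "\<And>f. integrand f \<Longrightarrow> absval (F (restrict f units)) \<le> 1"
    and lip: "\<And>f g n. \<lbrakk>integrand f; integrand g; \<And>x. x \<in> units \<Longrightarrow> absval (f x - g x) \<le> rad n\<rbrakk>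
        \<Longrightarrow> absval (F (restrict f units) - F (restrict g units)) \<le> rad n"
  shows "restrict F cfuns \<in> measures"
proof -
  have c: "restrict \<phi> units = \<phi>" "integrand \<phi>" if "\<phi> \<in> cfuns" for \<phi>
    using that by (auto simp: cfuns_iff extensional_restrict)
  show ?thesis
    unfolding measures_on_def
  proof (intro CollectI conjI ballI allI impI)
    show "restrict F cfuns \<in> cfuns \<rightarrow>\<^sub>E ring_of_integers"
      using bound c by (fastforce simp: ring_of_integers_def)
    show "restrict F cfuns (\<lambda>x\<in>units. \<phi> x + \<psi> x) = restrict F cfuns \<phi> + restrict F cfuns \<psi>"
      if "\<phi> \<in> cfuns" "\<psi> \<in> cfuns" for \<phi> \<psi>
      using that add[of \<phi> \<psi>] c by (simp add: restrict_in_cfuns integrand_add)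
    show "restrict F cfuns (\<lambda>x\<in>units. a * \<phi> x) = a * restrict F cfuns \<phi>"
      if "a \<in> ring_of_integers" "\<phi> \<in> cfuns" for a \<phi>
      using that cmult[of a \<phi>] c by (simp add: restrict_in_cfuns integrand_cmult ring_of_integers_def)
    fix \<phi> \<epsilon> assume \<phi>: "\<phi> \<in> cfuns" and "(0::real) < \<epsilon>"
    then obtain n where n: "rad n < \<epsilon>" using ex_rad_less by blast
    have "dist (restrict F cfuns \<psi>) (restrict F cfuns \<phi>) < \<epsilon>"
      if "\<psi> \<in> cfuns" "\<forall>x\<in>units. dist (\<psi> x) (\<phi> x) < rad n" for \<psi>
      using lip[of \<psi> \<phi> n] that \<phi> c n by (auto simp: dist_absval intro: less_imp_le le_less_trans)
    then show "\<exists>\<delta>>0. \<forall>\<psi>\<in>cfuns. (\<forall>x\<in>units. dist (\<psi> x) (\<phi> x) < \<delta>) \<longrightarrow>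
         dist (restrict F cfuns \<psi>) (restrict F cfuns \<phi>) < \<epsilon>"
      using rad_pos by blast
  qed
qed

section \<open>Measures are determined by their moments\<close>

text \<open>The condition at 0 keeps the moment of order 0 out of later comparisons. The
  coefficients need not be integral.\<close>

definition poly_approximable :: "('a \<Rightarrow> 'a) \<Rightarrow> bool" where
  "poly_approximable f \<longleftrightarrow>
    (\<forall>n. \<exists>P. poly P 0 = 0 \<and> (\<forall>x\<in>units. absval (f x - poly P x) \<le> rad n))"

lemma poly_approximableD:
  assumes "poly_approximable f"
  obtains P where "poly P 0 = 0" "\<And>x. x \<in> units \<Longrightarrow> absval (f x - poly P x) \<le> rad n"
  using assms unfolding poly_approximable_def by blast

lemma poly_approximable_ident: "poly_approximable (\<lambda>x. x)"
  unfolding poly_approximable_def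
  by (intro allI exI[of _ "[:0, 1:]"]) (simp add: less_imp_le)

lemma poly_approximable_add:
  assumes "poly_approximable f" "poly_approximable g"
  shows "poly_approximable (\<lambda>x. f x + g x)"
  unfolding poly_approximable_def
proof
  fix n
  obtain P where P: "poly P 0 = 0" "\<And>x. x \<in> units \<Longrightarrow> absval (f x - poly P x) \<le> rad n"
    using poly_approximableD[OF assms(1)] by metis
  obtain Q where Q: "poly Q 0 = 0" "\<And>x. x \<in> units \<Longrightarrow> absval (g x - poly Q x) \<le> rad n"
    using poly_approximableD[OF assms(2)] by metis
  have "absval (f x + g x - poly (P + Q) x) \<le> rad n" if "x \<in> units" for x
    using absval_add_le[OF P(2)[OF that] Q(2)[OF that]] by (simp add: algebra_simps)
  then show "\<exists>P. poly P 0 = 0 \<and> (\<forall>x\<in>units. absval (f x + g x - poly P x) \<le> rad n)"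
    using P(1) Q(1) by (intro exI[of _ "P + Q"]) auto
qed

lemma poly_approximable_cmult:
  assumes "poly_approximable f"
  shows "poly_approximable (\<lambda>x. c * f x)"
  unfolding poly_approximable_def
proof
  fix n
  obtain k where k: "absval c * rad k \<le> 1" using ex_absval_mult_rad_le by blast
  obtain P where P: "poly P 0 = 0" "\<And>x. x \<in> units \<Longrightarrow> absval (f x - poly P x) \<le> rad (k + n)"
    using poly_approximableD[OF assms] by metis
  have "absval (c * f x - poly (Polynomial.smult c P) x) \<le> rad n" if "x \<in> units" for x
  proof -
    have "absval (c * f x - poly (Polynomial.smult c P) x) = absval c * absval (f x - poly P x)"
      by (simp only: poly_smult absval_mult[symmetric] right_diff_distrib)
    also have "\<dots> \<le> absval c * rad (k + n)" by (intro mult_left_mono absval_nonneg P that)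
    also have "\<dots> = (absval c * rad k) * rad n" by (simp add: rad_add)
    also have "\<dots> \<le> 1 * rad n" using k by (intro mult_right_mono) auto
    finally show ?thesis by simp
  qed
  then show "\<exists>P. poly P 0 = 0 \<and> (\<forall>x\<in>units. absval (c * f x - poly P x) \<le> rad n)"
    using P(1) by (intro exI[of _ "Polynomial.smult c P"]) auto
qed

lemma poly_approximable_mult:
  assumes "poly_approximable f" "poly_approximable g"
    "\<And>x. x \<in> units \<Longrightarrow> absval (f x) \<le> 1" "\<And>x. x \<in> units \<Longrightarrow> absval (g x) \<le> 1"
  shows "poly_approximable (\<lambda>x. f x * g x)"
  unfolding poly_approximable_def
proof
  fix n
  obtain P where P: "poly P 0 = 0" "\<And>x. x \<in> units \<Longrightarrow> absval (f x - poly P x) \<le> rad n"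
    using poly_approximableD[OF assms(1)] by metis
  obtain Q where Q: "poly Q 0 = 0" "\<And>x. x \<in> units \<Longrightarrow> absval (g x - poly Q x) \<le> rad n"
    using poly_approximableD[OF assms(2)] by metis
  have "absval (f x * g x - poly (P * Q) x) \<le> rad n" if x: "x \<in> units" for x
  proof -
    \<comment> \<open>P is integral on the units because it stays within p^-n of f there.\<close>
    have "absval (poly P x) \<le> 1"
      using absval_diff_le[of "f x" 1 "f x - poly P x"] P(2)[OF x] assms(3)[OF x] rad_le_1[of n] by simp
    then have "absval (g x * (f x - poly P x) + poly P x * (g x - poly Q x)) \<le> rad n"
      using P(2)[OF x] Q(2)[OF x] assms(4)[OF x] by (intro absval_add_le absval_mult_le_left) auto
    then show ?thesis by (simp add: algebra_simps)
  qed
  then show "\<exists>P. poly P 0 = 0 \<and> (\<forall>x\<in>units. absval (f x * g x - poly P x) \<le> rad n)"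
    using P(1) by (intro exI[of _ "P * Q"]) auto
qed

lemma poly_approximable_power:
  assumes "poly_approximable f" "\<And>x. x \<in> units \<Longrightarrow> absval (f x) \<le> 1" "k > 0"
  shows "poly_approximable (\<lambda>x. f x ^ k)"
  using assms(3)
proof (induction k rule: nat_induct_non_zero)
  case (Suc k)
  then show ?case
    using poly_approximable_mult[OF assms(1) Suc.IH] assms(2) absval_power_le_1 by simp
qed (use assms in simp)

lemma poly_approximable_limit:
  assumes "\<And>n. \<exists>g. poly_approximable g \<and> (\<forall>x\<in>units. absval (f x - g x) \<le> rad n)"
  shows "poly_approximable f"
  unfolding poly_approximable_def
proof
  fix n
  obtain g where g: "poly_approximable g" "\<forall>x\<in>units. absval (f x - g x) \<le> rad n"
    using assms by blast
  obtain P where P: "poly P 0 = 0" "\<And>x. x \<in> units \<Longrightarrow> absval (g x - poly P x) \<le> rad n"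
    using poly_approximableD[OF g(1)] by metis
  show "\<exists>P. poly P 0 = 0 \<and> (\<forall>x\<in>units. absval (f x - poly P x) \<le> rad n)"
    using P g(2) absval_triangle_le by blast
qed

lemma absval_power_diff_le:
  assumes "absval (x::'a) \<le> 1" "absval y \<le> 1"
  shows "absval (x ^ k - y ^ k) \<le> absval (x - y)"
proof (induction k)
  case (Suc k)
  have "x ^ Suc k - y ^ Suc k = x * (x ^ k - y ^ k) + y ^ k * (x - y)" by (simp add: algebra_simps)
  moreover have "absval (x * (x ^ k - y ^ k) + y ^ k * (x - y)) \<le> absval (x - y)"
    using assms Suc by (intro absval_add_le absval_mult_le_left absval_power_le_1) auto
  ultimately show ?case by (simp only:)
qed (simp add: absval_nonneg)

text \<open>Euler's theorem for a natural number congruent to x, transported by the contraction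
  property of powers.\<close>

lemma absval_unit_power_totient:
  assumes "x \<in> units"
  shows "absval (x ^ totient (p ^ N) - 1) \<le> rad N"
proof (cases "N = 0")
  case False
  obtain a where a: "a < p ^ N" "absval (x - of_nat a) \<le> rad N"
    using Zp_approx_of_nat[OF units_in_Zp[OF assms]] by blast
  have "\<not> p dvd a" using unit_of_close[OF assms a(2)] False by simp
  then have "coprime a (p ^ N)"
    using prime_imp_coprime[OF prime_p, of a] by (simp add: coprime_commute)
  then have "[a ^ totient (p ^ N) = 1] (mod p ^ N)" by (rule euler_theorem)
  then have "absval (of_nat (a ^ totient (p ^ N)) - of_nat 1 :: 'a) \<le> rad N"
    by (subst absval_of_nat_diff_le_rad_iff)
  moreover have "absval (x ^ totient (p ^ N) - of_nat a ^ totient (p ^ N)) \<le> rad N"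
    using absval_power_diff_le[of x "of_nat a" "totient (p ^ N)"] a(2) assms
    by (simp add: absval_unit absval_of_nat_le_1)
  ultimately show ?thesis
    using absval_triangle_le[of "x ^ totient (p ^ N)" "of_nat a ^ totient (p ^ N)" "rad N" 1] by simp
qed (use absval_diff_le[of "x ^ totient 1" 1 1] assms in \<open>simp add: absval_unit absval_power\<close>)

text \<open>A crude bound, enough to make x^m at most p^-N for |x| <= 1/p and m the totient of
  p^N.\<close>

lemma totient_prime_power_ge: "N \<le> totient (p ^ N)"
proof (cases N)
  case (Suc k)
  have "totient (p ^ N) = p ^ k * (p - 1)"
    using totient_prime_power_Suc[OF prime_p, of k] by (simp add: Suc)
  moreover have "Suc k \<le> p ^ k"
  proof (induction k)
    case (Suc k)
    have "Suc (Suc k) \<le> 2 * Suc k" by simp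
    also have "\<dots> \<le> p * p ^ k" using p_gt_2 Suc by (intro mult_le_mono) auto
    finally show ?case by simp
  qed simp
  moreover have "p ^ k * 1 \<le> p ^ k * (p - 1)" using p_gt_2 by (intro mult_le_mono2) auto
  ultimately have "Suc k \<le> totient (p ^ N)" by linarith
  then show ?thesis by (simp only: Suc)
qed simp

lemma absval_power_totient:
  assumes "absval (x::'a) \<le> rad 1"
  shows "absval (x ^ totient (p ^ N)) \<le> rad N"
proof -
  have "absval (x ^ totient (p ^ N)) \<le> rad 1 ^ totient (p ^ N)"
    unfolding absval_power by (intro power_mono assms absval_nonneg)
  also have "\<dots> = rad (totient (p ^ N))" by (simp add: rad_def)
  also have "\<dots> \<le> rad N" using totient_prime_power_ge by (simp add: rad_le_rad_iff)
  finally show ?thesis .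
qed

definition ball_indicator :: "nat \<Rightarrow> nat \<Rightarrow> 'a \<Rightarrow> 'a" where
  "ball_indicator a n x = (if absval (x - of_nat a) \<le> rad n then 1 else 0)"

lemma totient_pow_pos: "totient (p ^ N) > 0"
  using p_gt_2 by (simp add: totient_gt_0_iff)

text \<open>The constant 1 is the uniform limit on the units of powers of x with Euler exponents,
  and these have no constant term.\<close>

lemma poly_approximable_const: "poly_approximable (\<lambda>_. c)"
proof -
  have "poly_approximable (\<lambda>_. 1)"
  proof (rule poly_approximable_limit)
    fix n
    have "poly_approximable (\<lambda>x. x ^ totient (p ^ n))"
      using absval_unit totient_pow_pos by (intro poly_approximable_power poly_approximable_ident) auto
    moreover have "absval (1 - x ^ totient (p ^ n)) \<le> rad n" if "x \<in> units" for x
      using absval_unit_power_totient[OF that] absval_minus_commute[of 1] by simp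
    ultimately show "\<exists>g. poly_approximable g \<and> (\<forall>x\<in>units. absval (1 - g x) \<le> rad n)" by blast
  qed
  then show ?thesis using poly_approximable_cmult[of "\<lambda>_. 1" c] by simp
qed

lemma poly_approximable_cong: "(\<And>x. x \<in> units \<Longrightarrow> f x = g x) \<Longrightarrow> poly_approximable f \<longleftrightarrow> poly_approximable g"
  by (simp add: poly_approximable_def cong: ball_cong)

text \<open>Since \<open>(x - a) / p\<^sup>n\<close> is integral on the ball, raising it to the Euler exponents of the
  powers of \<open>p\<close> separates the residue discs inside the ball: this refines the radius by a factor \<open>p\<close>.\<close>

lemma poly_approximable_ball_indicator: "poly_approximable (ball_indicator a n)"
proof (induction n)
  case 0
  have "poly_approximable (ball_indicator a 0) \<longleftrightarrow> poly_approximable (\<lambda>_. 1)"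
  proof (rule poly_approximable_cong)
    fix x assume "x \<in> units"
    then have "absval (x - of_nat a) \<le> 1"
      by (intro absval_diff_le absval_of_nat_le_1) (simp add: absval_unit)
    then show "ball_indicator a 0 x = 1" by (simp add: ball_indicator_def)
  qed
  then show ?case using poly_approximable_const by simp
next
  case (Suc n)
  let ?b = "ball_indicator a n"
  define f where "f = (\<lambda>x. (1 / of_nat p ^ n) * ((x + - of_nat a) * ?b x) :: 'a)"
  have b1: "absval (?b x) \<le> 1" for x by (simp add: ball_indicator_def)
  have f_abs: "absval (f x) = absval (x - of_nat a) / rad n * absval (?b x)" for x
    by (simp add: f_def absval_mult absval_divide absval_p_power)
  have f1: "absval (f x) \<le> 1" for x
    unfolding f_abs by (simp add: ball_indicator_def)
  have "absval (x + - of_nat a) \<le> 1" if "x \<in> units" for x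
    using absval_diff_le[of x 1 "of_nat a"] that by (simp add: absval_of_nat_le_1 absval_unit)
  then have "poly_approximable (\<lambda>x. (x + - of_nat a) * ?b x)"
    using b1 by (intro poly_approximable_mult poly_approximable_add poly_approximable_ident
        poly_approximable_const Suc.IH) auto
  then have f: "poly_approximable f" unfolding f_def by (rule poly_approximable_cmult)
  show ?case
  proof (rule poly_approximable_limit)
    fix N
    let ?e = "totient (p ^ N)"
    let ?g = "\<lambda>x. ?b x + (-1) * (?b x * f x ^ ?e)"
    have "poly_approximable ?g"
      using f f1 b1 totient_pow_pos
      by (intro poly_approximable_add poly_approximable_cmult poly_approximable_mult
          poly_approximable_power Suc.IH) (auto intro: absval_power_le_1)
    moreover have "absval (ball_indicator a (Suc n) x - ?g x) \<le> rad N" if x: "x \<in> units" for x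
    proof (cases "absval (x - of_nat a) \<le> rad n")
      case False
      then have "\<not> absval (x - of_nat a) \<le> rad (Suc n)" using rad_Suc_less[of n] by simp
      then show ?thesis using False by (simp add: ball_indicator_def)
    next
      case True
      then have fx: "f x = (x - of_nat a) / of_nat p ^ n" "absval (f x) = absval (x - of_nat a) / rad n"
        unfolding f_abs by (simp_all add: f_def ball_indicator_def)
      have "x \<in> Qp" using x by (simp add: units_iff)
      then have "f x \<in> Qp" unfolding fx(1) by (intro Qp_divide Qp_diff Qp_power of_nat_in_Qp)
      then have fZ: "f x \<in> Zp" using f1 by (simp add: Zp_iff)
      have iff: "absval (x - of_nat a) \<le> rad (Suc n) \<longleftrightarrow> absval (f x) \<le> rad 1"
        using rad_add[of 1 n] by (simp add: fx(2) divide_le_eq mult.commute)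
      show ?thesis
      proof (cases "absval (f x) \<le> rad 1")
        case True
        then have "ball_indicator a (Suc n) x - ?g x = f x ^ ?e"
          using \<open>absval (x - of_nat a) \<le> rad n\<close> iff by (simp add: ball_indicator_def)
        then show ?thesis using absval_power_totient[OF True] by simp
      next
        case False
        then have "f x \<in> units" using absval_le_rad_1_or_eq_1[OF fZ] fZ by (simp add: units_iff Zp_iff)
        moreover have "ball_indicator a (Suc n) x - ?g x = f x ^ ?e - 1"
          using \<open>absval (x - of_nat a) \<le> rad n\<close> iff False by (simp add: ball_indicator_def)
        ultimately show ?thesis using absval_unit_power_totient by simp
      qed
    qed
    ultimately show "\<exists>g. poly_approximable g \<and> (\<forall>x\<in>units. absval (ball_indicator a (Suc n) x - g x) \<le> rad N)"
      by blast
  qed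
qed

definition unit_residues :: "nat \<Rightarrow> nat set" where
  "unit_residues N = {a. a < p ^ N \<and> \<not> p dvd a}"

lemma finite_unit_residues [simp]: "finite (unit_residues N)"
  by (rule finite_subset[of _ "{..<p ^ N}"]) (auto simp: unit_residues_def)

lemma unit_residues_in_units: "a \<in> unit_residues N \<Longrightarrow> of_nat a \<in> units"
  by (simp add: unit_residues_def of_nat_in_units_iff)

lemma residue_in_unit_residues: "\<lbrakk>x \<in> units; N > 0\<rbrakk> \<Longrightarrow> residue N x \<in> unit_residues N"
  using residue_less[OF units_in_Zp] unit_of_close[OF _ absval_residue_le[OF units_in_Zp]]
  by (simp add: unit_residues_def)

lemma residue_unique:
  assumes "x \<in> Zp" "a < p ^ N" "absval (x - of_nat a) \<le> rad N"
  shows "residue N x = a"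
proof -
  have "absval (of_nat (residue N x) - of_nat a :: 'a) \<le> rad N"
    using absval_triangle_le[of "of_nat (residue N x)" x "rad N" "of_nat a"] assms
      absval_residue_le[OF assms(1), of N] absval_minus_commute[of x] by simp
  then have "[residue N x = a] (mod p ^ N)" by (simp add: absval_of_nat_diff_le_rad_iff)
  then show ?thesis using residue_less[OF assms(1)] assms(2) by (simp add: cong_less_modulus_unique_nat)
qed

lemma sum_eq_single:
  assumes "finite A" "a \<in> A" "\<And>b. b \<in> A \<Longrightarrow> b \<noteq> a \<Longrightarrow> f b = 0"
  shows "sum f A = (f a :: 'a)"
  using sum.mono_neutral_right[of A "{a}" f] assms by auto

text \<open>Uniform continuity makes f close to a step function that is constant on residue discs,
  and step functions are combinations of ball indicators.\<close>

lemma poly_approximable_integrand: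
  assumes "integrand f"
  shows "poly_approximable f"
proof (rule poly_approximable_limit)
  fix n
  obtain m0 where m0: "\<And>x y. \<lbrakk>x \<in> units; y \<in> units; absval (x - y) \<le> rad m0\<rbrakk> \<Longrightarrow> absval (f x - f y) \<le> rad n"
    using ucontD assms unfolding integrand_def by metis
  \<comment> \<open>The successor guarantees m > 0: at level 0 there are no unit residues.\<close>
  define m where "m = Suc m0"
  have m: "absval (f x - f y) \<le> rad n" if "x \<in> units" "y \<in> units" "absval (x - y) \<le> rad m" for x y
    using m0 that rad_Suc_less[of m0] by (simp add: m_def)
  let ?g = "\<lambda>x. \<Sum>a\<in>unit_residues m. f (of_nat a) * ball_indicator a m x"
  have "poly_approximable (\<lambda>x. \<Sum>a\<in>A. f (of_nat a) * ball_indicator a m x)" if "finite A" for A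
    using that
  proof (induction A rule: finite_induct)
    case (insert a A)
    then show ?case
      using poly_approximable_add[OF poly_approximable_cmult[OF poly_approximable_ball_indicator] insert.IH]
      by simp
  qed (simp add: poly_approximable_const)
  then have "poly_approximable ?g" by simp
  moreover have "absval (f x - ?g x) \<le> rad n" if x: "x \<in> units" for x
  proof -
    let ?r = "residue m x"
    have r: "?r \<in> unit_residues m" "absval (x - of_nat ?r) \<le> rad m"
      using x residue_in_unit_residues absval_residue_le units_in_Zp by (auto simp: m_def)
    have "f (of_nat a) * ball_indicator a m x = 0" if "a \<in> unit_residues m" "a \<noteq> ?r" for a
      using residue_unique[OF units_in_Zp[OF x], of a m] that by (auto simp: ball_indicator_def unit_residues_def)
    then have "?g x = f (of_nat ?r) * ball_indicator ?r m x"
      using r(1) by (intro sum_eq_single) auto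
    also have "\<dots> = f (of_nat ?r)" using r(2) by (simp add: ball_indicator_def)
    finally show ?thesis using m[OF x unit_residues_in_units[OF r(1)] r(2)] by simp
  qed
  ultimately show "\<exists>g. poly_approximable g \<and> (\<forall>x\<in>units. absval (f x - g x) \<le> rad n)" by blast
qed

section \<open>Uniqueness from moments\<close>

definition moment :: "(('a \<Rightarrow> 'a) \<Rightarrow> 'a) \<Rightarrow> nat \<Rightarrow> 'a" where
  "moment \<mu> k = integ \<mu> (\<lambda>x. x ^ k)"

text \<open>Integrability is part of the claim so that the induction can apply additivity of the
  integral. The coefficients are integral since measures are linear over the integers of the field
  only.\<close>

lemma integ_sum_monomials:
  assumes "\<mu> \<in> measures" "\<And>i. i \<in> A \<Longrightarrow> absval (c i) \<le> 1"
  shows "integrand (\<lambda>x. \<Sum>i\<in>A. c i * x ^ i) \<and>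
    integ \<mu> (\<lambda>x. \<Sum>i\<in>A. c i * x ^ i) = (\<Sum>i\<in>A. c i * moment \<mu> i)"
  using assms(2)
proof (induction A rule: infinite_finite_induct)
  case (insert i A)
  have 1: "integrand (\<lambda>x. c i * x ^ i)" using insert.prems by (intro integrand_cmult integrand_monomial) auto
  have 2: "integrand (\<lambda>x. \<Sum>i\<in>A. c i * x ^ i)"
    "integ \<mu> (\<lambda>x. \<Sum>i\<in>A. c i * x ^ i) = (\<Sum>i\<in>A. c i * moment \<mu> i)"
    using insert by auto
  have "integ \<mu> (\<lambda>x. c i * x ^ i + (\<Sum>i\<in>A. c i * x ^ i)) = c i * moment \<mu> i + (\<Sum>i\<in>A. c i * moment \<mu> i)"
    using insert.prems by (simp add: integ_add[OF assms(1) 1 2(1)] 2(2) moment_def integ_cmult[OF assms(1) integrand_monomial])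
  then show ?case using insert.hyps integrand_add[OF 1 2(1)] by simp
qed (use assms in \<open>auto simp: integrand_const integ_0\<close>)

text \<open>An approximating polynomial may have denominators. It is multiplied by some p^m, the two
  integrals are compared to precision m + n, and p^m is divided out again.\<close>

lemma measure_eqI_moments:
  assumes \<mu>: "\<mu> \<in> measures" and \<nu>: "\<nu> \<in> measures"
    and mom: "\<And>k. k > 0 \<Longrightarrow> moment \<mu> k = moment \<nu> k"
  shows "\<mu> = \<nu>"
proof -
  have eq: "integ \<mu> f = integ \<nu> f" if f: "integrand f" for f
  proof -
    have "absval (integ \<mu> f - integ \<nu> f) \<le> rad n" for n
    proof -
      obtain P where P: "poly P 0 = 0" "\<And>x. x \<in> units \<Longrightarrow> absval (f x - poly P x) \<le> rad n"
        using poly_approximableD[OF poly_approximable_integrand[OF f]] by metis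
      obtain K where K: "\<And>i. absval (Polynomial.coeff P i) * rad (K i) \<le> 1" 
        using choice[of "\<lambda>i k. absval (Polynomial.coeff P i) * rad k \<le> 1"] ex_absval_mult_rad_le by blast
      \<comment> \<open>The largest exponent needed to make a coefficient of P integral.\<close>
      define m where "m = Max (K ` {..degree P})"
      let ?c = "\<lambda>i. of_nat p ^ m * Polynomial.coeff P i"
      have c: "absval (?c i) \<le> 1" if "i \<in> {..degree P}" for i
      proof -
        have "K i \<le> m" using that by (simp add: m_def)
        then have "rad m * absval (Polynomial.coeff P i) \<le> rad (K i) * absval (Polynomial.coeff P i)"
          by (intro mult_right_mono absval_nonneg) (simp add: rad_le_rad_iff)
        then have "absval (?c i) \<le> absval (Polynomial.coeff P i) * rad (K i)"
          by (simp only: absval_mult absval_p_power mult.commute[of "rad (K i)"])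
        then show ?thesis using K[of i] by linarith
      qed
      let ?Q = "\<lambda>x. \<Sum>i\<le>degree P. ?c i * x ^ i"
      have Q: "?Q x = of_nat p ^ m * poly P x" for x
        by (simp add: poly_altdef sum_distrib_left mult.assoc)
      let ?f = "\<lambda>x. of_nat p ^ m * f x"
      have f': "integrand ?f" using f rad_le_1[of m] by (intro integrand_cmult) (simp_all add: absval_p_power)
      note Q\<mu> = integ_sum_monomials[OF \<mu>, of "{..degree P}" ?c, OF c]
        and Q\<nu> = integ_sum_monomials[OF \<nu>, of "{..degree P}" ?c, OF c]
      \<comment> \<open>The constant coefficient of P is 0, so the unknown moments of order 0 do not
        enter.\<close>
      have "?c i * moment \<mu> i = ?c i * moment \<nu> i" for i
        using mom[of i] P(1) by (cases "i = 0") (auto simp: poly_0_coeff_0)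
      then have "(\<Sum>i\<le>degree P. ?c i * moment \<mu> i) = (\<Sum>i\<le>degree P. ?c i * moment \<nu> i)"
        by (rule sum.cong[OF refl])
      then have Qeq: "integ \<mu> ?Q = integ \<nu> ?Q" using Q\<mu> Q\<nu> by (simp only:)
      have close: "absval (?f x - ?Q x) \<le> rad (m + n)" if "x \<in> units" for x
      proof -
        have "absval (?f x - ?Q x) = rad m * absval (f x - poly P x)"
          unfolding Q by (simp only: absval_p_power[symmetric] absval_mult[symmetric] right_diff_distrib)
        then show ?thesis using P(2)[OF that] by (simp add: rad_add mult_left_mono)
      qed
      have "absval (integ \<mu> ?f - integ \<nu> ?f) \<le> rad (m + n)"
        using absval_triangle_le[of "integ \<mu> ?f" "integ \<mu> ?Q" "rad (m + n)" "integ \<nu> ?f"]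
          absval_integ_diff_le[OF \<mu> f' _ close] absval_integ_diff_le[OF \<nu> f' _ close] Q\<mu> Q\<nu> Qeq
          absval_minus_commute[of "integ \<nu> ?f"] by simp
      moreover have "integ \<mu> ?f - integ \<nu> ?f = of_nat p ^ m * (integ \<mu> f - integ \<nu> f)"
        using rad_le_1[of m] by (simp add: integ_cmult \<mu> \<nu> f absval_p_power right_diff_distrib)
      ultimately have "rad m * absval (integ \<mu> f - integ \<nu> f) \<le> rad m * rad n"
        by (simp only: absval_mult absval_p_power rad_add)
      then show ?thesis by simp
    qed
    then have "absval (integ \<mu> f - integ \<nu> f) \<le> 0"
      using LIMSEQ_le_const[OF rad_tendsto_0] by blast
    then show ?thesis using absval_nonneg[of "integ \<mu> f - integ \<nu> f"] absval_eq_0_iff by simp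
  qed
  have "\<mu> \<in> extensional cfuns" "\<nu> \<in> extensional cfuns"
    using \<mu> \<nu> by (auto simp: measures_on_def PiE_def)
  then show ?thesis
  proof (rule extensionalityI)
    fix \<phi> assume "\<phi> \<in> cfuns"
    then have "\<phi> = restrict \<phi> units" "integrand \<phi>" by (simp_all add: cfuns_iff extensional_restrict)
    then show "\<mu> \<phi> = \<nu> \<phi>" using eq[of \<phi>] by (simp add: measure_integral_def)
  qed
qed

section \<open>The Iwasawa algebra\<close>

abbreviation iwasawa :: "(('a \<Rightarrow> 'a) \<Rightarrow> 'a) ring" where
  "iwasawa \<equiv> iwasawa_algebra Zp_units"

lemma Zp_units_mult [simp]: "x \<otimes>\<^bsub>Zp_units\<^esub> y = x * (y::'a)"
  and Zp_units_one [simp]: "\<one>\<^bsub>Zp_units\<^esub> = (1::'a)"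
  by (simp_all add: Zp_units_def)

lemma iwasawa_simps:
  "carrier iwasawa = measures"
  "x \<otimes>\<^bsub>iwasawa\<^esub> y = convolution Zp_units x y"
  "\<one>\<^bsub>iwasawa\<^esub> = dirac Zp_units 1"
  "\<zero>\<^bsub>iwasawa\<^esub> = (\<lambda>\<phi>\<in>cfuns. 0)"
  "x \<oplus>\<^bsub>iwasawa\<^esub> y = (\<lambda>\<phi>\<in>cfuns. x \<phi> + y \<phi>)"
  by (simp_all add: iwasawa_algebra_def)

lemma integ_restrict:
  "integrand f \<Longrightarrow> integ (restrict F cfuns) f = F (restrict f units)"
  by (simp add: measure_integral_def restrict_in_cfuns)

lemma dirac_in_measures: "g \<in> units \<Longrightarrow> dirac Zp_units g \<in> measures"
  unfolding dirac_def by (rule measureI) (auto dest: integrandD)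

lemma moment_dirac: "g \<in> units \<Longrightarrow> moment (dirac Zp_units g) k = g ^ k"
  unfolding moment_def dirac_def by (simp add: integ_restrict integrand_monomial)

lemma zero_in_measures: "(\<lambda>\<phi>\<in>cfuns. 0) \<in> measures"
  by (rule measureI) auto

lemma moment_zero: "moment (\<lambda>\<phi>\<in>cfuns. 0) k = 0"
  unfolding moment_def by (simp add: integ_restrict integrand_monomial)

text \<open>Serves addition with c = 1, and additive inverses with the zero measure and c =
  -1.\<close>

lemma linear_in_measures:
  assumes "\<mu> \<in> measures" "\<nu> \<in> measures" "absval c \<le> 1"
  shows "(\<lambda>\<phi>\<in>cfuns. \<mu> \<phi> + c * \<nu> \<phi>) \<in> measures"
proof (rule measureI)
  have I: "\<mu> (restrict f units) = integ \<mu> f" for \<mu> f by (simp add: measure_integral_def)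
  fix f g a n assume fg: "integrand f" "integrand g"
  show "\<mu> (\<lambda>x\<in>units. f x + g x) + c * \<nu> (\<lambda>x\<in>units. f x + g x) =
      \<mu> (restrict f units) + c * \<nu> (restrict f units) + (\<mu> (restrict g units) + c * \<nu> (restrict g units))"
    unfolding I using fg assms by (simp add: integ_add algebra_simps)
  show "absval (\<mu> (restrict f units) + c * \<nu> (restrict f units)) \<le> 1"
    unfolding I using fg assms by (intro absval_add_le absval_mult_le_left absval_integ_le_1)
  show "\<mu> (\<lambda>x\<in>units. a * f x) + c * \<nu> (\<lambda>x\<in>units. a * f x) = a * (\<mu> (restrict f units) + c * \<nu> (restrict f units))"
    if "absval a \<le> 1"
    unfolding I using fg assms that by (simp add: integ_cmult algebra_simps)
  assume "\<And>x. x \<in> units \<Longrightarrow> absval (f x - g x) \<le> rad n"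
  then have "absval (integ \<mu> f - integ \<mu> g) \<le> rad n" "absval (integ \<nu> f - integ \<nu> g) \<le> rad n"
    using absval_integ_diff_le fg assms by blast+
  then have "absval ((integ \<mu> f - integ \<mu> g) + c * (integ \<nu> f - integ \<nu> g)) \<le> rad n"
    using assms(3) by (intro absval_add_le absval_mult_le_left)
  then show "absval (\<mu> (restrict f units) + c * \<nu> (restrict f units) -
      (\<mu> (restrict g units) + c * \<nu> (restrict g units))) \<le> rad n"
    unfolding I by (simp add: algebra_simps)
qed

lemma moment_linear:
  "moment (\<lambda>\<phi>\<in>cfuns. \<mu> \<phi> + c * \<nu> \<phi>) k = moment \<mu> k + c * moment \<nu> k"
  unfolding moment_def by (simp add: integ_restrict integrand_monomial) (simp add: measure_integral_def)

text \<open>The functions y -> f (x y) depend uniformly continuously on x, since |u y - v y| = |u -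
  v| for a unit y, and integration is a contraction. This makes the outer integral of a convolution
  meaningful.\<close>

lemma integrand_partial_integ:
  assumes "\<nu> \<in> measures" "integrand f"
  shows "integrand (\<lambda>x. integ \<nu> (\<lambda>y. f (x * y)))"
  unfolding integrand_def
proof (intro conjI ballI)
  show "absval (integ \<nu> (\<lambda>y. f (x * y))) \<le> 1" if "x \<in> units" for x
    using assms that by (intro absval_integ_le_1 integrand_scale_arg)
  show "ucont (\<lambda>x. integ \<nu> (\<lambda>y. f (x * y)))" unfolding ucont_def
  proof
    fix n
    obtain m where m: "\<And>x y. \<lbrakk>x \<in> units; y \<in> units; absval (x - y) \<le> rad m\<rbrakk> \<Longrightarrow> absval (f x - f y) \<le> rad n"
      using ucontD assms(2) unfolding integrand_def by metis
    have "absval (integ \<nu> (\<lambda>y. f (u * y)) - integ \<nu> (\<lambda>y. f (v * y))) \<le> rad n"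
      if uv: "u \<in> units" "v \<in> units" "absval (u - v) \<le> rad m" for u v
    proof (rule absval_integ_diff_le)
      fix y assume y: "y \<in> units"
      have "absval (u * y - v * y) = absval (u - v) * absval y"
        by (simp only: absval_mult[symmetric] left_diff_distrib)
      then show "absval (f (u * y) - f (v * y)) \<le> rad n"
        using uv y by (intro m) (auto simp: units_mult absval_unit)
    qed (use assms uv in \<open>auto intro: integrand_scale_arg\<close>)
    then show "\<exists>m. \<forall>x\<in>units. \<forall>z\<in>units. absval (x - z) \<le> rad m \<longrightarrow>
        absval (integ \<nu> (\<lambda>y. f (x * y)) - integ \<nu> (\<lambda>y. f (z * y))) \<le> rad n" by blast
  qed
qed

lemma convolution_eq:
  "convolution Zp_units \<mu> \<nu> = (\<lambda>\<phi>\<in>cfuns. integ \<mu> (\<lambda>x. integ \<nu> (\<lambda>y. \<phi> (x * y))))"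
  unfolding convolution_def by simp

lemma convolution_restrict:
  "integ \<mu> (\<lambda>x. integ \<nu> (\<lambda>y. restrict f units (x * y))) = integ \<mu> (\<lambda>x. integ \<nu> (\<lambda>y. f (x * y)))"
  by (intro integ_cong) (simp add: units_mult)

lemma convolution_in_measures:
  assumes "\<mu> \<in> measures" "\<nu> \<in> measures"
  shows "convolution Zp_units \<mu> \<nu> \<in> measures"
  unfolding convolution_eq
proof (rule measureI, unfold convolution_restrict)
  note intgr = integrand_partial_integ[OF assms(2)]
  fix f g a n assume f: "integrand f"
  show "integ \<mu> (\<lambda>x. integ \<nu> (\<lambda>y. a * f (x * y))) = a * integ \<mu> (\<lambda>x. integ \<nu> (\<lambda>y. f (x * y)))"
    if a: "absval a \<le> 1"
  proof -
    have "integ \<mu> (\<lambda>x. integ \<nu> (\<lambda>y. a * f (x * y))) = integ \<mu> (\<lambda>x. a * integ \<nu> (\<lambda>y. f (x * y)))"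
      using a f assms by (intro integ_cong integ_cmult integrand_scale_arg)
    then show ?thesis using a f assms by (simp add: integ_cmult intgr)
  qed
  show "absval (integ \<mu> (\<lambda>x. integ \<nu> (\<lambda>y. f (x * y)))) \<le> 1"
    using assms f by (intro absval_integ_le_1 intgr)
  assume g: "integrand g"
  show "integ \<mu> (\<lambda>x. integ \<nu> (\<lambda>y. f (x * y) + g (x * y))) =
      integ \<mu> (\<lambda>x. integ \<nu> (\<lambda>y. f (x * y))) + integ \<mu> (\<lambda>x. integ \<nu> (\<lambda>y. g (x * y)))"
  proof -
    have "integ \<mu> (\<lambda>x. integ \<nu> (\<lambda>y. f (x * y) + g (x * y))) =
       integ \<mu> (\<lambda>x. integ \<nu> (\<lambda>y. f (x * y)) + integ \<nu> (\<lambda>y. g (x * y)))"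
      using f g assms by (intro integ_cong integ_add integrand_scale_arg)
    then show ?thesis using f g assms by (simp add: integ_add intgr)
  qed
  assume close: "\<And>x. x \<in> units \<Longrightarrow> absval (f x - g x) \<le> rad n"
  show "absval (integ \<mu> (\<lambda>x. integ \<nu> (\<lambda>y. f (x * y))) - integ \<mu> (\<lambda>x. integ \<nu> (\<lambda>y. g (x * y)))) \<le> rad n"
    using assms f g by (intro absval_integ_diff_le intgr integrand_scale_arg close units_mult)
qed

text \<open>x -> x^k is a character, so the double integral factors.\<close>

lemma moment_convolution:
  assumes "\<mu> \<in> measures" "\<nu> \<in> measures"
  shows "moment (convolution Zp_units \<mu> \<nu>) k = moment \<mu> k * moment \<nu> k"
proof -
  have "moment (convolution Zp_units \<mu> \<nu>) k = integ \<mu> (\<lambda>x. integ \<nu> (\<lambda>y. (x * y) ^ k))"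
    unfolding moment_def convolution_eq
    by (subst integ_restrict[OF integrand_monomial]) (rule convolution_restrict)
  also have "\<dots> = integ \<mu> (\<lambda>x. moment \<nu> k * x ^ k)"
  proof (rule integ_cong)
    fix x assume "x \<in> units"
    then show "integ \<nu> (\<lambda>y. (x * y) ^ k) = moment \<nu> k * x ^ k"
      using assms(2) integ_cmult[OF assms(2) integrand_monomial, of "x ^ k" k]
      by (simp add: moment_def power_mult_distrib absval_power absval_unit mult.commute)
  qed
  also have "\<dots> = moment \<nu> k * moment \<mu> k"
    unfolding moment_def using assms
    by (intro integ_cmult integrand_monomial absval_integ_le_1)
  finally show ?thesis by (simp add: mult.commute)
qed

lemma moment_iwasawa_add: "moment (\<mu> \<oplus>\<^bsub>iwasawa\<^esub> \<nu>) k = moment \<mu> k + moment \<nu> k"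
  using moment_linear[of \<mu> 1 \<nu> k] by (simp add: iwasawa_simps)

lemma iwasawa_add_closed: "\<lbrakk>\<mu> \<in> measures; \<nu> \<in> measures\<rbrakk> \<Longrightarrow> \<mu> \<oplus>\<^bsub>iwasawa\<^esub> \<nu> \<in> measures"
  using linear_in_measures[of \<mu> \<nu> 1] by (simp add: iwasawa_simps)

lemma moment_iwasawa_mult:
  "\<lbrakk>\<mu> \<in> measures; \<nu> \<in> measures\<rbrakk> \<Longrightarrow> moment (\<mu> \<otimes>\<^bsub>iwasawa\<^esub> \<nu>) k = moment \<mu> k * moment \<nu> k"
  by (simp add: iwasawa_simps moment_convolution)

lemma iwasawa_mult_closed: "\<lbrakk>\<mu> \<in> measures; \<nu> \<in> measures\<rbrakk> \<Longrightarrow> \<mu> \<otimes>\<^bsub>iwasawa\<^esub> \<nu> \<in> measures"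
  by (simp add: iwasawa_simps convolution_in_measures)

lemma iwasawa_one_zero:
  "\<one>\<^bsub>iwasawa\<^esub> \<in> measures" "\<zero>\<^bsub>iwasawa\<^esub> \<in> measures"
  "moment \<one>\<^bsub>iwasawa\<^esub> k = 1" "moment \<zero>\<^bsub>iwasawa\<^esub> k = 0"
  by (simp_all add: iwasawa_simps dirac_in_measures zero_in_measures moment_dirac moment_zero)

text \<open>All ring axioms follow from the injectivity of the moment map into a product of fields.\<close>

lemma cring_iwasawa: "cring iwasawa"
proof -
  note closed = iwasawa_add_closed iwasawa_mult_closed iwasawa_one_zero(1,2)
  note moments = moment_iwasawa_add moment_iwasawa_mult iwasawa_one_zero(3,4) closed
  have "abelian_group iwasawa"
  proof (rule abelian_groupI, unfold iwasawa_simps(1))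
    fix x assume x: "x \<in> measures"
    let ?y = "\<lambda>\<phi>\<in>cfuns. (\<lambda>\<phi>\<in>cfuns. 0) \<phi> + (-1) * x \<phi>"
    have y: "?y \<in> measures" by (rule linear_in_measures[OF zero_in_measures x]) simp
    have "moment ?y k = - moment x k" for k
      by (simp only: moment_linear moment_zero) simp
    then have "?y \<oplus>\<^bsub>iwasawa\<^esub> x = \<zero>\<^bsub>iwasawa\<^esub>"
      using x y by (intro measure_eqI_moments) (simp_all only: moments, simp)
    then show "\<exists>y\<in>measures. y \<oplus>\<^bsub>iwasawa\<^esub> x = \<zero>\<^bsub>iwasawa\<^esub>" using y by blast
  qed (auto intro!: measure_eqI_moments simp: moments algebra_simps)
  moreover have "Group.comm_monoid iwasawa"
    by (rule comm_monoidI, unfold iwasawa_simps(1))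
       (auto intro!: measure_eqI_moments simp: moments algebra_simps)
  moreover have "(x \<oplus>\<^bsub>iwasawa\<^esub> y) \<otimes>\<^bsub>iwasawa\<^esub> z = x \<otimes>\<^bsub>iwasawa\<^esub> z \<oplus>\<^bsub>iwasawa\<^esub> y \<otimes>\<^bsub>iwasawa\<^esub> z"
    if "x \<in> carrier iwasawa" "y \<in> carrier iwasawa" "z \<in> carrier iwasawa" for x y z
    using that unfolding iwasawa_simps(1)
    by (intro measure_eqI_moments) (simp_all add: moments algebra_simps)
  ultimately show ?thesis by (rule cringI)
qed

sublocale iwasawa: cring iwasawa
  by (rule cring_iwasawa)

lemma iwasawa_minus_closed:
  "\<lbrakk>\<mu> \<in> measures; \<nu> \<in> measures\<rbrakk> \<Longrightarrow> \<mu> \<ominus>\<^bsub>iwasawa\<^esub> \<nu> \<in> measures"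
  using iwasawa.minus_closed by (simp add: iwasawa_simps(1))

lemma moment_iwasawa_minus:
  assumes "\<mu> \<in> measures" "\<nu> \<in> measures"
  shows "moment (\<mu> \<ominus>\<^bsub>iwasawa\<^esub> \<nu>) k = moment \<mu> k - moment \<nu> k"
proof -
  have "(\<mu> \<ominus>\<^bsub>iwasawa\<^esub> \<nu>) \<oplus>\<^bsub>iwasawa\<^esub> \<nu> = \<mu>"
    using assms[folded iwasawa_simps(1)] by (simp add: a_minus_def iwasawa.a_assoc iwasawa.l_neg)
  then have "moment (\<mu> \<ominus>\<^bsub>iwasawa\<^esub> \<nu>) k + moment \<nu> k = moment \<mu> k"
    by (metis moment_iwasawa_add)
  then show ?thesis by (simp add: algebra_simps)
qed

text \<open>Moments multiply in a field, so an annihilated measure has no nonzero moment of positive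
  order and is therefore 0.\<close>

lemma iwasawa_regularI:
  assumes "\<mu> \<in> measures" "\<And>k. k > 0 \<Longrightarrow> moment \<mu> k \<noteq> 0"
  shows "\<mu> \<in> regular_elements iwasawa"
  unfolding regular_elements_def iwasawa_simps(1)
proof (intro CollectI conjI ballI impI assms(1))
  fix a assume a: "a \<in> measures" "a \<otimes>\<^bsub>iwasawa\<^esub> \<mu> = \<zero>\<^bsub>iwasawa\<^esub>"
  then have "moment a k * moment \<mu> k = 0" for k
    by (metis moment_iwasawa_mult assms(1) iwasawa_one_zero(4))
  then show "a = \<zero>\<^bsub>iwasawa\<^esub>"
    using assms(2) a(1) by (intro measure_eqI_moments iwasawa_one_zero) (auto simp: iwasawa_one_zero)
qed

section \<open>Regularised Bernoulli distributions\<close>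

definition fibre :: "nat \<Rightarrow> nat \<Rightarrow> nat set" where
  "fibre N b = {a \<in> unit_residues (Suc N). a mod p ^ N = b}"

lemma finite_fibre [simp]: "finite (fibre N b)"
  by (simp add: fibre_def)

lemma unit_residues_0 [simp]: "unit_residues 0 = {}"
  by (auto simp: unit_residues_def intro!: gr0I)

lemma mod_in_unit_residues:
  assumes "N > 0" "a \<in> unit_residues (Suc N)"
  shows "a mod p ^ N \<in> unit_residues N"
proof -
  have "p dvd p ^ N" using assms(1) by simp
  then have "p dvd a mod p ^ N \<longleftrightarrow> p dvd a" by (rule dvd_mod_iff)
  then show ?thesis using assms(2) p_gt_2 by (simp add: unit_residues_def)
qed

lemma sum_fibres:
  assumes "N > 0"
  shows "(\<Sum>b\<in>unit_residues N. \<Sum>a\<in>fibre N b. h a) = (\<Sum>a\<in>unit_residues (Suc N). h a :: 'a)"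
  unfolding fibre_def using assms mod_in_unit_residues by (intro sum.group) auto

text \<open>For N > 0 adding a multiple of p^N does not change divisibility by p, so all p lifts of
  b are unit residues.\<close>

lemma fibre_eq_image:
  assumes "N > 0" "b \<in> unit_residues N"
  shows "fibre N b = (\<lambda>j. b + j * p ^ N) ` {..<p}"
proof (intro equalityI subsetI)
  fix a assume "a \<in> fibre N b"
  then have a: "a < p * p ^ N" "a mod p ^ N = b" by (auto simp: fibre_def unit_residues_def)
  have "a div p ^ N < p" using a(1) by (rule less_mult_imp_div_less)
  moreover have "a = b + (a div p ^ N) * p ^ N" using a(2) by (metis mod_div_mult_eq)
  ultimately show "a \<in> (\<lambda>j. b + j * p ^ N) ` {..<p}" by blast
next
  fix a assume "a \<in> (\<lambda>j. b + j * p ^ N) ` {..<p}"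
  then obtain j where j: "j < p" "a = b + j * p ^ N" by blast
  have b: "b < p ^ N" "\<not> p dvd b" using assms(2) by (auto simp: unit_residues_def)
  have "p dvd j * p ^ N" using assms(1) by simp
  then have "\<not> p dvd a" using b(2) unfolding j(2) by (simp add: dvd_add_left_iff)
  moreover have "a < p ^ Suc N"
  proof -
    have "a < Suc j * p ^ N" using b(1) by (simp add: j(2))
    also have "\<dots> \<le> p * p ^ N" using j(1) by (intro mult_le_mono1) simp
    finally show ?thesis by simp
  qed
  moreover have "a mod p ^ N = b" using b(1) by (simp add: j(2))
  ultimately show "a \<in> fibre N b" by (simp add: fibre_def unit_residues_def)
qed

lemma absval_fibre_le: "a \<in> fibre N b \<Longrightarrow> absval (of_nat a - of_nat b :: 'a) \<le> rad N"
  by (auto simp: fibre_def absval_of_nat_diff_le_rad_iff cong_def)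

lemma padic_tendsto_sum:
  "(\<And>i. i \<in> A \<Longrightarrow> (f i \<longlongrightarrow> l i) F) \<Longrightarrow> ((\<lambda>x. \<Sum>i\<in>A. f i x) \<longlongrightarrow> (\<Sum>i\<in>A. l i :: 'a)) F"
  by (induction A rule: infinite_finite_induct) (auto intro: padic_tendsto_add)

text \<open>A bounded additive function on residue discs integrates continuous functions through
  Riemann sums. Additivity starts at level 1 because \<open>unit_residues 0\<close> is
  empty.\<close>

lemma measure_of_distribution:
  assumes bound: "\<And>N a. \<lbrakk>N > 0; a \<in> unit_residues N\<rbrakk> \<Longrightarrow> absval (m N a :: 'a) \<le> 1"
    and additive: "\<And>N b. \<lbrakk>N > 0; b \<in> unit_residues N\<rbrakk> \<Longrightarrow> (\<Sum>a\<in>fibre N b. m (Suc N) a) = m N b"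
  obtains \<mu> where "\<mu> \<in> measures"
    "\<And>f. integrand f \<Longrightarrow> (\<lambda>N. \<Sum>a\<in>unit_residues N. f (of_nat a) * m N a) \<longlonglongrightarrow> integ \<mu> f"
proof -
  define S :: "('a \<Rightarrow> 'a) \<Rightarrow> nat \<Rightarrow> 'a" where "S = (\<lambda>f N. \<Sum>a\<in>unit_residues N. f (of_nat a) * m N a)"
  have S_restrict: "S (restrict f units) = S f" for f
    unfolding S_def by (intro ext sum.cong refl) (simp add: unit_residues_in_units)
  have conv: "\<exists>l. S f \<longlonglongrightarrow> l" if f: "integrand f" for f
  proof (rule padic_convergent)
    fix e assume "(0::real) < e"
    then obtain n where n: "rad n < e" using ex_rad_less by blast
    obtain M where M: "\<And>x y. \<lbrakk>x \<in> units; y \<in> units; absval (x - y) \<le> rad M\<rbrakk> \<Longrightarrow> absval (f x - f y) \<le> rad n"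
      using ucontD f unfolding integrand_def by metis
    have "absval (S f (Suc N) - S f N) \<le> rad n" if N: "N \<ge> Suc M" for N
    proof -
      have N0: "N > 0" using N by simp
      \<comment> \<open>Additivity rewrites the sum of level N over the finer discs, so only the
        oscillation of f on a disc remains.\<close>
      have "S f (Suc N) - S f N = (\<Sum>b\<in>unit_residues N. \<Sum>a\<in>fibre N b. f (of_nat a) * m (Suc N) a)
          - (\<Sum>b\<in>unit_residues N. \<Sum>a\<in>fibre N b. f (of_nat b) * m (Suc N) a)"
        unfolding S_def sum_fibres[OF N0] by (simp add: additive[OF N0] flip: sum_distrib_left)
      also have "\<dots> = (\<Sum>b\<in>unit_residues N. \<Sum>a\<in>fibre N b. m (Suc N) a * (f (of_nat a) - f (of_nat b)))"
        by (simp add: sum_subtractf algebra_simps)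
      also have "absval \<dots> \<le> rad n"
      proof (intro absval_sum_le rad_nonneg absval_mult_le_left)
        fix a b assume ab: "b \<in> unit_residues N" "a \<in> fibre N b"
        then have a: "a \<in> unit_residues (Suc N)" by (simp add: fibre_def)
        show "absval (m (Suc N) a) \<le> 1" using bound a by simp
        have "rad N \<le> rad M" using N by (simp add: rad_le_rad_iff)
        then show "absval (f (of_nat a) - f (of_nat b)) \<le> rad n"
          using absval_fibre_le[OF ab(2)] ab(1) a unit_residues_in_units by (intro M) auto
      qed
      finally show ?thesis .
    qed
    then show "\<exists>K. \<forall>N\<ge>K. absval (S f (Suc N) - S f N) < e" using n by (meson le_less_trans)
  qed
  \<comment> \<open>\<open>lim\<close> is an arbitrary value when the sums diverge; the restriction
    to \<open>cfuns\<close> keeps only convergent cases.\<close>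
  define F where "F = (\<lambda>f. lim (S f))"
  have F: "S f \<longlonglongrightarrow> F f" if "integrand f" for f
    using conv[OF that] by (auto simp: F_def limI)
  have F_restrict: "F (restrict f units) = F f" for f
    by (simp add: F_def S_restrict)
  have S_bound: "absval (S f N) \<le> 1" if "integrand f" for f N
  proof (cases "N > 0")
    case True
    then show ?thesis unfolding S_def using integrandD[OF that unit_residues_in_units] bound
      by (intro absval_sum_le absval_mult_le_left) auto
  qed (simp add: S_def)
  have "restrict F cfuns \<in> measures"
  proof (rule measureI, unfold F_restrict)
    fix f g c n assume f: "integrand f"
    show "F (\<lambda>x. c * f x) = c * F f" if "absval c \<le> 1"
    proof -
      have "S (\<lambda>x. c * f x) = (\<lambda>N. c * S f N)"
        by (simp add: S_def sum_distrib_left mult_ac)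
      then show ?thesis
        using LIMSEQ_unique[OF F[OF integrand_cmult[OF that f]]] padic_tendsto_const_mult[OF F[OF f]] by simp
    qed
    show "absval (F f) \<le> 1"
      using absval_le_of_tendsto[OF F[OF f], of 0 0 1] S_bound[OF f] by simp
    assume g: "integrand g"
    have "S (\<lambda>x. f x + g x) = (\<lambda>N. S f N + S g N)"
      by (simp add: S_def sum.distrib algebra_simps)
    then show "F (\<lambda>x. f x + g x) = F f + F g"
      using LIMSEQ_unique[OF F[OF integrand_add[OF f g]]] padic_tendsto_add[OF F[OF f] F[OF g]] by simp
    assume close: "\<And>x. x \<in> units \<Longrightarrow> absval (f x - g x) \<le> rad n"
    have "absval (S f N - S g N - 0) \<le> rad n" for N
    proof (cases "N > 0")
      case True
      have "S f N - S g N = (\<Sum>a\<in>unit_residues N. m N a * (f (of_nat a) - g (of_nat a)))"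
        by (simp add: S_def sum_subtractf algebra_simps)
      then show ?thesis using True bound close unit_residues_in_units
        by (auto intro!: absval_sum_le absval_mult_le_left)
    qed (simp add: S_def)
    then show "absval (F f - F g) \<le> rad n"
      using absval_le_of_tendsto[OF padic_tendsto_diff[OF F[OF f] F[OF g]], of 0 0 "rad n"] by simp
  qed
  moreover have "S f \<longlonglongrightarrow> integ (restrict F cfuns) f" if "integrand f" for f
    using F[OF that] that by (simp add: integ_restrict F_restrict)
  ultimately show ?thesis using that unfolding S_def by blast
qed

lemma sum_of_nat_lessThan: "(\<Sum>j<n. of_nat j :: 'a) = of_nat n * (of_nat n - 1) / 2"
  by (induction n) (auto simp: field_simps)

lemma p_neq_0 [simp]: "p \<noteq> 0"
  using p_gt_2 by simp

text \<open>From the first Bernoulli polynomial \<open>X - 1/2\<close>; unbounded, hence not itself a measure.\<close>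

definition bernoulli_dist :: "nat \<Rightarrow> nat \<Rightarrow> 'a" where
  "bernoulli_dist N a = of_nat a / of_nat p ^ N - 1 / 2"

text \<open>The digits j/p of the p lifts sum to (p - 1)/2, which turns p times -1/2 back into -1/2;
  this is why the constant is 1/2.\<close>

lemma bernoulli_dist_additive:
  assumes "N > 0" "b \<in> unit_residues N"
  shows "(\<Sum>a\<in>fibre N b. bernoulli_dist (Suc N) a) = bernoulli_dist N b"
proof -
  have "inj_on (\<lambda>j. b + j * p ^ N) {..<p}" using p_gt_2 by (auto intro!: inj_onI)
  then have "(\<Sum>a\<in>fibre N b. bernoulli_dist (Suc N) a) = (\<Sum>j<p. bernoulli_dist (Suc N) (b + j * p ^ N))"
    unfolding fibre_eq_image[OF assms] by (simp add: sum.reindex)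
  also have "\<dots> = (\<Sum>j<p. (of_nat b / of_nat p ^ Suc N - 1 / 2) + of_nat j / of_nat p)"
    by (intro sum.cong refl) (simp add: bernoulli_dist_def add_divide_distrib)
  also have "\<dots> = of_nat p * (of_nat b / of_nat p ^ Suc N - 1 / 2) + (\<Sum>j<p. of_nat j) / of_nat p"
    by (simp add: sum.distrib sum_divide_distrib)
  also have "\<dots> = bernoulli_dist N b"
    unfolding sum_of_nat_lessThan by (simp add: bernoulli_dist_def field_simps)
  finally show ?thesis .
qed

section \<open>Units acting on residues\<close>

definition act :: "'a \<Rightarrow> nat \<Rightarrow> nat \<Rightarrow> nat" where
  "act \<alpha> N a = residue N (\<alpha> * of_nat a)"

lemma act_in_unit_residues:
  "\<lbrakk>\<alpha> \<in> units; a \<in> unit_residues N; N > 0\<rbrakk> \<Longrightarrow> act \<alpha> N a \<in> unit_residues N"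
  unfolding act_def by (intro residue_in_unit_residues units_mult unit_residues_in_units)

lemma absval_act_le:
  "\<lbrakk>\<alpha> \<in> units; a \<in> unit_residues M\<rbrakk> \<Longrightarrow> absval (\<alpha> * of_nat a - of_nat (act \<alpha> N a)) \<le> rad N"
  unfolding act_def by (intro absval_residue_le units_in_Zp units_mult unit_residues_in_units)

lemma absval_unit_mult_diff:
  "\<alpha> \<in> units \<Longrightarrow> absval (\<alpha> * x - \<alpha> * y) = absval (x - y)"
  using absval_mult[of \<alpha> "x - y"] by (simp add: absval_unit right_diff_distrib)

lemma inj_on_act:
  assumes "\<alpha> \<in> units"
  shows "inj_on (act \<alpha> N) (unit_residues N)"
proof (rule inj_onI)
  fix a b assume ab: "a \<in> unit_residues N" "b \<in> unit_residues N" "act \<alpha> N a = act \<alpha> N b"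
  have "absval (\<alpha> * of_nat a - \<alpha> * of_nat b) \<le> rad N"
    using absval_triangle_le[OF absval_act_le[OF assms ab(1), of N]] absval_act_le[OF assms ab(2), of N]
      absval_minus_commute[of "\<alpha> * of_nat b"] ab(3) by simp
  then have "[a = b] (mod p ^ N)"
    unfolding absval_unit_mult_diff[OF assms] by (simp add: absval_of_nat_diff_le_rad_iff)
  then show "a = b" using ab by (simp add: unit_residues_def cong_less_modulus_unique_nat)
qed

lemma bij_betw_act:
  assumes "\<alpha> \<in> units" "N > 0"
  shows "bij_betw (act \<alpha> N) (unit_residues N) (unit_residues N)"
  using inj_on_act[OF assms(1)] act_in_unit_residues[OF assms(1) _ assms(2)]
  by (simp add: bij_betw_def endo_inj_surj image_subsetI)

text \<open>Multiplication is compatible with reduction modulo p^N and injective, and both fibres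
  have p elements.\<close>

lemma bij_betw_act_fibre:
  assumes "\<alpha> \<in> units" "N > 0" "b \<in> unit_residues N"
  shows "bij_betw (act \<alpha> (Suc N)) (fibre N b) (fibre N (act \<alpha> N b))"
proof -
  have inj: "inj_on (act \<alpha> (Suc N)) (fibre N b)"
    by (rule inj_on_subset[OF inj_on_act[OF assms(1)]]) (auto simp: fibre_def)
  have sub: "act \<alpha> (Suc N) ` fibre N b \<subseteq> fibre N (act \<alpha> N b)"
  proof (rule image_subsetI)
    fix a assume a: "a \<in> fibre N b"
    then have ar: "a \<in> unit_residues (Suc N)" by (simp add: fibre_def)
    let ?c = "act \<alpha> (Suc N) a"
    have c: "?c \<in> unit_residues (Suc N)" using act_in_unit_residues[OF assms(1) ar] by simp
    have "absval (\<alpha> * of_nat a - of_nat ?c) \<le> rad N"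
      using absval_act_le[OF assms(1) ar, of "Suc N"] rad_Suc_less[of N] by simp
    moreover have "absval (\<alpha> * of_nat b - \<alpha> * of_nat a) \<le> rad N"
      unfolding absval_unit_mult_diff[OF assms(1)] using absval_fibre_le[OF a] absval_minus_commute[of "of_nat b"] by simp
    moreover have "absval (of_nat ?c - of_nat (?c mod p ^ N) :: 'a) \<le> rad N"
      by (simp add: absval_of_nat_diff_le_rad_iff cong_def)
    ultimately have "absval (\<alpha> * of_nat b - of_nat (?c mod p ^ N)) \<le> rad N"
      by (meson absval_triangle_le)
    then have "act \<alpha> N b = ?c mod p ^ N"
      unfolding act_def using assms p_gt_2
      by (intro residue_unique units_in_Zp units_mult unit_residues_in_units) auto
    then show "?c \<in> fibre N (act \<alpha> N b)" using c by (simp add: fibre_def)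
  qed
  have card: "card (fibre N c) = p" if "c \<in> unit_residues N" for c
    unfolding fibre_eq_image[OF assms(2) that] using p_gt_2 by (subst card_image) (auto intro!: inj_onI)
  have "act \<alpha> (Suc N) ` fibre N b = fibre N (act \<alpha> N b)"
    using sub by (rule card_subset_eq[OF finite_fibre])
      (simp add: card_image[OF inj] card assms act_in_unit_residues)
  then show ?thesis using inj by (simp add: bij_betw_def)
qed

section \<open>The regularised distribution\<close>

text \<open>The denominators p^N cancel: a and \<alpha>^-1 times the residue of \<alpha> a are
  congruent modulo p^N. The weight \<alpha>^-1 is what makes this work.\<close>

definition regularized_dist :: "'a \<Rightarrow> nat \<Rightarrow> nat \<Rightarrow> 'a" where
  "regularized_dist \<alpha> N a = bernoulli_dist N a - inverse \<alpha> * bernoulli_dist N (act \<alpha> N a)"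

lemma unit_nonzero: "x \<in> units \<Longrightarrow> x \<noteq> 0"
  by (auto simp: units_iff)

lemma regularized_dist_eq:
  "regularized_dist \<alpha> N a =
     (of_nat a - inverse \<alpha> * of_nat (act \<alpha> N a)) / of_nat p ^ N + (inverse \<alpha> - 1) / 2"
  by (simp add: regularized_dist_def bernoulli_dist_def diff_divide_distrib algebra_simps)

lemma absval_act_inverse_le:
  assumes "\<alpha> \<in> units" "a \<in> unit_residues N"
  shows "absval (of_nat a - inverse \<alpha> * of_nat (act \<alpha> N a)) \<le> rad N"
proof -
  have "of_nat a - inverse \<alpha> * of_nat (act \<alpha> N a) = inverse \<alpha> * (\<alpha> * of_nat a - of_nat (act \<alpha> N a))"
    using unit_nonzero[OF assms(1)] by (simp add: right_diff_distrib flip: mult.assoc)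
  then show ?thesis
    using absval_act_le[OF assms, of N] assms(1) by (simp add: absval_mult absval_inverse absval_unit)
qed

lemma absval_regularized_dist_le_1:
  assumes "\<alpha> \<in> units" "a \<in> unit_residues N"
  shows "absval (regularized_dist \<alpha> N a) \<le> 1"
  unfolding regularized_dist_eq
proof (rule absval_add_le)
  show "absval ((of_nat a - inverse \<alpha> * of_nat (act \<alpha> N a)) / of_nat p ^ N) \<le> 1"
    using absval_act_inverse_le[OF assms] by (simp only: absval_divide absval_p_power) simp
  \<comment> \<open>Oddness of p makes the constant part integral.\<close>
  have "\<not> p dvd 2" using p_gt_2 by (auto dest: dvd_imp_le)
  then have "absval (of_nat 2 :: 'a) = 1" by (rule absval_of_nat_eq_1)
  moreover have "absval (inverse \<alpha> - 1) \<le> 1"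
    using assms(1) by (intro absval_diff_le) (auto simp: absval_inverse absval_unit)
  ultimately show "absval ((inverse \<alpha> - 1) / 2) \<le> 1" by (simp add: absval_divide)
qed

lemma regularized_dist_additive:
  assumes "\<alpha> \<in> units" "N > 0" "b \<in> unit_residues N"
  shows "(\<Sum>a\<in>fibre N b. regularized_dist \<alpha> (Suc N) a) = regularized_dist \<alpha> N b"
proof -
  have "(\<Sum>a\<in>fibre N b. bernoulli_dist (Suc N) (act \<alpha> (Suc N) a)) = bernoulli_dist N (act \<alpha> N b)"
    using sum.reindex_bij_betw[OF bij_betw_act_fibre[OF assms], of "bernoulli_dist (Suc N)"]
      bernoulli_dist_additive[OF assms(2) act_in_unit_residues[OF assms(1,3,2)]] by simp
  then show ?thesis
    by (simp add: regularized_dist_def sum_subtractf bernoulli_dist_additive[OF assms(2,3)] flip: sum_distrib_left)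
qed

section \<open>Moments and the zeta pseudo-measure\<close>

lemma inverse_mult_eq_divide:
  "\<lbrakk>t \<noteq> 0; r \<noteq> 0; t * x = r * y\<rbrakk> \<Longrightarrow> inverse r * x = y / (t :: 'a)"
  by (simp add: field_simps)

lemma of_nat_p_power_tendsto_0: "(\<lambda>N. of_nat (p ^ N)) \<longlonglongrightarrow> (0::'a)"
  unfolding tendsto_absval using rad_tendsto_0 by (simp add: absval_p_power)

lemma padic_tendsto_0_mult_bounded:
  assumes "f \<longlonglongrightarrow> (0::'a)" "\<And>n. absval (g n) \<le> 1"
  shows "(\<lambda>n. g n * f n) \<longlonglongrightarrow> (0::'a)"
  unfolding tendsto_absval
proof (rule Lim_null_comparison)
  show "(\<lambda>n. absval (f n - 0)) \<longlonglongrightarrow> 0" using assms(1) unfolding tendsto_absval .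
  show "\<forall>\<^sub>F n in sequentially. norm (absval (g n * f n - 0)) \<le> absval (f n - 0)"
    using assms(2) absval_mult_le_left[OF _ order_refl] by (simp add: absval_nonneg)
qed

section \<open>Power sums and their p-adic limits\<close>

text \<open>As p^N - 1 tends to -1, the limit is (-1 choose n) = (-1)^n. The induction uses Pascal's
  rule, where (p^N choose n+1) = p^N/(n+1) times an integer tends to 0.\<close>

lemma binomial_p_power_minus_1_tendsto:
  "(\<lambda>N. of_nat ((p ^ N - 1) choose n)) \<longlonglongrightarrow> ((- 1) ^ n :: 'a)"
proof (induction n)
  case (Suc n)
  let ?c = "\<lambda>N. of_nat ((p ^ N - 1) choose n) :: 'a"
  have eq: "of_nat ((p ^ N - 1) choose Suc n) = 1 / of_nat (Suc n) * (?c N * of_nat (p ^ N)) + (- 1) * ?c N" for N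
  proof -
    have M: "Suc (p ^ N - 1) = p ^ N" using p_gt_2 by simp
    have "Suc n * (p ^ N choose Suc n) = p ^ N * ((p ^ N - 1) choose n)"
      using Suc_times_binomial[of n "p ^ N - 1"] unfolding M .
    then have "of_nat (Suc n) * of_nat (p ^ N choose Suc n) = ?c N * (of_nat (p ^ N) :: 'a)"
      by (metis of_nat_mult mult.commute)
    then have "of_nat (p ^ N choose Suc n) = 1 / of_nat (Suc n) * (?c N * of_nat (p ^ N) :: 'a)"
      by (simp add: field_simps del: of_nat_Suc)
    moreover have "(p ^ N choose Suc n) = ((p ^ N - 1) choose n) + ((p ^ N - 1) choose Suc n)"
      using binomial_Suc_Suc[of "p ^ N - 1" n] unfolding M .
    ultimately have sum: "?c N + of_nat ((p ^ N - 1) choose Suc n) = 1 / of_nat (Suc n) * (?c N * of_nat (p ^ N))"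
      by (simp only: of_nat_add)
    show ?thesis unfolding sum[symmetric] by simp
  qed
  have "(\<lambda>N. 1 / of_nat (Suc n) * (?c N * of_nat (p ^ N)) + (- 1) * ?c N) \<longlonglongrightarrow> 1 / of_nat (Suc n) * 0 + (- 1) * (- 1) ^ n"
    by (intro padic_tendsto_add padic_tendsto_const_mult Suc.IH padic_tendsto_0_mult_bounded
        of_nat_p_power_tendsto_0 absval_of_nat_le_1)
  then show ?case unfolding eq by simp
qed simp

definition power_sum :: "nat \<Rightarrow> nat \<Rightarrow> 'a" where
  "power_sum k M = (\<Sum>x<M. of_nat (Suc x) ^ k)"

text \<open>Newton interpolation expands (x+1)^k in binomial coefficients of x, and summation over x
  < M is the hockey-stick identity. The computation is rational and is then transported to the
  field.\<close>

lemma power_sum_eq: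
  "power_sum k M = (\<Sum>n\<le>k. (- 1) ^ n * of_rat (alt_diff (\<lambda>j. of_nat (Suc j) ^ k) n) * of_nat (M choose Suc n))"
proof -
  let ?D = "alt_diff (\<lambda>j. of_nat (Suc j) ^ k :: rat)"
  have newton: "of_nat (Suc x) ^ k = (\<Sum>n\<le>k. (- 1) ^ n * ?D n * of_nat (x choose n))" for x
  proof -
    have "of_nat (Suc x) ^ k = (\<Sum>n\<le>x. (- 1) ^ n * of_nat (x choose n) * ?D n)"
      by (rule newton_interpolation)
    \<comment> \<open>Both sums extend to \<open>max x k\<close> by zero terms: binomials vanish for
      n > x, differences for n > k.\<close>
    also have "\<dots> = (\<Sum>n\<le>max x k. (- 1) ^ n * of_nat (x choose n) * ?D n)"
      by (rule sum.mono_neutral_left) (auto simp: binomial_eq_0)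
    also have "\<dots> = (\<Sum>n\<le>k. (- 1) ^ n * of_nat (x choose n) * ?D n)"
      by (rule sum.mono_neutral_right) (auto simp: alt_diff_power_eq_0 simp del: of_nat_Suc)
    finally show ?thesis by (simp add: mult_ac)
  qed
  have "(\<Sum>x<M. of_nat (Suc x) ^ k :: rat) = (\<Sum>x<M. \<Sum>n\<le>k. (- 1) ^ n * ?D n * of_nat (x choose n))"
    by (rule sum.cong[OF refl newton])
  also have "\<dots> = (\<Sum>n\<le>k. (- 1) ^ n * ?D n * of_nat (\<Sum>x<M. x choose n))"
    by (subst sum.swap) (simp add: sum_distrib_left)
  also have "\<dots> = (\<Sum>n\<le>k. (- 1) ^ n * ?D n * of_nat (M choose Suc n))"
  proof -
    have "(\<Sum>x<M. x choose n) = M choose Suc n" for n by (induction M) auto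
    then show ?thesis by (simp only:)
  qed
  finally have "of_rat (\<Sum>x<M. of_nat (Suc x) ^ k) = (of_rat (\<Sum>n\<le>k. (- 1) ^ n * ?D n * of_nat (M choose Suc n)) :: 'a)"
    by (rule arg_cong)
  then show ?thesis
    by (simp add: power_sum_def of_rat_sum of_rat_mult of_rat_power of_rat_minus del: of_nat_Suc)
qed

text \<open>Since (p^N choose n+1)/p^N = (p^N-1 choose n)/(n+1) tends to (-1)^n/(n+1), the sign in
  Newton's formula is squared away and exactly the finite Hasse sum remains.\<close>

lemma power_sum_tendsto:
  "(\<lambda>N. power_sum k (p ^ N) / of_nat p ^ N) \<longlonglongrightarrow> of_rat (zeta_numerator k)"
proof -
  let ?D = "\<lambda>n. of_rat (alt_diff (\<lambda>j. of_nat (Suc j) ^ k) n) :: 'a"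
  have eq: "power_sum k (p ^ N) / of_nat p ^ N =
    (\<Sum>n\<le>k. ((- 1) ^ n * ?D n / of_nat (Suc n)) * of_nat ((p ^ N - 1) choose n))" for N
  proof -
    have quot: "of_nat (p ^ N choose Suc n) / of_nat p ^ N = (of_nat ((p ^ N - 1) choose n) / of_nat (Suc n) :: 'a)" for n
    proof -
      have "Suc n * (p ^ N choose Suc n) = p ^ N * ((p ^ N - 1) choose n)"
        using Suc_times_binomial[of n "p ^ N - 1"] p_gt_2 by simp
      then have "of_nat (Suc n) * of_nat (p ^ N choose Suc n) = of_nat p ^ N * (of_nat ((p ^ N - 1) choose n) :: 'a)"
        by (metis of_nat_mult of_nat_power)
      then show ?thesis by (simp add: field_simps del: of_nat_Suc)
    qed
    have summand: "(- 1) ^ n * ?D n * of_nat (p ^ N choose Suc n) / of_nat p ^ N =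
       ((- 1) ^ n * ?D n / of_nat (Suc n)) * of_nat ((p ^ N - 1) choose n)" for n
    proof -
      have "(- 1) ^ n * ?D n * of_nat (p ^ N choose Suc n) / of_nat p ^ N =
          (- 1) ^ n * ?D n * (of_nat (p ^ N choose Suc n) / of_nat p ^ N)"
        by (simp only: times_divide_eq_right)
      also have "\<dots> = ((- 1) ^ n * ?D n / of_nat (Suc n)) * of_nat ((p ^ N - 1) choose n)"
        unfolding quot by (simp only: times_divide_eq_right times_divide_eq_left)
      finally show ?thesis .
    qed
    show ?thesis unfolding power_sum_eq sum_divide_distrib by (rule sum.cong[OF refl summand])
  qed
  have "(\<lambda>N. power_sum k (p ^ N) / of_nat p ^ N) \<longlonglongrightarrow> (\<Sum>n\<le>k. ((- 1) ^ n * ?D n / of_nat (Suc n)) * (- 1) ^ n)"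
    unfolding eq by (intro padic_tendsto_sum padic_tendsto_const_mult binomial_p_power_minus_1_tendsto)
  also have "(\<Sum>n\<le>k. ((- 1) ^ n * ?D n / of_nat (Suc n)) * (- 1) ^ n) = (\<Sum>n\<le>k. ?D n / of_nat (Suc n))"
  proof (rule sum.cong[OF refl])
    show "((- 1) ^ n * ?D n / of_nat (Suc n)) * (- 1) ^ n = ?D n / of_nat (Suc n)" for n
      by (cases "even n") (simp_all del: of_nat_Suc)
  qed
  also have "\<dots> = of_rat (zeta_numerator k)"
    unfolding zeta_numerator_def of_rat_sum of_rat_divide of_rat_of_nat_eq ..
  finally show ?thesis .
qed

definition unit_power_sum :: "nat \<Rightarrow> nat \<Rightarrow> 'a" where
  "unit_power_sum k N = (\<Sum>a\<in>unit_residues N. of_nat a ^ k)"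

text \<open>The numbers from 1 to p^(N+1) are the unit residues and p times the numbers from 1 to
  p^N; removing the latter produces the Euler factor.\<close>

lemma unit_power_sum_Suc:
  "unit_power_sum k (Suc N) = power_sum k (p ^ Suc N) - of_nat p ^ k * power_sum k (p ^ N)"
proof -
  have ps: "power_sum k M = (\<Sum>a\<in>{1..M}. of_nat a ^ k)" for M
    unfolding power_sum_def by (rule sum.reindex_bij_witness[of _ "\<lambda>a. a - 1" Suc]) auto
  have un: "{1..p ^ Suc N} = unit_residues (Suc N) \<union> (\<lambda>a. p * a) ` {1..p ^ N}"
  proof (intro equalityI subsetI)
    fix a assume a: "a \<in> {1..p ^ Suc N}"
    show "a \<in> unit_residues (Suc N) \<union> (\<lambda>a. p * a) ` {1..p ^ N}"
    proof (cases "p dvd a")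
      case True
      then obtain b where b: "a = p * b" ..
      then have "b \<noteq> 0" "p * b \<le> p * p ^ N" using a by auto
      then have "b \<in> {1..p ^ N}" using p_gt_2 by simp
      then show ?thesis using b by blast
    next
      case False
      then have "a \<noteq> p ^ Suc N" by auto
      then show ?thesis using a False by (auto simp: unit_residues_def)
    qed
  next
    fix a assume "a \<in> unit_residues (Suc N) \<union> (\<lambda>a. p * a) ` {1..p ^ N}"
    then show "a \<in> {1..p ^ Suc N}" using p_gt_2
      by (auto simp: unit_residues_def Suc_le_eq intro: gr0I)
  qed
  have "power_sum k (p ^ Suc N) = unit_power_sum k (Suc N) + (\<Sum>a\<in>(\<lambda>a. p * a) ` {1..p ^ N}. of_nat a ^ k)"
    unfolding ps un unit_power_sum_def by (rule sum.union_disjoint) (auto simp: unit_residues_def)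
  also have "(\<Sum>a\<in>(\<lambda>a. p * a) ` {1..p ^ N}. of_nat a ^ k :: 'a) = (\<Sum>a\<in>{1..p ^ N}. of_nat (p * a) ^ k)"
    using p_gt_2 by (subst sum.reindex) (auto intro: inj_onI)
  also have "\<dots> = of_nat p ^ k * power_sum k (p ^ N)"
    unfolding ps by (simp add: power_mult_distrib sum_distrib_left)
  finally show ?thesis by simp
qed

text \<open>The factor is written p^k / p because k = 0 occurs too, where truncated subtraction in
  the exponent would be wrong.\<close>

lemma unit_power_sum_tendsto:
  "(\<lambda>N. unit_power_sum k (Suc N) / of_nat p ^ Suc N) \<longlonglongrightarrow>
     (1 - of_nat p ^ k / of_nat p) * of_rat (zeta_numerator k)"
proof -
  have eq: "unit_power_sum k (Suc N) / of_nat p ^ Suc N =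
     power_sum k (p ^ Suc N) / of_nat p ^ Suc N - (of_nat p ^ k / of_nat p) * (power_sum k (p ^ N) / of_nat p ^ N)" for N
    unfolding unit_power_sum_Suc by (simp add: diff_divide_distrib)
  have "(\<lambda>N. power_sum k (p ^ Suc N) / of_nat p ^ Suc N) \<longlonglongrightarrow> of_rat (zeta_numerator k)"
    using power_sum_tendsto by (rule LIMSEQ_Suc)
  then have "(\<lambda>N. unit_power_sum k (Suc N) / of_nat p ^ Suc N) \<longlonglongrightarrow>
     of_rat (zeta_numerator k) - (of_nat p ^ k / of_nat p) * of_rat (zeta_numerator k)"
    unfolding eq by (intro padic_tendsto_diff padic_tendsto_const_mult power_sum_tendsto)
  then show ?thesis by (simp add: left_diff_distrib)
qed

text \<open>The sum is p^(N+1) times a convergent quotient. This disposes of the constant part of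
  the regularised distribution.\<close>

lemma unit_power_sum_tendsto_0: "(\<lambda>N. unit_power_sum k (Suc N)) \<longlonglongrightarrow> 0"
proof -
  let ?l = "(1 - of_nat p ^ k / of_nat p) * of_rat (zeta_numerator k) :: 'a"
  let ?q = "\<lambda>N. unit_power_sum k (Suc N) / of_nat p ^ Suc N"
  have 1: "(\<lambda>N. of_nat (p ^ Suc N) * (?q N - ?l)) \<longlonglongrightarrow> 0"
    using padic_tendsto_diff[OF unit_power_sum_tendsto[of k] tendsto_const[of ?l]]
    by (intro padic_tendsto_0_mult_bounded absval_of_nat_le_1) simp
  have 2: "(\<lambda>N. ?l * of_nat (p ^ Suc N)) \<longlonglongrightarrow> ?l * 0"
    by (intro padic_tendsto_const_mult LIMSEQ_Suc of_nat_p_power_tendsto_0)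
  have "of_nat (p ^ Suc N) * (?q N - ?l) + ?l * of_nat (p ^ Suc N) = unit_power_sum k (Suc N)" for N
    by (simp add: right_diff_distrib)
  then show ?thesis using padic_tendsto_add[OF 1 2] by simp
qed

text \<open>A first-order expansion with quadratic error: passing from k to k + 1 multiplies the old
  error by a and subtracts (a - b) (a^(k+1) - b^(k+1)), a product of two terms of size at most
  p^-N.\<close>

lemma absval_power_Suc_linear_le:
  assumes "absval (a::'a) \<le> 1" "absval b \<le> 1" "absval (a - b) \<le> rad N"
  shows "absval (a ^ Suc k - b ^ Suc k - of_nat (Suc k) * a ^ k * (a - b)) \<le> rad N * rad N"
proof (induction k)
  case (Suc k)
  have "a ^ Suc (Suc k) - b ^ Suc (Suc k) - of_nat (Suc (Suc k)) * a ^ Suc k * (a - b) =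
      a * (a ^ Suc k - b ^ Suc k - of_nat (Suc k) * a ^ k * (a - b)) - (a - b) * (a ^ Suc k - b ^ Suc k)"
    by (simp add: algebra_simps)
  also have "absval \<dots> \<le> rad N * rad N"
  proof (rule absval_diff_le[OF absval_mult_le_left[OF assms(1) Suc] absval_mult_le[OF assms(3)]])
    show "absval (a ^ Suc k - b ^ Suc k) \<le> rad N"
      using absval_power_diff_le[OF assms(1,2), of "Suc k"] assms(3) by (rule order_trans)
  qed
  finally show ?case .
qed simp

text \<open>Let b be \<alpha>^-1 times the residue of \<alpha> a. Then (k+1) a^k (a - b) agrees with
  a^(k+1) - b^(k+1) modulo p^(2N), so after division by p^N the sum is, up to a vanishing error, 1 -
  \<alpha>^-(k+1) times a power sum over p^N. The factor k + 1 stays on the left, as it need not be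
  a unit.\<close>

lemma regularized_moment_tendsto:
  assumes \<alpha>: "\<alpha> \<in> units"
  shows "(\<lambda>N. of_nat (Suc k) * (\<Sum>a\<in>unit_residues (Suc N). of_nat a ^ k * regularized_dist \<alpha> (Suc N) a))
    \<longlonglongrightarrow> (1 - inverse \<alpha> ^ Suc k) * ((1 - of_nat p ^ k) * of_rat (zeta_numerator (Suc k)))"
proof -
  define u where "u = (\<lambda>N a. of_nat a - inverse \<alpha> * of_nat (act \<alpha> N a))"
  define err where "err = (\<lambda>N a. of_nat a ^ Suc k - (inverse \<alpha> * of_nat (act \<alpha> N a)) ^ Suc k
      - of_nat (Suc k) * of_nat a ^ k * u N a)"
  define E where "E = (\<lambda>N. (\<Sum>a\<in>unit_residues N. err N a) / of_nat p ^ N)"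
  have err: "absval (err N a) \<le> rad N * rad N" if "a \<in> unit_residues N" for N a
    unfolding err_def u_def using absval_act_inverse_le[OF \<alpha> that] \<alpha>
    by (intro absval_power_Suc_linear_le)
      (auto simp: absval_of_nat_le_1 absval_mult absval_inverse absval_unit)
  have "absval (E N) \<le> rad N" for N
  proof -
    have "absval (\<Sum>a\<in>unit_residues N. err N a) \<le> rad N * rad N"
      using err by (intro absval_sum_le) auto
    then show ?thesis by (simp add: E_def absval_divide absval_p_power divide_le_eq)
  qed
  then have E: "E \<longlonglongrightarrow> 0"
    unfolding tendsto_absval by (intro Lim_null_comparison[OF _ rad_tendsto_0] always_eventually) (simp add: absval_nonneg)
  \<comment> \<open>Multiplication by \<alpha> permutes the unit residues.\<close>
  have act_sum: "(\<Sum>a\<in>unit_residues (Suc N). of_nat (act \<alpha> (Suc N) a) ^ Suc k) = unit_power_sum (Suc k) (Suc N)" for N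
    unfolding unit_power_sum_def
    using sum.reindex_bij_betw[OF bij_betw_act[OF \<alpha>, of "Suc N"], of "\<lambda>a. of_nat a ^ Suc k"] by simp
  have eq: "of_nat (Suc k) * (\<Sum>a\<in>unit_residues (Suc N). of_nat a ^ k * regularized_dist \<alpha> (Suc N) a) =
     (1 - inverse \<alpha> ^ Suc k) * (unit_power_sum (Suc k) (Suc N) / of_nat p ^ Suc N) - E (Suc N)
      + (of_nat (Suc k) * ((inverse \<alpha> - 1) / 2)) * unit_power_sum k (Suc N)" for N
  proof -
    let ?P = "of_nat p ^ Suc N :: 'a"
    define c where "c = (inverse \<alpha> - 1) / 2"
    have "of_nat (Suc k) * (of_nat a ^ k * regularized_dist \<alpha> (Suc N) a) =
       of_nat a ^ Suc k / ?P - inverse \<alpha> ^ Suc k * of_nat (act \<alpha> (Suc N) a) ^ Suc k / ?P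
        - err (Suc N) a / ?P + of_nat (Suc k) * c * of_nat a ^ k" for a
    proof -
      have "of_nat (Suc k) * of_nat a ^ k * u (Suc N) a =
         of_nat a ^ Suc k - inverse \<alpha> ^ Suc k * of_nat (act \<alpha> (Suc N) a) ^ Suc k - err (Suc N) a"
        by (simp only: err_def power_mult_distrib) simp
      then have "of_nat (Suc k) * of_nat a ^ k * u (Suc N) a / ?P =
         of_nat a ^ Suc k / ?P - inverse \<alpha> ^ Suc k * of_nat (act \<alpha> (Suc N) a) ^ Suc k / ?P - err (Suc N) a / ?P"
        by (simp only: diff_divide_distrib)
      moreover have "regularized_dist \<alpha> (Suc N) a = u (Suc N) a / ?P + c"
        by (simp only: regularized_dist_eq u_def c_def)
      ultimately show ?thesis by (simp only: distrib_left mult.assoc times_divide_eq_right mult.commute[of c])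
    qed
    then have "of_nat (Suc k) * (\<Sum>a\<in>unit_residues (Suc N). of_nat a ^ k * regularized_dist \<alpha> (Suc N) a) =
       unit_power_sum (Suc k) (Suc N) / ?P
        - inverse \<alpha> ^ Suc k * (\<Sum>a\<in>unit_residues (Suc N). of_nat (act \<alpha> (Suc N) a) ^ Suc k) / ?P
        - E (Suc N) + of_nat (Suc k) * c * unit_power_sum k (Suc N)"
      unfolding unit_power_sum_def E_def
      by (simp only: sum_distrib_left sum_divide_distrib sum.distrib sum_subtractf)
    then show ?thesis unfolding act_sum c_def[symmetric] by (simp only: left_diff_distrib mult_1 times_divide_eq_right diff_divide_distrib)
  qed
  have "(\<lambda>N. (1 - inverse \<alpha> ^ Suc k) * (unit_power_sum (Suc k) (Suc N) / of_nat p ^ Suc N) - E (Suc N)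
      + (of_nat (Suc k) * ((inverse \<alpha> - 1) / 2)) * unit_power_sum k (Suc N)) \<longlonglongrightarrow>
    (1 - inverse \<alpha> ^ Suc k) * ((1 - of_nat p ^ Suc k / of_nat p) * of_rat (zeta_numerator (Suc k))) - 0
      + (of_nat (Suc k) * ((inverse \<alpha> - 1) / 2)) * 0"
    by (intro padic_tendsto_add padic_tendsto_diff padic_tendsto_const_mult unit_power_sum_tendsto
        unit_power_sum_tendsto_0 LIMSEQ_Suc E)
  then show ?thesis unfolding eq by simp
qed

text \<open>For k > 0 this is zeta(1 - k), by \<open>riemann_zeta_one_minus_of_nat\<close>.\<close>

definition zeta_value :: "nat \<Rightarrow> rat" where
  "zeta_value k = - zeta_numerator k / of_nat k"

text \<open>The (k-1)-th moment of the regularised measure carries the value at 1 - k, so the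
  density 1/x, available on units, shifts the order by one. Taking \<alpha> = 1/g makes the factor 1
  - g^k, whose sign is absorbed by zeta(1 - k) = -B_k / k.\<close>

lemma ex_zeta_measure:
  assumes g: "g \<in> units"
  obtains \<mu> where "\<mu> \<in> measures"
    "\<And>k. k > 0 \<Longrightarrow> moment \<mu> k = (g ^ k - 1) * of_rat ((1 - of_nat p ^ (k - 1)) * zeta_value k)"
proof -
  let ?\<alpha> = "inverse g"
  have \<alpha>: "?\<alpha> \<in> units" by (rule units_inverse[OF g])
  obtain \<nu> where \<nu>: "\<nu> \<in> measures"
    "\<And>f. integrand f \<Longrightarrow> (\<lambda>N. \<Sum>a\<in>unit_residues N. f (of_nat a) * regularized_dist ?\<alpha> N a) \<longlonglongrightarrow> integ \<nu> f"
    using measure_of_distribution[OF absval_regularized_dist_le_1[OF \<alpha>] regularized_dist_additive[OF \<alpha>]]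
    by blast
  define \<mu> where "\<mu> = (\<lambda>\<phi>\<in>cfuns. integ \<nu> (\<lambda>x. inverse x * \<phi> x))"
  note inv = integrand_mult[OF integrand_inverse]
  have r: "integ \<nu> (\<lambda>x. inverse x * restrict f units x) = integ \<nu> (\<lambda>x. inverse x * f x)" for f
    by (rule integ_cong) simp
  have "\<mu> \<in> measures"
    unfolding \<mu>_def
  proof (rule measureI, unfold r)
    fix f h c n assume f: "integrand f"
    show "integ \<nu> (\<lambda>x. inverse x * (c * f x)) = c * integ \<nu> (\<lambda>x. inverse x * f x)" if "absval c \<le> 1"
      using integ_cmult[OF \<nu>(1) inv[OF f] that] by (simp add: mult_ac)
    show "absval (integ \<nu> (\<lambda>x. inverse x * f x)) \<le> 1"
      by (rule absval_integ_le_1[OF \<nu>(1) inv[OF f]])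
    assume h: "integrand h"
    show "integ \<nu> (\<lambda>x. inverse x * (f x + h x)) = integ \<nu> (\<lambda>x. inverse x * f x) + integ \<nu> (\<lambda>x. inverse x * h x)"
      using integ_add[OF \<nu>(1) inv[OF f] inv[OF h]] by (simp add: distrib_left)
    assume close: "\<And>x. x \<in> units \<Longrightarrow> absval (f x - h x) \<le> rad n"
    show "absval (integ \<nu> (\<lambda>x. inverse x * f x) - integ \<nu> (\<lambda>x. inverse x * h x)) \<le> rad n"
    proof (rule absval_integ_diff_le[OF \<nu>(1) inv[OF f] inv[OF h]])
      fix x assume "x \<in> units"
      then show "absval (inverse x * f x - inverse x * h x) \<le> rad n"
        using absval_unit_mult_diff[OF units_inverse] close by simp
    qed
  qed
  moreover have "moment \<mu> k = (g ^ k - 1) * of_rat ((1 - of_nat p ^ (k - 1)) * zeta_value k)" if k0: "k > 0" for k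
  proof -
    obtain j where k: "k = Suc j" using k0 by (cases k) auto
    have "moment \<mu> k = integ \<nu> (\<lambda>x. inverse x * x ^ k)"
      unfolding moment_def \<mu>_def by (subst integ_restrict[OF integrand_monomial]) (rule r)
    also have "\<dots> = integ \<nu> (\<lambda>x. x ^ j)"
      by (rule integ_cong) (simp add: k unit_nonzero)
    finally have m: "moment \<mu> k = integ \<nu> (\<lambda>x. x ^ j)" .
    have "(\<lambda>N. of_nat (Suc j) * (\<Sum>a\<in>unit_residues (Suc N). of_nat a ^ j * regularized_dist ?\<alpha> (Suc N) a))
       \<longlonglongrightarrow> of_nat (Suc j) * moment \<mu> k"
      unfolding m by (intro padic_tendsto_const_mult LIMSEQ_Suc \<nu>(2)[OF integrand_monomial])
    then have "of_nat (Suc j) * moment \<mu> k =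
        (1 - g ^ Suc j) * ((1 - of_nat p ^ j) * of_rat (zeta_numerator (Suc j)))"
      using LIMSEQ_unique[OF _ regularized_moment_tendsto[OF \<alpha>, of j]] by simp
    then have "moment \<mu> k = (1 - g ^ k) * ((1 - of_nat p ^ j) * of_rat (zeta_numerator k)) / of_nat k"
      unfolding k by (simp add: field_simps del: of_nat_Suc power_Suc)
    also have "\<dots> = (g ^ k - 1) * of_rat ((1 - of_nat p ^ (k - 1)) * zeta_value k)"
      by (simp add: zeta_value_def k of_rat_mult of_rat_divide of_rat_diff of_rat_power of_rat_minus
          field_simps del: of_nat_Suc power_Suc)
    finally show ?thesis .
  qed
  ultimately show ?thesis by (rule that)
qed

section \<open>Pseudo-measures and their integrals\<close>

definition aug :: "'a \<Rightarrow> ('a \<Rightarrow> 'a) \<Rightarrow> 'a" where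
  "aug g = dirac Zp_units g \<ominus>\<^bsub>iwasawa\<^esub> dirac Zp_units 1"

lemma aug_in_measures: "g \<in> units \<Longrightarrow> aug g \<in> measures"
  unfolding aug_def by (intro iwasawa_minus_closed dirac_in_measures one_in_units)

lemma moment_aug: "g \<in> units \<Longrightarrow> moment (aug g) k = g ^ k - 1"
  unfolding aug_def by (simp add: moment_iwasawa_minus dirac_in_measures moment_dirac)

lemma two_in_units: "2 \<in> units"
  using of_nat_in_units_iff[of 2] p_gt_2 by (auto dest: dvd_imp_le)

lemma two_power_neq_1: "k > 0 \<Longrightarrow> (2::'a) ^ k \<noteq> 1"
  using of_nat_eq_iff[of "2 ^ k" 1, where 'a = 'a] by simp

text \<open>The moments are 2^k - 1, nonzero for k > 0 in characteristic 0; the one of order 0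
  vanishes, but only positive orders count.\<close>

lemma aug_two_regular: "aug 2 \<in> regular_elements iwasawa"
  by (rule iwasawa_regularI) (auto simp: aug_in_measures moment_aug two_in_units two_power_neq_1)

lemma augmentation_mult_fraction:
  assumes "g \<in> units" "a \<in> measures" "s \<in> regular_elements iwasawa"
  shows "augmentation_mult Zp_units g (fraction iwasawa a s) = fraction iwasawa (aug g \<otimes>\<^bsub>iwasawa\<^esub> a) s"
  using iwasawa.fraction_embed_mult_fraction[of "aug g" a s] assms aug_in_measures
  unfolding augmentation_mult_def aug_def by (simp add: iwasawa_simps(1))

text \<open>Translates the conditions in the ring of fractions into divisibilities in the Iwasawa
  algebra, with one family \<mu> of quotients.\<close>

lemma pseudo_measuresE:
  assumes "\<xi> \<in> pseudo_measures Zp_units"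
  obtains a s \<mu> where "a \<in> measures" "s \<in> regular_elements iwasawa" "\<xi> = fraction iwasawa a s"
    "\<And>g. g \<in> units \<Longrightarrow> \<mu> g \<in> measures"
    "\<And>g. g \<in> units \<Longrightarrow> aug g \<otimes>\<^bsub>iwasawa\<^esub> a = \<mu> g \<otimes>\<^bsub>iwasawa\<^esub> s"
proof -
  from assms have \<xi>: "\<xi> \<in> carrier (total_fraction_ring iwasawa)"
    and emb: "\<And>g. g \<in> units \<Longrightarrow> augmentation_mult Zp_units g \<xi> \<in> fraction_embed iwasawa ` measures"
    by (auto simp: pseudo_measures_def iwasawa_simps(1))
  from \<xi> obtain a s where as: "a \<in> measures" "s \<in> regular_elements iwasawa" "\<xi> = fraction iwasawa a s"
    by (rule iwasawa.total_fraction_ring_carrierE) (simp add: iwasawa_simps(1))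
  have "\<exists>\<mu>\<in>measures. aug g \<otimes>\<^bsub>iwasawa\<^esub> a = \<mu> \<otimes>\<^bsub>iwasawa\<^esub> s" if g: "g \<in> units" for g
  proof -
    obtain \<mu> where \<mu>: "\<mu> \<in> measures" "fraction iwasawa (aug g \<otimes>\<^bsub>iwasawa\<^esub> a) s = fraction_embed iwasawa \<mu>"
      using emb[OF g] augmentation_mult_fraction[OF g as(1,2)] as(3) by auto
    then have "aug g \<otimes>\<^bsub>iwasawa\<^esub> a = \<mu> \<otimes>\<^bsub>iwasawa\<^esub> s"
      using iwasawa.fraction_eq_embed_iff[of "aug g \<otimes>\<^bsub>iwasawa\<^esub> a" s \<mu>]
        iwasawa_mult_closed[OF aug_in_measures[OF g] as(1)] as(2) by (simp add: iwasawa_simps(1))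
    then show ?thesis using \<mu>(1) by blast
  qed
  then obtain \<mu> where "\<And>g. g \<in> units \<Longrightarrow> \<mu> g \<in> measures \<and> aug g \<otimes>\<^bsub>iwasawa\<^esub> a = \<mu> g \<otimes>\<^bsub>iwasawa\<^esub> s"
    by metis
  then show ?thesis using that as by blast
qed

text \<open>Cancelling s gives ([h] - [1]) \<mu> = ([g] - [1]) \<nu>; on moments this says that the
  integral of a pseudo-measure does not depend on the auxiliary group element.\<close>

lemma moment_regular_fraction:
  assumes "\<mu> \<in> measures" "\<nu> \<in> measures" "g \<in> units" "h \<in> units" "a \<in> measures"
    and "s \<in> regular_elements iwasawa"
    and "aug g \<otimes>\<^bsub>iwasawa\<^esub> a = \<mu> \<otimes>\<^bsub>iwasawa\<^esub> s" "aug h \<otimes>\<^bsub>iwasawa\<^esub> a = \<nu> \<otimes>\<^bsub>iwasawa\<^esub> s"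
  shows "(h ^ k - 1) * moment \<mu> k = (g ^ k - 1) * moment \<nu> k"
proof -
  have s: "s \<in> measures" using iwasawa.regular_elementsD[OF assms(6)] by (simp add: iwasawa_simps(1))
  have mem: "aug g \<in> measures" "aug h \<in> measures" using assms by (auto intro: aug_in_measures)
  note carr = assms(1,2,5) s mem
  have "(aug h \<otimes>\<^bsub>iwasawa\<^esub> \<mu>) \<otimes>\<^bsub>iwasawa\<^esub> s = (aug g \<otimes>\<^bsub>iwasawa\<^esub> \<nu>) \<otimes>\<^bsub>iwasawa\<^esub> s"
  proof -
    have "(aug h \<otimes>\<^bsub>iwasawa\<^esub> \<mu>) \<otimes>\<^bsub>iwasawa\<^esub> s = aug h \<otimes>\<^bsub>iwasawa\<^esub> (aug g \<otimes>\<^bsub>iwasawa\<^esub> a)"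
      unfolding assms(7) using carr[folded iwasawa_simps(1)] by (intro iwasawa.m_assoc)
    also have "\<dots> = aug g \<otimes>\<^bsub>iwasawa\<^esub> (aug h \<otimes>\<^bsub>iwasawa\<^esub> a)"
      using carr[folded iwasawa_simps(1)] by (intro iwasawa.m_lcomm)
    also have "\<dots> = (aug g \<otimes>\<^bsub>iwasawa\<^esub> \<nu>) \<otimes>\<^bsub>iwasawa\<^esub> s"
      unfolding assms(8) using carr[folded iwasawa_simps(1)] by (intro iwasawa.m_assoc[symmetric])
    finally show ?thesis .
  qed
  then have "aug h \<otimes>\<^bsub>iwasawa\<^esub> \<mu> = aug g \<otimes>\<^bsub>iwasawa\<^esub> \<nu>"
    using iwasawa.regular_elements_cancel[OF assms(6)] iwasawa_mult_closed carr by (simp add: iwasawa_simps(1))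
  then have "moment (aug h) k * moment \<mu> k = moment (aug g) k * moment \<nu> k"
    using moment_iwasawa_mult carr by metis
  then show ?thesis by (simp add: moment_aug assms)
qed

text \<open>The group element in the definition is an unspecified choice that varies with k; the
  preceding relation replaces it by 2 for all k.\<close>

lemma pseudo_measure_integral_eq:
  assumes a: "a \<in> measures" and s: "s \<in> regular_elements iwasawa" and \<xi>: "\<xi> = fraction iwasawa a s"
    and \<mu>: "\<And>g. g \<in> units \<Longrightarrow> \<mu> g \<in> measures"
      "\<And>g. g \<in> units \<Longrightarrow> aug g \<otimes>\<^bsub>iwasawa\<^esub> a = \<mu> g \<otimes>\<^bsub>iwasawa\<^esub> s"
    and k: "k > 0"
  shows "pseudo_measure_integral Zp_units \<xi> (\<lambda>x. x ^ k) = moment (\<mu> 2) k / (2 ^ k - 1)"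
proof -
  define g :: 'a where "g = (SOME g. g \<in> units \<and> g ^ k \<noteq> 1)"
  have g: "g \<in> units" "g ^ k \<noteq> 1"
    using someI_ex[of "\<lambda>g. g \<in> units \<and> g ^ k \<noteq> 1"] two_in_units two_power_neq_1[OF k]
    unfolding g_def by blast+
  have mg: "aug g \<otimes>\<^bsub>iwasawa\<^esub> a \<in> measures" by (intro iwasawa_mult_closed aug_in_measures g a)
  have "augmentation_mult Zp_units g \<xi> = fraction_embed iwasawa (\<mu> g)"
    unfolding \<xi> augmentation_mult_fraction[OF g(1) a s]
    using iwasawa.fraction_eq_embed_iff[of "aug g \<otimes>\<^bsub>iwasawa\<^esub> a" s "\<mu> g"] mg s \<mu>[OF g(1)]
    by (simp add: iwasawa_simps(1))
  moreover have "inj_on (fraction_embed iwasawa) (carrier iwasawa)"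
    by (rule inj_onI) (simp add: iwasawa.fraction_embed_eq_iff)
  ultimately have "the_inv_into (carrier iwasawa) (fraction_embed iwasawa) (augmentation_mult Zp_units g \<xi>) = \<mu> g"
    using \<mu>(1)[OF g(1)] by (simp add: the_inv_into_f_f iwasawa_simps(1))
  then have "pseudo_measure_integral Zp_units \<xi> (\<lambda>x. x ^ k) = inverse (g ^ k - 1) * moment (\<mu> g) k"
    unfolding pseudo_measure_integral_def moment_def g_def[symmetric] by (simp add: Let_def)
  moreover have "(2 ^ k - 1) * moment (\<mu> g) k = (g ^ k - 1) * moment (\<mu> 2) k"
    by (intro moment_regular_fraction[where a = a and s = s] \<mu> a s g two_in_units)
  ultimately show ?thesis
    using g(2) two_power_neq_1[OF k] inverse_mult_eq_divide[of "2 ^ k - 1" "g ^ k - 1"] by simp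
qed

text \<open>Equal integrals give ([2] - [1]) \<xi> and ([2] - [1]) \<eta> the same moments of
  positive order, so these measures coincide; the regular factor is then cancelled from the
  cross-multiplied fractions.\<close>

lemma pseudo_measure_eqI:
  assumes "\<xi> \<in> pseudo_measures (Zp_units :: 'a monoid)" "\<eta> \<in> pseudo_measures (Zp_units :: 'a monoid)"
    and eq: "\<And>k. k > 0 \<Longrightarrow> pseudo_measure_integral Zp_units \<xi> (\<lambda>x. x ^ k) =
        pseudo_measure_integral Zp_units \<eta> (\<lambda>x. x ^ k)"
  shows "\<xi> = \<eta>"
proof -
  obtain a s \<mu> where \<xi>: "a \<in> measures" "s \<in> regular_elements iwasawa" "\<xi> = fraction iwasawa a s"
    "\<And>g. g \<in> units \<Longrightarrow> \<mu> g \<in> measures"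
    "\<And>g. g \<in> units \<Longrightarrow> aug g \<otimes>\<^bsub>iwasawa\<^esub> a = \<mu> g \<otimes>\<^bsub>iwasawa\<^esub> s"
    using assms(1) by (rule pseudo_measuresE) blast
  obtain b t \<nu> where \<eta>: "b \<in> measures" "t \<in> regular_elements iwasawa" "\<eta> = fraction iwasawa b t"
    "\<And>g. g \<in> units \<Longrightarrow> \<nu> g \<in> measures"
    "\<And>g. g \<in> units \<Longrightarrow> aug g \<otimes>\<^bsub>iwasawa\<^esub> b = \<nu> g \<otimes>\<^bsub>iwasawa\<^esub> t"
    using assms(2) by (rule pseudo_measuresE) blast
  have two: "\<mu> 2 = \<nu> 2"
  proof (rule measure_eqI_moments)
    fix k :: nat assume k: "k > 0"
    then show "moment (\<mu> 2) k = moment (\<nu> 2) k"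
      using eq[OF k] pseudo_measure_integral_eq[OF \<xi> k] pseudo_measure_integral_eq[OF \<eta> k]
        two_power_neq_1[OF k] by simp
  qed (use \<xi>(4) \<eta>(4) two_in_units in auto)
  have st: "s \<in> carrier iwasawa" "t \<in> carrier iwasawa"
    using iwasawa.regular_elementsD \<xi>(2) \<eta>(2) by auto
  have c: "a \<in> carrier iwasawa" "b \<in> carrier iwasawa" "aug 2 \<in> carrier iwasawa" "\<nu> 2 \<in> carrier iwasawa"
    using \<xi>(1) \<eta>(1,4) two_in_units aug_in_measures by (auto simp: iwasawa_simps(1))
  have "(a \<otimes>\<^bsub>iwasawa\<^esub> t) \<otimes>\<^bsub>iwasawa\<^esub> aug 2 = (aug 2 \<otimes>\<^bsub>iwasawa\<^esub> a) \<otimes>\<^bsub>iwasawa\<^esub> t"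
    using c st by (simp add: iwasawa.m_ac)
  also have "\<dots> = (aug 2 \<otimes>\<^bsub>iwasawa\<^esub> b) \<otimes>\<^bsub>iwasawa\<^esub> s"
    unfolding \<xi>(5)[OF two_in_units] \<eta>(5)[OF two_in_units] two using c st by (simp add: iwasawa.m_ac)
  also have "\<dots> = (b \<otimes>\<^bsub>iwasawa\<^esub> s) \<otimes>\<^bsub>iwasawa\<^esub> aug 2"
    using c st by (simp add: iwasawa.m_ac)
  finally have "a \<otimes>\<^bsub>iwasawa\<^esub> t = b \<otimes>\<^bsub>iwasawa\<^esub> s"
    using iwasawa.regular_elements_cancel[OF aug_two_regular] c st by simp
  then show ?thesis
    unfolding \<xi>(3) \<eta>(3) using iwasawa.fraction_eq_iff \<xi>(2) \<eta>(2) c by simp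
qed

lemma ex_zeta_pseudo_measure:
  "\<exists>\<xi>\<in>pseudo_measures Zp_units. \<forall>k>0. pseudo_measure_integral Zp_units \<xi> (\<lambda>x. x ^ k) =
     (of_rat ((1 - of_nat p ^ (k - 1)) * zeta_value k) :: 'a)"
proof -
  define z where "z = (\<lambda>k. of_rat ((1 - of_nat p ^ (k - 1)) * zeta_value k) :: 'a)"
  have "\<forall>g\<in>units. \<exists>\<mu>. \<mu> \<in> measures \<and> (\<forall>k>0. moment \<mu> k = (g ^ k - 1) * z k)"
    using ex_zeta_measure unfolding z_def by metis
  then obtain \<mu> where \<mu>: "\<And>g. g \<in> units \<Longrightarrow> \<mu> g \<in> measures"
    "\<And>g k. \<lbrakk>g \<in> units; k > 0\<rbrakk> \<Longrightarrow> moment (\<mu> g) k = (g ^ k - 1) * z k"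
    by metis
  define \<xi> where "\<xi> = fraction iwasawa (\<mu> 2) (aug 2)"
  note \<mu>2 = \<mu>(1)[OF two_in_units]
  \<comment> \<open>Both sides have k-th moment (g^k - 1) (2^k - 1) \<open>z k\<close> for k >
    0.\<close>
  have rel: "aug g \<otimes>\<^bsub>iwasawa\<^esub> \<mu> 2 = \<mu> g \<otimes>\<^bsub>iwasawa\<^esub> aug 2" if "g \<in> units" for g
    using that two_in_units by (intro measure_eqI_moments)
      (auto simp: iwasawa_mult_closed aug_in_measures moment_iwasawa_mult moment_aug \<mu>)
  have "\<xi> \<in> pseudo_measures Zp_units"
    unfolding pseudo_measures_def
  proof (intro CollectI conjI ballI)
    show "\<xi> \<in> carrier (total_fraction_ring iwasawa)"
      unfolding \<xi>_def using \<mu>2 aug_two_regular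
      by (intro iwasawa.fraction_in_carrier) (auto simp: iwasawa_simps(1))
    fix g :: 'a assume g: "g \<in> units"
    have "augmentation_mult Zp_units g \<xi> = fraction_embed iwasawa (\<mu> g)"
      unfolding \<xi>_def augmentation_mult_fraction[OF g \<mu>2 aug_two_regular] rel[OF g]
      using iwasawa.fraction_eq_embed_iff[OF _ aug_two_regular, of "\<mu> g \<otimes>\<^bsub>iwasawa\<^esub> aug 2" "\<mu> g"]
        iwasawa_mult_closed \<mu>(1)[OF g] aug_in_measures[OF two_in_units] by (simp add: iwasawa_simps(1))
    then show "augmentation_mult Zp_units g \<xi> \<in> fraction_embed iwasawa ` carrier iwasawa"
      using \<mu>(1)[OF g] by (simp add: iwasawa_simps(1))
  qed
  moreover have "pseudo_measure_integral Zp_units \<xi> (\<lambda>x. x ^ k) = z k" if "k > 0" for k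
    using pseudo_measure_integral_eq[OF \<mu>2 aug_two_regular \<xi>_def \<mu>(1) rel that]
      \<mu>(2)[OF two_in_units that] two_power_neq_1[OF that] by simp
  ultimately show ?thesis unfolding z_def by blast
qed

end

theorem theorem4p1:
  fixes p :: nat
  assumes "prime p" and "odd p"
    and "finite_extension_Qp p TYPE('a::{field_char_0,metric_space})"
  shows "\<exists>!\<zeta>\<^sub>p. \<zeta>\<^sub>p \<in> pseudo_measures (Zp_units :: 'a monoid) \<and>
    (\<forall>k::nat. k > 0 \<longrightarrow>
      (\<exists>q::rat. of_rat q = riemann_zeta (1 - of_nat k) \<and>
        pseudo_measure_integral Zp_units \<zeta>\<^sub>p (\<lambda>x. x ^ k) =
          (of_rat ((1 - of_nat p ^ (k - 1)) * q) :: 'a)))"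
proof -
  interpret padic_field p "TYPE('a)"
    using assms by unfold_locales
  \<comment> \<open>\<open>of_rat\<close> is injective, so the rational number in the statement is
    forced and the existential quantifier disappears.\<close>
  have zeta: "of_rat q = riemann_zeta (1 - of_nat k) \<longleftrightarrow> q = zeta_value k" if "k > 0" for q k
    using riemann_zeta_one_minus_of_nat[OF that] by (simp add: zeta_value_def)
  have char: "(\<forall>k::nat. k > 0 \<longrightarrow>
      (\<exists>q::rat. of_rat q = riemann_zeta (1 - of_nat k) \<and>
        pseudo_measure_integral Zp_units \<xi> (\<lambda>x. x ^ k) = (of_rat ((1 - of_nat p ^ (k - 1)) * q) :: 'a))) \<longleftrightarrow>
      (\<forall>k>0. pseudo_measure_integral Zp_units \<xi> (\<lambda>x. x ^ k) =
        (of_rat ((1 - of_nat p ^ (k - 1)) * zeta_value k) :: 'a))" for \<xi>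
    using zeta by metis
  obtain \<xi> where \<xi>: "\<xi> \<in> pseudo_measures (Zp_units :: 'a monoid)"
    "\<forall>k>0. pseudo_measure_integral Zp_units \<xi> (\<lambda>x. x ^ k) =
      (of_rat ((1 - of_nat p ^ (k - 1)) * zeta_value k) :: 'a)"
    using ex_zeta_pseudo_measure by blast
  show ?thesis
    unfolding char
  proof (rule ex1I[of _ \<xi>])
    fix \<eta> assume "\<eta> \<in> pseudo_measures (Zp_units :: 'a monoid) \<and>
      (\<forall>k>0. pseudo_measure_integral Zp_units \<eta> (\<lambda>x. x ^ k) =
        (of_rat ((1 - of_nat p ^ (k - 1)) * zeta_value k) :: 'a))"
    then show "\<eta> = \<xi>" using \<xi> by (intro pseudo_measure_eqI) auto
  qed (use \<xi> in blast)
qed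

end
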